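(* Let $\delta\le\kappa\le\lambda$ be uncountable cardinals with $\delta$ regular, and suppose that $\kappa$ has the $(\delta,2^{(\lambda^{<\kappa})})$-filter extension property (in particular, this is the case if $\kappa$ is $(\delta,2^{(\lambda^{<\kappa})})$-compact). Then there is a fine, ${<}\delta$-complete ultrafilter on $\mathcal P(\mathcal P_\kappa(\lambda))$, that is, $\kappa$ is $(\delta,\lambda)$-strongly compact; or equivalently, there is an elementary embedding $j\colon V\to W$ for some transitive class $W\subseteq V$, with critical point $\mathrm{crit}\,j\ge\delta$, and there is $D\in W$ with $j[\lambda]\subseteq D$ and $|D|<j(\kappa)$ in $W$.
   Context: Work in ZFC. Filters. Let $X$ be a set and $F\subseteq E\subseteq\mathcal P(X)$ with $E$ closed under complements in $X$ and $X\in E$. For an infinite cardinal $\kappa$, $F$ is a ${<}\kappa$-complete filter (on $E$) if: $X\in F$ and $\emptyset\notin F$; whenever $Y,Z\in E$, $Y\supseteq Z$ and $Z\in F$, then $Y\in F$; and whenever $(Y_i)_{i<\mu}$ is a family of elements of $F$ with $\mu<\kappa$, then $\bigcap_{i<\mu}Y_i\ne\emptyset$. A filter (i.e. a ${<}\omega$-complete filter) $F$ measures $E$ if for every $Y\in E$, $Y\in F$ or $X\setminus Y\in F$; an ultrafilter on $E$ is a filter on $E$ that measures $E$. For infinite cardinals $\delta\le\kappa\le\mu$ with $\delta$ regular, $\kappa$ has the $(\delta,\mu)$-filter extension property if whenever $X$ is a set, $E\subseteq\mathcal P(X)$ is of size at most $\mu$ and closed under complements in $X$ with $X\in E$, and $F\subseteq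 E$ is a ${<}\kappa$-complete filter on $E$, then $F$ can be extended to a ${<}\delta$-complete filter on $E$ that measures $E$. $\mathcal P_\kappa(A)$ is the collection of subsets of $A$ of cardinality less than $\kappa$. A filter $F\subseteq\mathcal P(\mathcal P_\kappa(A))$ is fine if $\{x\in\mathcal P_\kappa(A)\mid a\in x\}\in F$ for every $a\in A$. For uncountable cardinals $\delta\le\kappa\le\lambda$, $\kappa$ is $(\delta,\lambda)$-strongly compact if there is a fine, ${<}\delta$-complete ultrafilter on $\mathcal P(\mathcal P_\kappa(\lambda))$. For uncountable cardinals $\delta\le\kappa\le\mu$ with $\delta$ regular, $\kappa$ is $(\delta,\mu)$-compact if every $\mathcal L_{\delta,\omega}$-theory in a language of size at most $\mu$, all of whose subsets of size less than $\kappa$ have a model, has a model; here $\mathcal L_{\delta,\omega}$ extends first-order logic by conjunctions and disjunctions of size less than $\delta$, with formulas having only finitely many free variables. The critical point of an elementary embedding $j$ between transitive classes is the least ordinal $\alpha$ with $j(\alpha)>\alpha$; the statement $\mathrm{crit}\,j\ge\delta$ includes that $\mathrm{crit}\,j$ exists. *)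

theory Defs
  imports Main
begin

section \<open>First-order formulas of set theory\<close>

datatype fm =
    Member nat nat
  | Equal nat nat
  | Neg fm
  | Conj fm fm
  | Forall nat fm

primrec sat :: "'v set \<Rightarrow> ('v \<Rightarrow> 'v \<Rightarrow> bool) \<Rightarrow> (nat \<Rightarrow> 'v) \<Rightarrow> fm \<Rightarrow> bool" where
  "sat M mem s (Member i j) = mem (s i) (s j)"
| "sat M mem s (Equal i j) = (s i = s j)"
| "sat M mem s (Neg p) = (\<not> sat M mem s p)"
| "sat M mem s (Conj p q) = (sat M mem s p \<and> sat M mem s q)"
| "sat M mem s (Forall i p) = (\<forall>x\<in>M. sat M mem (s(i := x)) p)"


section \<open>Notions interpreted in a class with a membership relation\<close>

text \<open>
  Cardinality has to be computed both in the universe and in the target of an embedding.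
  So the notions it depends on are defined over an arbitrary domain \<open>M\<close>, with all
  quantifiers (also those implicit in descriptions) restricted to \<open>M\<close>.
\<close>

locale set_structure =
  fixes M :: "'v set"
    and mem :: "'v \<Rightarrow> 'v \<Rightarrow> bool"  (infix "\<epsilon>" 50)
begin

text \<open>The set \<open>{x | P x}\<close> of the structure; meaningful only if this class is a set there.\<close>

definition setof :: "('v \<Rightarrow> bool) \<Rightarrow> 'v" where
  "setof P = (THE y. y \<in> M \<and> (\<forall>x\<in>M. x \<epsilon> y \<longleftrightarrow> P x))"

definition upair :: "'v \<Rightarrow> 'v \<Rightarrow> 'v" where
  "upair a b = setof (\<lambda>x. x = a \<or> x = b)"

definition pair :: "'v \<Rightarrow> 'v \<Rightarrow> 'v" where
  "pair a b = upair (upair a a) (upair a b)"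

definition trans_set :: "'v \<Rightarrow> bool" where
  "trans_set x \<longleftrightarrow> (\<forall>y\<in>M. \<forall>z\<in>M. y \<epsilon> x \<and> z \<epsilon> y \<longrightarrow> z \<epsilon> x)"

text \<open>In the presence of the axiom of foundation, the transitive sets of transitive sets are
  exactly the transitive sets well-ordered by membership.\<close>

definition Ord :: "'v \<Rightarrow> bool" where
  "Ord x \<longleftrightarrow> trans_set x \<and> (\<forall>y\<in>M. y \<epsilon> x \<longrightarrow> trans_set y)"

definition func :: "'v \<Rightarrow> 'v \<Rightarrow> 'v \<Rightarrow> bool" where
  "func f a b \<longleftrightarrow>
     (\<forall>p\<in>M. p \<epsilon> f \<longrightarrow> (\<exists>x\<in>M. \<exists>y\<in>M. x \<epsilon> a \<and> y \<epsilon> b \<and> p = pair x y)) \<and>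
     (\<forall>x\<in>M. x \<epsilon> a \<longrightarrow> (\<exists>!y. y \<in> M \<and> pair x y \<epsilon> f))"

definition bijection :: "'v \<Rightarrow> 'v \<Rightarrow> 'v \<Rightarrow> bool" where
  "bijection f a b \<longleftrightarrow>
     func f a b \<and> (\<forall>y\<in>M. y \<epsilon> b \<longrightarrow> (\<exists>!x. x \<in> M \<and> pair x y \<epsilon> f))"

definition eqpoll :: "'v \<Rightarrow> 'v \<Rightarrow> bool" where
  "eqpoll a b \<longleftrightarrow> (\<exists>f\<in>M. bijection f a b)"

definition is_initial :: "'v \<Rightarrow> bool" where
  "is_initial \<alpha> \<longleftrightarrow> Ord \<alpha> \<and> (\<forall>\<beta>\<in>M. \<beta> \<epsilon> \<alpha> \<longrightarrow> \<not> eqpoll \<alpha> \<beta>)"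

definition card :: "'v \<Rightarrow> 'v" where
  "card x = (THE \<alpha>. \<alpha> \<in> M \<and> is_initial \<alpha> \<and> eqpoll x \<alpha>)"

end


section \<open>Models of ZFC\<close>

text \<open>
  First-order ZFC: the schemas range over formulas with parameters, not over arbitrary
  predicates on \<open>'v\<close>. No well-foundedness of \<open>mem\<close> outside the model is assumed.
  Everything below quantifies over elements of the model only, so that it is the
  interpretation in the model of a first-order notion; the exceptions are classes, which are
  predicates definable with parameters, and elementarity.
\<close>

locale ZFC = set_structure "UNIV :: 'v set" mem
  for mem :: "'v \<Rightarrow> 'v \<Rightarrow> bool"  (infix "\<epsilon>" 50) +
  assumes extensionality: "(\<forall>z. z \<epsilon> x \<longleftrightarrow> z \<epsilon> y) \<longrightarrow> x = y"
    and foundation: "(\<exists>y. y \<epsilon> x) \<longrightarrow> (\<exists>y. y \<epsilon> x \<and> \<not> (\<exists>z. z \<epsilon> x \<and> z \<epsilon> y))"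
    and pairing: "\<exists>z. \<forall>w. w \<epsilon> z \<longleftrightarrow> w = x \<or> w = y"
    and union: "\<exists>z. \<forall>w. w \<epsilon> z \<longleftrightarrow> (\<exists>y. y \<epsilon> x \<and> w \<epsilon> y)"
    and power_set: "\<exists>z. \<forall>w. w \<epsilon> z \<longleftrightarrow> (\<forall>y. y \<epsilon> w \<longrightarrow> y \<epsilon> x)"
    and infinity: "\<exists>z. (\<exists>e. e \<epsilon> z \<and> (\<forall>w. \<not> w \<epsilon> e)) \<and>
      (\<forall>x. x \<epsilon> z \<longrightarrow> (\<exists>y. y \<epsilon> z \<and> (\<forall>w. w \<epsilon> y \<longleftrightarrow> w \<epsilon> x \<or> w = x)))"
    and separation: "\<exists>z. \<forall>w. w \<epsilon> z \<longleftrightarrow> w \<epsilon> x \<and> sat UNIV mem (s(0 := w)) p"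
    and replacement:
      "(\<forall>w. w \<epsilon> x \<longrightarrow> (\<exists>!y. sat UNIV mem (s(0 := w, 1 := y)) p)) \<longrightarrow>
       (\<exists>z. \<forall>y. y \<epsilon> z \<longleftrightarrow> (\<exists>w. w \<epsilon> x \<and> sat UNIV mem (s(0 := w, 1 := y)) p))"
    and choice:
      "(\<forall>y. y \<epsilon> x \<longrightarrow> (\<exists>w. w \<epsilon> y)) \<and>
       (\<forall>y y'. y \<epsilon> x \<and> y' \<epsilon> x \<and> y \<noteq> y' \<longrightarrow> \<not> (\<exists>w. w \<epsilon> y \<and> w \<epsilon> y')) \<longrightarrow>
       (\<exists>c. \<forall>y. y \<epsilon> x \<longrightarrow> (\<exists>!w. w \<epsilon> y \<and> w \<epsilon> c))"
begin

subsection \<open>Sets, numbers and cardinals\<close>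

definition subset :: "'v \<Rightarrow> 'v \<Rightarrow> bool" where
  "subset x y \<longleftrightarrow> (\<forall>z. z \<epsilon> x \<longrightarrow> z \<epsilon> y)"

definition empty :: 'v where
  "empty = setof (\<lambda>x. False)"

definition adjoin :: "'v \<Rightarrow> 'v \<Rightarrow> 'v" where
  "adjoin u a = setof (\<lambda>x. x \<epsilon> u \<or> x = a)"

definition diff :: "'v \<Rightarrow> 'v \<Rightarrow> 'v" where
  "diff x y = setof (\<lambda>z. z \<epsilon> x \<and> \<not> z \<epsilon> y)"

definition Power :: "'v \<Rightarrow> 'v" where
  "Power x = setof (\<lambda>y. subset y x)"

definition app :: "'v \<Rightarrow> 'v \<Rightarrow> 'v" where
  "app f x = (THE y. pair x y \<epsilon> f)"

definition funs :: "'v \<Rightarrow> 'v \<Rightarrow> 'v" where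
  "funs a b = setof (\<lambda>f. func f a b)"

definition func_on :: "'v \<Rightarrow> 'v \<Rightarrow> bool" where
  "func_on f a \<longleftrightarrow> (\<exists>b. func f a b)"

primrec num :: "nat \<Rightarrow> 'v" where
  "num 0 = empty"
| "num (Suc n) = adjoin (num n) (num n)"

definition omega :: 'v where
  "omega = setof (\<lambda>n. Ord n \<and> (\<forall>m. m \<epsilon> n \<or> m = n \<longrightarrow> m = empty \<or> (\<exists>k. m = adjoin k k)))"

definition le :: "'v \<Rightarrow> 'v \<Rightarrow> bool" where
  "le \<alpha> \<beta> \<longleftrightarrow> \<alpha> \<epsilon> \<beta> \<or> \<alpha> = \<beta>"

definition uncountable_cardinal :: "'v \<Rightarrow> bool" where
  "uncountable_cardinal \<kappa> \<longleftrightarrow> is_initial \<kappa> \<and> omega \<epsilon> \<kappa>"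

definition regular_cardinal :: "'v \<Rightarrow> bool" where
  "regular_cardinal \<delta> \<longleftrightarrow> is_initial \<delta> \<and> le omega \<delta> \<and>
     (\<forall>\<alpha> f. \<alpha> \<epsilon> \<delta> \<and> func f \<alpha> \<delta> \<longrightarrow>
        (\<exists>\<beta>. \<beta> \<epsilon> \<delta> \<and> (\<forall>\<xi>. \<xi> \<epsilon> \<alpha> \<longrightarrow> app f \<xi> \<epsilon> \<beta>)))"

definition cexp :: "'v \<Rightarrow> 'v \<Rightarrow> 'v" where
  "cexp \<kappa> \<mu> = card (funs \<mu> \<kappa>)"

text \<open>\<open>\<kappa>\<close> to the power \<open><\<mu>\<close>, as the number of sequences in \<open>\<kappa>\<close> of length less than
  \<open>\<mu>\<close>.\<close>

definition cexp_less :: "'v \<Rightarrow> 'v \<Rightarrow> 'v" where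
  "cexp_less \<kappa> \<mu> = card (setof (\<lambda>f. \<exists>\<alpha>. \<alpha> \<epsilon> \<mu> \<and> func f \<alpha> \<kappa>))"


subsection \<open>Filters\<close>

definition filter_base :: "'v \<Rightarrow> 'v \<Rightarrow> bool" where
  "filter_base X E \<longleftrightarrow> X \<epsilon> E \<and> (\<forall>Y. Y \<epsilon> E \<longrightarrow> subset Y X \<and> diff X Y \<epsilon> E)"

text \<open>Closure under intersections is deliberately not required: only nonemptiness is, as
  \<open>E\<close> need not be closed under intersections. The intersection of the empty family is
  \<open>X\<close>.\<close>

definition complete_filter :: "'v \<Rightarrow> 'v \<Rightarrow> 'v \<Rightarrow> 'v \<Rightarrow> bool" where
  "complete_filter \<kappa> X E F \<longleftrightarrow>
     subset F E \<and> X \<epsilon> F \<and> \<not> empty \<epsilon> F \<and>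
     (\<forall>Y Z. Y \<epsilon> E \<and> Z \<epsilon> E \<and> subset Z Y \<and> Z \<epsilon> F \<longrightarrow> Y \<epsilon> F) \<and>
     (\<forall>\<mu> Y. \<mu> \<epsilon> \<kappa> \<and> func Y \<mu> F \<longrightarrow>
        (\<exists>x. x \<epsilon> X \<and> (\<forall>i. i \<epsilon> \<mu> \<longrightarrow> x \<epsilon> app Y i)))"

definition measures :: "'v \<Rightarrow> 'v \<Rightarrow> 'v \<Rightarrow> bool" where
  "measures X E F \<longleftrightarrow> (\<forall>Y. Y \<epsilon> E \<longrightarrow> Y \<epsilon> F \<or> diff X Y \<epsilon> F)"

definition filter_extension_property :: "'v \<Rightarrow> 'v \<Rightarrow> 'v \<Rightarrow> bool" where
  "filter_extension_property \<delta> \<kappa> \<mu> \<longleftrightarrow>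
     (\<forall>X E F. filter_base X E \<and> le (card E) \<mu> \<and> complete_filter \<kappa> X E F \<longrightarrow>
        (\<exists>U. subset F U \<and> complete_filter \<delta> X E U \<and> measures X E U))"

definition Pk :: "'v \<Rightarrow> 'v \<Rightarrow> 'v" where
  "Pk \<kappa> A = setof (\<lambda>x. subset x A \<and> card x \<epsilon> \<kappa>)"

definition fine :: "'v \<Rightarrow> 'v \<Rightarrow> 'v \<Rightarrow> bool" where
  "fine \<kappa> A F \<longleftrightarrow> (\<forall>a. a \<epsilon> A \<longrightarrow> setof (\<lambda>x. x \<epsilon> Pk \<kappa> A \<and> a \<epsilon> x) \<epsilon> F)"

definition strongly_compact :: "'v \<Rightarrow> 'v \<Rightarrow> 'v \<Rightarrow> bool" where
  "strongly_compact \<delta> \<kappa> l \<longleftrightarrow>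
     (\<exists>U. fine \<kappa> l U \<and> complete_filter \<delta> (Pk \<kappa> l) (Power (Pk \<kappa> l)) U \<and>
        measures (Pk \<kappa> l) (Power (Pk \<kappa> l)) U)"


subsection \<open>The logic with conjunctions and disjunctions of size less than \<open>\<delta>\<close>\<close>

text \<open>
  This logic is internal to the model, so its syntax is coded by elements of the model. A language
  consists of a set \<open>L\<close> of symbols, the subset \<open>R\<close> of relation symbols (the others are
  function symbols) and the arity function \<open>ar\<close>. The variables are indexed by \<open>omega\<close>.
\<close>

definition language :: "'v \<Rightarrow> 'v \<Rightarrow> 'v \<Rightarrow> bool" where
  "language L R ar \<longleftrightarrow> subset R L \<and> func ar L omega"

definition tVar :: "'v \<Rightarrow> 'v" where
  "tVar m = pair (num 0) m"

definition tApp :: "'v \<Rightarrow> 'v \<Rightarrow> 'v" where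
  "tApp f ts = pair (num 1) (pair f ts)"

definition fEq :: "'v \<Rightarrow> 'v \<Rightarrow> 'v" where
  "fEq t t' = pair (num 2) (pair t t')"

definition fRel :: "'v \<Rightarrow> 'v \<Rightarrow> 'v" where
  "fRel r ts = pair (num 3) (pair r ts)"

definition fNeg :: "'v \<Rightarrow> 'v" where
  "fNeg p = pair (num 4) p"

definition fConj :: "'v \<Rightarrow> 'v" where
  "fConj \<Phi> = pair (num 5) \<Phi>"

definition fDisj :: "'v \<Rightarrow> 'v" where
  "fDisj \<Phi> = pair (num 6) \<Phi>"

definition fEx :: "'v \<Rightarrow> 'v \<Rightarrow> 'v" where
  "fEx m p = pair (num 7) (pair m p)"

definition fAll :: "'v \<Rightarrow> 'v \<Rightarrow> 'v" where
  "fAll m p = pair (num 8) (pair m p)"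

text \<open>\<open>t\<close> is a term all of whose variables have indices in \<open>u\<close>.\<close>

definition is_term :: "'v \<Rightarrow> 'v \<Rightarrow> 'v \<Rightarrow> 'v \<Rightarrow> 'v \<Rightarrow> bool" where
  "is_term L R ar u t \<longleftrightarrow>
     (\<forall>C. (\<forall>m. m \<epsilon> u \<longrightarrow> tVar m \<epsilon> C) \<and>
          (\<forall>f ts. f \<epsilon> L \<and> \<not> f \<epsilon> R \<and> func ts (app ar f) C \<longrightarrow> tApp f ts \<epsilon> C)
        \<longrightarrow> t \<epsilon> C)"

text \<open>\<open>C\<close> is closed under the formation rules for pairs of a formula and a finite set of
  indices that includes those of its free variables. This bookkeeping ensures that all formulas
  have finitely many free variables.\<close>

definition formation_closed :: "'v \<Rightarrow> 'v \<Rightarrow> 'v \<Rightarrow> 'v \<Rightarrow> 'v \<Rightarrow> bool" where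
  "formation_closed \<delta> L R ar C \<longleftrightarrow>
     (\<forall>u. subset u omega \<and> card u \<epsilon> omega \<longrightarrow>
        (\<forall>t t'. is_term L R ar u t \<and> is_term L R ar u t' \<longrightarrow> pair (fEq t t') u \<epsilon> C) \<and>
        (\<forall>r ts. r \<epsilon> R \<and> func_on ts (app ar r) \<and>
            (\<forall>i. i \<epsilon> app ar r \<longrightarrow> is_term L R ar u (app ts i)) \<longrightarrow> pair (fRel r ts) u \<epsilon> C) \<and>
        (\<forall>p. pair p u \<epsilon> C \<longrightarrow> pair (fNeg p) u \<epsilon> C) \<and>
        (\<forall>\<Phi>. card \<Phi> \<epsilon> \<delta> \<and> (\<forall>p. p \<epsilon> \<Phi> \<longrightarrow> pair p u \<epsilon> C) \<longrightarrow>
            pair (fConj \<Phi>) u \<epsilon> C \<and> pair (fDisj \<Phi>) u \<epsilon> C) \<and>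
        (\<forall>m p. m \<epsilon> omega \<and> pair p (adjoin u m) \<epsilon> C \<longrightarrow>
            pair (fEx m p) u \<epsilon> C \<and> pair (fAll m p) u \<epsilon> C))"

definition is_sentence :: "'v \<Rightarrow> 'v \<Rightarrow> 'v \<Rightarrow> 'v \<Rightarrow> 'v \<Rightarrow> bool" where
  "is_sentence \<delta> L R ar p \<longleftrightarrow> (\<forall>C. formation_closed \<delta> L R ar C \<longrightarrow> pair p empty \<epsilon> C)"

definition is_structure :: "'v \<Rightarrow> 'v \<Rightarrow> 'v \<Rightarrow> 'v \<Rightarrow> 'v \<Rightarrow> bool" where
  "is_structure L R ar A I \<longleftrightarrow>
     (\<exists>a. a \<epsilon> A) \<and> func_on I L \<and>
     (\<forall>r. r \<epsilon> R \<longrightarrow> subset (app I r) (funs (app ar r) A)) \<and>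
     (\<forall>f. f \<epsilon> L \<and> \<not> f \<epsilon> R \<longrightarrow> func (app I f) (funs (app ar f) A) A)"

text \<open>The term \<open>t\<close> has the value \<open>a\<close> under the assignment \<open>s\<close>.\<close>

definition term_value :: "'v \<Rightarrow> 'v \<Rightarrow> 'v \<Rightarrow> 'v \<Rightarrow> 'v \<Rightarrow> 'v \<Rightarrow> 'v \<Rightarrow> 'v \<Rightarrow> bool" where
  "term_value L R ar A I s t a \<longleftrightarrow>
     (\<forall>C. (\<forall>m. m \<epsilon> omega \<longrightarrow> pair (tVar m) (app s m) \<epsilon> C) \<and>
          (\<forall>f ts as. f \<epsilon> L \<and> \<not> f \<epsilon> R \<and> func_on ts (app ar f) \<and> func as (app ar f) A \<and>
              (\<forall>i. i \<epsilon> app ar f \<longrightarrow> pair (app ts i) (app as i) \<epsilon> C) \<longrightarrow>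
              pair (tApp f ts) (app (app I f) as) \<epsilon> C)
        \<longrightarrow> pair t a \<epsilon> C)"

definition update :: "'v \<Rightarrow> 'v \<Rightarrow> 'v \<Rightarrow> 'v" where
  "update s m a = setof (\<lambda>p. (p \<epsilon> s \<and> (\<forall>b. p \<noteq> pair m b)) \<or> p = pair m a)"

text \<open>\<open>C\<close> is closed under immediate subformulas, and \<open>S\<close> satisfies Tarski's
  recursive clauses for the formulas in \<open>C\<close>. By foundation these clauses determine which
  pairs of a formula in \<open>C\<close> and an assignment belong to \<open>S\<close>.\<close>

definition truth_set :: "'v \<Rightarrow> 'v \<Rightarrow> 'v \<Rightarrow> 'v \<Rightarrow> 'v \<Rightarrow> 'v \<Rightarrow> 'v \<Rightarrow> bool" where
  "truth_set L R ar A I C S \<longleftrightarrow>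
     (\<forall>t t'. fEq t t' \<epsilon> C \<longrightarrow>
        (\<forall>s. func s omega A \<longrightarrow> (pair (fEq t t') s \<epsilon> S \<longleftrightarrow>
          (\<exists>a. term_value L R ar A I s t a \<and> term_value L R ar A I s t' a)))) \<and>
     (\<forall>r ts. fRel r ts \<epsilon> C \<longrightarrow>
        (\<forall>s. func s omega A \<longrightarrow> (pair (fRel r ts) s \<epsilon> S \<longleftrightarrow>
          (\<exists>as. func as (app ar r) A \<and> as \<epsilon> app I r \<and>
            (\<forall>i. i \<epsilon> app ar r \<longrightarrow> term_value L R ar A I s (app ts i) (app as i)))))) \<and>
     (\<forall>p. fNeg p \<epsilon> C \<longrightarrow> p \<epsilon> C \<and>
        (\<forall>s. func s omega A \<longrightarrow> (pair (fNeg p) s \<epsilon> S \<longleftrightarrow> \<not> pair p s \<epsilon> S))) \<and>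
     (\<forall>\<Phi>. fConj \<Phi> \<epsilon> C \<longrightarrow> subset \<Phi> C \<and>
        (\<forall>s. func s omega A \<longrightarrow> (pair (fConj \<Phi>) s \<epsilon> S \<longleftrightarrow>
          (\<forall>p. p \<epsilon> \<Phi> \<longrightarrow> pair p s \<epsilon> S)))) \<and>
     (\<forall>\<Phi>. fDisj \<Phi> \<epsilon> C \<longrightarrow> subset \<Phi> C \<and>
        (\<forall>s. func s omega A \<longrightarrow> (pair (fDisj \<Phi>) s \<epsilon> S \<longleftrightarrow>
          (\<exists>p. p \<epsilon> \<Phi> \<and> pair p s \<epsilon> S)))) \<and>
     (\<forall>m p. fEx m p \<epsilon> C \<longrightarrow> p \<epsilon> C \<and>
        (\<forall>s. func s omega A \<longrightarrow> (pair (fEx m p) s \<epsilon> S \<longleftrightarrow>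
          (\<exists>a. a \<epsilon> A \<and> pair p (update s m a) \<epsilon> S)))) \<and>
     (\<forall>m p. fAll m p \<epsilon> C \<longrightarrow> p \<epsilon> C \<and>
        (\<forall>s. func s omega A \<longrightarrow> (pair (fAll m p) s \<epsilon> S \<longleftrightarrow>
          (\<forall>a. a \<epsilon> A \<longrightarrow> pair p (update s m a) \<epsilon> S))))"

definition satisfies :: "'v \<Rightarrow> 'v \<Rightarrow> 'v \<Rightarrow> 'v \<Rightarrow> 'v \<Rightarrow> 'v \<Rightarrow> 'v \<Rightarrow> bool" where
  "satisfies L R ar A I p s \<longleftrightarrow>
     (\<exists>C S. p \<epsilon> C \<and> truth_set L R ar A I C S \<and> pair p s \<epsilon> S)"

definition has_model :: "'v \<Rightarrow> 'v \<Rightarrow> 'v \<Rightarrow> 'v \<Rightarrow> bool" where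
  "has_model L R ar T \<longleftrightarrow>
     (\<exists>A I. is_structure L R ar A I \<and>
        (\<forall>p s. p \<epsilon> T \<and> func s omega A \<longrightarrow> satisfies L R ar A I p s))"

definition compact_cardinal :: "'v \<Rightarrow> 'v \<Rightarrow> 'v \<Rightarrow> bool" where
  "compact_cardinal \<delta> \<kappa> \<mu> \<longleftrightarrow>
     (\<forall>L R ar T. language L R ar \<and> le (card L) \<mu> \<and>
        (\<forall>p. p \<epsilon> T \<longrightarrow> is_sentence \<delta> L R ar p) \<and>
        (\<forall>T'. subset T' T \<and> card T' \<epsilon> \<kappa> \<longrightarrow> has_model L R ar T') \<longrightarrow>
        has_model L R ar T)"


subsection \<open>Elementary embeddings of the universe\<close>

definition definable_class :: "'v set \<Rightarrow> bool" where
  "definable_class W \<longleftrightarrow> (\<exists>p s. \<forall>x. x \<in> W \<longleftrightarrow> sat UNIV mem (s(0 := x)) p)"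

definition definable_map :: "('v \<Rightarrow> 'v) \<Rightarrow> bool" where
  "definable_map j \<longleftrightarrow> (\<exists>p s. \<forall>x y. j x = y \<longleftrightarrow> sat UNIV mem (s(0 := x, 1 := y)) p)"

definition transitive_class :: "'v set \<Rightarrow> bool" where
  "transitive_class W \<longleftrightarrow> (\<forall>x y. x \<in> W \<and> y \<epsilon> x \<longrightarrow> y \<in> W)"

definition elementary_embedding :: "('v \<Rightarrow> 'v) \<Rightarrow> 'v set \<Rightarrow> bool" where
  "elementary_embedding j W \<longleftrightarrow>
     range j \<subseteq> W \<and> (\<forall>p s. sat UNIV mem s p \<longleftrightarrow> sat W mem (j \<circ> s) p)"

definition critical_point :: "('v \<Rightarrow> 'v) \<Rightarrow> 'v \<Rightarrow> bool" where
  "critical_point j \<alpha> \<longleftrightarrow>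
     Ord \<alpha> \<and> \<alpha> \<epsilon> j \<alpha> \<and> (\<forall>\<beta>. Ord \<beta> \<and> \<beta> \<epsilon> j \<beta> \<longrightarrow> le \<alpha> \<beta>)"

definition covering_embedding_exists :: "'v \<Rightarrow> 'v \<Rightarrow> 'v \<Rightarrow> bool" where
  "covering_embedding_exists \<delta> \<kappa> l \<longleftrightarrow>
     (\<exists>j W. definable_map j \<and> definable_class W \<and> transitive_class W \<and>
        elementary_embedding j W \<and>
        (\<exists>\<alpha>. critical_point j \<alpha> \<and> le \<delta> \<alpha>) \<and>
        (\<exists>D\<in>W. (\<forall>a. a \<epsilon> l \<longrightarrow> j a \<epsilon> D) \<and> set_structure.card W mem D \<epsilon> j \<kappa>))"

end

end

theory Submission
  imports Defs
begin

text \<open>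
  The three implications are instances of classical arguments.

  \<^emph>\<open>From compactness to filter extensions.\<close> Propositional infinitary logic is enough. Read each
  set of \<open>E\<close> as an atomic proposition; the theory asserts the sets of the given filter, one of \<open>Y\<close>
  and \<open>X - Y\<close> for each \<open>Y\<close>, and denies every conjunction of fewer than \<open>\<delta>\<close> atoms without a common
  point. A part of the theory with fewer than \<open>\<kappa>\<close> sentences is true at any common point of the
  filter sets it mentions, and a model of the whole theory is an extension of the filter.

  \<^emph>\<open>From filter extensions to strong compactness.\<close> The sets \<open>{x | a \<in> x}\<close>, for \<open>a \<in> \<lambda>\<close>, generate a
  \<open><\<kappa>\<close>-complete filter, for fewer than \<open>\<kappa>\<close> of them have the set of the points \<open>a\<close> concerned in
  common. There are at most \<open>2\<close> to the power \<open>\<lambda>\<^bsup><\<kappa>\<^esup>\<close> subsets of \<open>P\<^sub>\<kappa>(\<lambda>)\<close>, since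
  every element of \<open>P\<^sub>\<kappa>(\<lambda>)\<close> is the range of a sequence in \<open>\<lambda>\<close> of length less than \<open>\<kappa>\<close>.

  \<^emph>\<open>Strong compactness and embeddings.\<close> The ultrapower of the universe by a \<open><\<delta>\<close>-complete ultrafilter
  on \<open>P\<^sub>\<kappa>(\<lambda>)\<close> is well-founded, as a descending sequence would descend at a single coordinate. Its
  transitive collapse is the target of an embedding \<open>j\<close>, elementary by the theorem of Los
  (\<open>Los\<close>), and the class \<open>D\<close> of the identity function is the required cover: it is an element of
  \<open>j(P\<^sub>\<kappa>(\<lambda>))\<close>, hence smaller than \<open>j(\<kappa>)\<close>, and fineness puts \<open>j(a)\<close> into \<open>D\<close>. Completeness
  makes \<open>j\<close> fix every ordinal below \<open>\<delta>\<close>; and \<open>j\<close> moves some ordinal, because otherwise \<open>D\<close> would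
  include \<open>\<lambda>\<close> and have fewer than \<open>\<kappa>\<close> elements. Conversely, an embedding with a cover \<open>D\<close>
  yields the ultrafilter of all \<open>Y\<close> with \<open>D \<inter> j(\<lambda>) \<in> j(Y)\<close>.

  The universe is an arbitrary model of first-order ZFC, so a set or a class function is available only
  if a formula defines it. The calculus of definable predicates (\<open>df\<close>) and definable functions
  (\<open>dt\<close>) at the beginning derives definability from the shape of a HOL term. With it, the development
  of set theory inside the model needs two general principles: recursion along a well-founded set-like
  relation (\<open>wf_recursion\<close>), which gives transitive closures, the cumulative hierarchy, the
  well-ordering theorem and the collapse of the ultrapower; and collection together with choice for
  classes (\<open>class_choice\<close>), on which the theorem of Los rests. Conclusions are carried across \<open>j\<close> by
  the same calculus, applied to the universe and to the target of \<open>j\<close> at the same time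
  (\<open>transfer\<close>).
\<close>

section \<open>Definability\<close>

primrec rename :: "(nat \<Rightarrow> nat) \<Rightarrow> fm \<Rightarrow> fm" where
  "rename f (Member i k) = Member (f i) (f k)"
| "rename f (Equal i k) = Equal (f i) (f k)"
| "rename f (Neg p) = Neg (rename f p)"
| "rename f (Conj p q) = Conj (rename f p) (rename f q)"
| "rename f (Forall i p) = Forall (f i) (rename f p)"

lemma sat_rename:
  assumes "inj f"
  shows "sat M mem s (rename f p) \<longleftrightarrow> sat M mem (s \<circ> f) p"
proof (induction p arbitrary: s)
  case (Forall i p)
  have "(s(f i := x)) \<circ> f = (s \<circ> f)(i := x)" for x
    using assms by (auto simp: fun_eq_iff inj_eq)
  then show ?case using Forall by (simp only: rename.simps sat.simps)
qed auto

text \<open>Parameters have to be kept apart from the variables that later quantifiers bind. In a combined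
  assignment the variables \<open>e\<close> take the even places and the parameters \<open>s\<close> the odd ones.\<close>

definition merge :: "(nat \<Rightarrow> 'v) \<Rightarrow> (nat \<Rightarrow> 'v) \<Rightarrow> nat \<Rightarrow> 'v" where
  "merge e s i = (if even i then e (i div 2) else s (i div 2))"

lemma merge_simps [simp]: "merge e s (2 * i) = e i" "merge e s (Suc (2 * i)) = s i"
  by (simp_all add: merge_def)

lemma merge_comp: "f \<circ> merge e s = merge (f \<circ> e) (f \<circ> s)"
  by (auto simp: merge_def)

definition split_rename :: "(nat \<Rightarrow> nat) \<Rightarrow> (nat \<Rightarrow> nat) \<Rightarrow> nat \<Rightarrow> nat" where
  "split_rename f g i = (if even i then 2 * f (i div 2) else Suc (2 * g (i div 2)))"

lemma inj_split_rename:
  assumes "inj f" "inj g"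
  shows "inj (split_rename f g)"
proof (rule injI)
  fix x y assume *: "split_rename f g x = split_rename f g y"
  have "odd (Suc (2 * n))" "even (2 * n)" for n :: nat by auto
  then have "even x \<longleftrightarrow> even y" using * unfolding split_rename_def by metis
  then have "x div 2 = y div 2"
    using * assms unfolding split_rename_def by (auto simp: inj_eq split: if_splits)
  then show "x = y" using \<open>even x \<longleftrightarrow> even y\<close>
    by (metis even_two_times_div_two odd_two_times_div_two_succ)
qed

lemma merge_split_rename: "merge e t \<circ> split_rename f g = merge (e \<circ> f) (t \<circ> g)"
  by (auto simp: fun_eq_iff split_rename_def) (auto simp: merge_def)

lemma merge_comp_even_odd: "merge s t \<circ> (*) 2 = s" "merge s t \<circ> (\<lambda>i. Suc (2 * i)) = t"
  by (auto simp: fun_eq_iff)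

text \<open>One formula with parameters defines \<open>P\<close> in the universe and, with the images of the parameters
  under \<open>j\<close>, defines \<open>Q\<close> in the class \<open>W\<close>. For \<open>W = UNIV\<close> and \<open>j = id\<close> this is definability; for an
  elementary \<open>j\<close> it lets a statement be carried from the universe to \<open>W\<close>. The common generality
  allows the closure properties to be proved once.\<close>

definition corr ::
  "('v \<Rightarrow> 'v \<Rightarrow> bool) \<Rightarrow> 'v set \<Rightarrow> ('v \<Rightarrow> 'v) \<Rightarrow> ((nat \<Rightarrow> 'v) \<Rightarrow> bool) \<Rightarrow> ((nat \<Rightarrow> 'v) \<Rightarrow> bool) \<Rightarrow> bool"
  where "corr mem W j P Q \<longleftrightarrow> (\<exists>p s. \<forall>e. (P e \<longleftrightarrow> sat UNIV mem (merge e s) p) \<and>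
    (range e \<subseteq> W \<longrightarrow> (Q e \<longleftrightarrow> sat W mem (merge e (j \<circ> s)) p)))"

lemma corrI:
  assumes "\<And>e. P e \<longleftrightarrow> sat UNIV mem (merge e s) p"
    and "\<And>e. range e \<subseteq> W \<Longrightarrow> Q e \<longleftrightarrow> sat W mem (merge e (j \<circ> s)) p"
  shows "corr mem W j P Q"
  unfolding corr_def using assms by blast

lemma corrE:
  assumes "corr mem W j P Q"
  obtains p s where "\<And>e. P e \<longleftrightarrow> sat UNIV mem (merge e s) p"
    and "\<And>e. range e \<subseteq> W \<Longrightarrow> Q e \<longleftrightarrow> sat W mem (merge e (j \<circ> s)) p"
  using assms unfolding corr_def by blast

lemma corr_cong:
  assumes "corr mem W j P Q" "\<And>e. P' e \<longleftrightarrow> P e" "\<And>e. range e \<subseteq> W \<Longrightarrow> Q' e \<longleftrightarrow> Q e"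
  shows "corr mem W j P' Q'"
  using assms unfolding corr_def by blast

lemma corr_mem_var: "corr mem W j (\<lambda>e. mem (e i) (e k)) (\<lambda>e. mem (e i) (e k))"
  by (rule corrI[where p = "Member (2 * i) (2 * k)"]) auto

lemma corr_eq_var: "corr mem W j (\<lambda>e. e i = e k) (\<lambda>e. e i = e k)"
  by (rule corrI[where p = "Equal (2 * i) (2 * k)"]) auto

lemma corr_eq_const: "corr mem W j (\<lambda>e. e i = c) (\<lambda>e. e i = j c)"
  by (rule corrI[where p = "Equal (2 * i) (Suc (2 * 0))" and s = "\<lambda>_. c"])
    (simp_all only: sat.simps merge_simps comp_def)

lemma corr_bool: "corr mem W j (\<lambda>_. b) (\<lambda>_. b)"
  by (cases b; rule corrI[where p = "if b then Equal 0 0 else Neg (Equal 0 0)"]) auto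

lemma corr_not:
  assumes "corr mem W j P Q"
  shows "corr mem W j (\<lambda>e. \<not> P e) (\<lambda>e. \<not> Q e)"
proof -
  obtain p s where "\<And>e. P e \<longleftrightarrow> sat UNIV mem (merge e s) p"
    and "\<And>e. range e \<subseteq> W \<Longrightarrow> Q e \<longleftrightarrow> sat W mem (merge e (j \<circ> s)) p"
    using assms by (rule corrE) blast
  then show ?thesis by (intro corrI[where p = "Neg p" and s = s]) auto
qed

lemma corr_conj:
  assumes "corr mem W j P Q" "corr mem W j P' Q'"
  shows "corr mem W j (\<lambda>e. P e \<and> P' e) (\<lambda>e. Q e \<and> Q' e)"
proof -
  obtain p s where p: "\<And>e. P e \<longleftrightarrow> sat UNIV mem (merge e s) p"
    "\<And>e. range e \<subseteq> W \<Longrightarrow> Q e \<longleftrightarrow> sat W mem (merge e (j \<circ> s)) p"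
    using assms(1) by (rule corrE) blast
  obtain p' s' where p': "\<And>e. P' e \<longleftrightarrow> sat UNIV mem (merge e s') p'"
    "\<And>e. range e \<subseteq> W \<Longrightarrow> Q' e \<longleftrightarrow> sat W mem (merge e (j \<circ> s')) p'"
    using assms(2) by (rule corrE) blast
  let ?f = "split_rename id ((*) 2)" and ?g = "split_rename id (\<lambda>i. Suc (2 * i))"
  have inj: "inj ?f" "inj ?g"
    by (intro inj_split_rename; simp add: inj_def)+
  show ?thesis
    by (intro corrI[where p = "Conj (rename ?f p) (rename ?g p')" and s = "merge s s'"])
      (simp_all add: p p' sat_rename inj merge_comp merge_split_rename merge_comp_even_odd)
qed

text \<open>The bound variable is the new first entry of the assignment. It cannot be quantified at the place
  that it has there, because the other variables must return to their old places; renaming moves it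
  to the first parameter, whose value the quantifier then overrides.\<close>

lemma corr_all:
  assumes "corr mem W j (\<lambda>e. P (e 0) (\<lambda>n. e (Suc n))) (\<lambda>e. Q (e 0) (\<lambda>n. e (Suc n)))"
  shows "corr mem W j (\<lambda>e. \<forall>x. P x e) (\<lambda>e. \<forall>x\<in>W. Q x e)"
proof -
  obtain p s where p: "\<And>e. P (e 0) (\<lambda>n. e (Suc n)) \<longleftrightarrow> sat UNIV mem (merge e s) p"
    "\<And>e. range e \<subseteq> W \<Longrightarrow> Q (e 0) (\<lambda>n. e (Suc n)) \<longleftrightarrow> sat W mem (merge e (j \<circ> s)) p"
    using assms by (rule corrE) blast
  let ?f = "\<lambda>i :: nat. if i = 0 then 1 else if even i then i - 2 else i + 2"
  have inj: "inj ?f"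
    by (rule inj_on_inverseI[where g = "\<lambda>i. if i = 1 then 0 else if even i then i + 2 else i - 2"])
      (auto elim!: evenE oddE, presburger)
  have eq: "((merge e (case_nat c t))(1 := x)) \<circ> ?f = merge (case_nat x e) t" for e t :: "nat \<Rightarrow> 'a" and x c
    by (auto simp: fun_eq_iff merge_def split: nat.splits elim!: evenE oddE)
  have c: "j \<circ> case_nat c s = case_nat (j c) (j \<circ> s)" for c
    by (auto simp: fun_eq_iff split: nat.splits)
  have 1: "P x e \<longleftrightarrow> sat UNIV mem (merge (case_nat x e) s) p" for x e
    using p(1)[of "case_nat x e"] by simp
  have 2: "Q x e \<longleftrightarrow> sat W mem (merge (case_nat x e) (j \<circ> s)) p"
    if "range e \<subseteq> W" "x \<in> W" for x e
    using p(2)[of "case_nat x e"] that by (auto simp: image_subset_iff split: nat.splits)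
  show ?thesis
    by (intro corrI[where p = "Forall 1 (rename ?f p)" and s = "case_nat undefined s"])
      (simp_all only: sat.simps sat_rename[OF inj] eq c 1 2 simp_thms ball_UNIV cong: ball_cong)
qed

lemma corr_reindex:
  assumes "corr mem W j P Q" "inj f"
  shows "corr mem W j (\<lambda>e. P (\<lambda>i. e (f i))) (\<lambda>e. Q (\<lambda>i. e (f i)))"
proof -
  obtain p s where p: "\<And>e. P e \<longleftrightarrow> sat UNIV mem (merge e s) p"
    "\<And>e. range e \<subseteq> W \<Longrightarrow> Q e \<longleftrightarrow> sat W mem (merge e (j \<circ> s)) p"
    using assms(1) by (rule corrE) blast
  let ?f = "split_rename f id"
  have inj: "inj ?f"
    using assms(2) by (simp add: inj_split_rename)
  show ?thesis
  proof (rule corrI[where p = "rename ?f p" and s = s])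
    show "P (\<lambda>i. e (f i)) \<longleftrightarrow> sat UNIV mem (merge e s) (rename ?f p)" for e
      using p(1)[of "e \<circ> f"] unfolding sat_rename[OF inj] merge_split_rename by (simp add: comp_def)
    show "Q (\<lambda>i. e (f i)) \<longleftrightarrow> sat W mem (merge e (j \<circ> s)) (rename ?f p)" if "range e \<subseteq> W" for e
      using p(2)[of "e \<circ> f"] that unfolding sat_rename[OF inj] merge_split_rename
      by (simp add: comp_def image_subset_iff)
  qed
qed

text \<open>The version of \<open>corr\<close> for functions, expressed by their graphs.\<close>

definition cterm ::
  "('v \<Rightarrow> 'v \<Rightarrow> bool) \<Rightarrow> 'v set \<Rightarrow> ('v \<Rightarrow> 'v) \<Rightarrow> ((nat \<Rightarrow> 'v) \<Rightarrow> 'v) \<Rightarrow> ((nat \<Rightarrow> 'v) \<Rightarrow> 'v) \<Rightarrow> bool"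
  where "cterm mem W j a b \<longleftrightarrow>
    corr mem W j (\<lambda>e. e 0 = a (\<lambda>n. e (Suc n))) (\<lambda>e. e 0 = b (\<lambda>n. e (Suc n))) \<and>
    (\<forall>e. range e \<subseteq> W \<longrightarrow> b e \<in> W)"

lemma cterm_var: "cterm mem W j (\<lambda>e. e i) (\<lambda>e. e i)"
  unfolding cterm_def using corr_eq_var[of mem W j 0 "Suc i"] by auto

lemma cterm_const: "j c \<in> W \<Longrightarrow> cterm mem W j (\<lambda>e. c) (\<lambda>e. j c)"
  unfolding cterm_def using corr_eq_const by auto

lemma cterm_shift:
  assumes "cterm mem W j a b"
  shows "cterm mem W j (\<lambda>e. a (\<lambda>n. e (Suc n))) (\<lambda>e. b (\<lambda>n. e (Suc n)))"
proof -
  have "inj (case_nat 0 (\<lambda>n. Suc (Suc n)))"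
    by (auto simp: inj_def split: nat.splits)
  from corr_reindex[OF conjunct1[OF assms[unfolded cterm_def]] this] show ?thesis
    using assms unfolding cterm_def by (auto simp: image_subset_iff)
qed

lemma corr_ex:
  assumes "corr mem W j (\<lambda>e. P (e 0) (\<lambda>n. e (Suc n))) (\<lambda>e. Q (e 0) (\<lambda>n. e (Suc n)))"
  shows "corr mem W j (\<lambda>e. \<exists>x. P x e) (\<lambda>e. \<exists>x\<in>W. Q x e)"
  using corr_not[OF corr_all[OF corr_not[OF assms]]] by simp

lemma corr_subst1:
  assumes "corr mem W j (\<lambda>e. P (e 0) (\<lambda>n. e (Suc n))) (\<lambda>e. Q (e 0) (\<lambda>n. e (Suc n)))"
    and "cterm mem W j a b"
  shows "corr mem W j (\<lambda>e. P (a e) e) (\<lambda>e. Q (b e) e)"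
proof -
  have "corr mem W j (\<lambda>e. \<exists>x. x = a e \<and> P x e) (\<lambda>e. \<exists>x\<in>W. x = b e \<and> Q x e)"
    by (rule corr_ex, rule corr_conj[OF _ assms(1)]) (use assms(2) in \<open>simp add: cterm_def\<close>)
  then show ?thesis
    by (rule corr_cong) (use assms(2) in \<open>auto simp: cterm_def\<close>)
qed

text \<open>Substitution of terms for all free variables of a formula at once. It is proved on formulas, by
  induction, and yields substitution into arbitrary definable predicates.\<close>

lemma corr_sat:
  assumes "\<And>i. cterm mem W j (t i) (t' i)"
  shows "corr mem W j (\<lambda>e. sat UNIV mem (\<lambda>i. t i e) p) (\<lambda>e. sat W mem (\<lambda>i. t' i e) p)"
  using assms
proof (induction p arbitrary: t t')
  case (Member i k)
  have "corr mem W j (\<lambda>e. mem (e 0) (t k (\<lambda>n. e (Suc n)))) (\<lambda>e. mem (e 0) (t' k (\<lambda>n. e (Suc n))))"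
    by (rule corr_subst1[where P = "\<lambda>x e. mem (e 0) x" and Q = "\<lambda>x e. mem (e 0) x"])
      (simp_all add: corr_mem_var cterm_shift Member)
  then have "corr mem W j (\<lambda>e. mem (t i e) (t k e)) (\<lambda>e. mem (t' i e) (t' k e))"
    by (rule corr_subst1[where P = "\<lambda>x e. mem x (t k e)" and Q = "\<lambda>x e. mem x (t' k e)"]) (rule Member)
  then show ?case by simp
next
  case (Equal i k)
  have "corr mem W j (\<lambda>e. e 0 = t k (\<lambda>n. e (Suc n))) (\<lambda>e. e 0 = t' k (\<lambda>n. e (Suc n)))"
    using Equal unfolding cterm_def by blast
  then have "corr mem W j (\<lambda>e. t i e = t k e) (\<lambda>e. t' i e = t' k e)"
    by (rule corr_subst1[where P = "\<lambda>x e. x = t k e" and Q = "\<lambda>x e. x = t' k e"]) (rule Equal)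
  then show ?case by simp
next
  case (Forall i p)
  let ?t = "\<lambda>k e. if k = i then e 0 else t k (\<lambda>n. e (Suc n))"
  let ?t' = "\<lambda>k e. if k = i then e 0 else t' k (\<lambda>n. e (Suc n))"
  have "cterm mem W j (?t k) (?t' k)" for k
    by (cases "k = i") (auto intro: cterm_var cterm_shift Forall)
  then have "corr mem W j (\<lambda>e. \<forall>x. sat UNIV mem (\<lambda>k. if k = i then x else t k e) p)
      (\<lambda>e. \<forall>x\<in>W. sat W mem (\<lambda>k. if k = i then x else t' k e) p)"
    by (intro corr_all) (rule Forall.IH[of ?t ?t', simplified])
  then show ?case by (simp add: fun_upd_def)
next
  case (Neg p)
  from corr_not[OF Neg.IH[OF Neg.prems]] show ?case by simp
next
  case (Conj p q)
  from corr_conj[OF Conj.IH(1)[OF Conj.prems] Conj.IH(2)[OF Conj.prems]] show ?case by simp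
qed

lemma corr_subst:
  assumes "corr mem W j P Q" "range j \<subseteq> W" "\<And>i. cterm mem W j (t i) (t' i)"
  shows "corr mem W j (\<lambda>e. P (\<lambda>i. t i e)) (\<lambda>e. Q (\<lambda>i. t' i e))"
proof -
  obtain p s where p: "\<And>e. P e \<longleftrightarrow> sat UNIV mem (merge e s) p"
    "\<And>e. range e \<subseteq> W \<Longrightarrow> Q e \<longleftrightarrow> sat W mem (merge e (j \<circ> s)) p"
    using assms(1) by (rule corrE) blast
  let ?u = "\<lambda>i e. merge (\<lambda>k. t k e) s i"
  let ?u' = "\<lambda>i e. merge (\<lambda>k. t' k e) (j \<circ> s) i"
  have "cterm mem W j (?u i) (?u' i)" for i
    using assms(2,3) by (cases "even i") (auto simp: merge_def intro!: cterm_const)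
  from corr_sat[OF this, where p = p] show ?thesis
    by (rule corr_cong) (use p assms(3) in \<open>auto simp: cterm_def image_subset_iff\<close>)
qed

text \<open>Elementarity enters here: without variables, only the parameters \<open>s\<close> and \<open>j \<circ> s\<close> remain.\<close>

lemma corr_closed:
  assumes "corr mem W j (\<lambda>e. P) (\<lambda>e. Q)" "range j \<subseteq> W"
    and "\<And>p s. sat UNIV mem s p \<longleftrightarrow> sat W mem (j \<circ> s) p"
  shows "P \<longleftrightarrow> Q"
proof -
  obtain p s where p: "\<And>e. P \<longleftrightarrow> sat UNIV mem (merge e s) p"
    "\<And>e. range e \<subseteq> W \<Longrightarrow> Q \<longleftrightarrow> sat W mem (merge e (j \<circ> s)) p"
    using assms(1) by (rule corrE) blast
  have "P \<longleftrightarrow> sat W mem (merge (j \<circ> s) (j \<circ> s)) p"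
    using p(1)[of s] by (simp add: assms(3) merge_comp)
  also have "\<dots> \<longleftrightarrow> Q"
    using p(2)[of "j \<circ> s"] assms(2) by auto
  finally show ?thesis .
qed

context ZFC
begin

text \<open>The rules collected as \<open>df_intros\<close> treat a predicate of assignments \<open>\<lambda>e. ... e 0 ... e 1 ...\<close> as
  a formula with de Bruijn indices: below a quantifier, the bound variable becomes \<open>e 0\<close> and the others
  are shifted. Expressions without \<open>e\<close> are parameters.\<close>

definition df :: "((nat \<Rightarrow> 'v) \<Rightarrow> bool) \<Rightarrow> bool" where
  "df P \<longleftrightarrow> corr mem UNIV id P P"

definition dt :: "((nat \<Rightarrow> 'v) \<Rightarrow> 'v) \<Rightarrow> bool" where
  "dt a \<longleftrightarrow> df (\<lambda>e. e 0 = a (\<lambda>n. e (Suc n)))"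

named_theorems df_intros

lemma dt_cterm: "dt a \<longleftrightarrow> cterm mem UNIV id a a"
  by (simp add: dt_def df_def cterm_def)

lemma df_sat:
  assumes "\<And>i. dt (t i)"
  shows "df (\<lambda>e. sat UNIV mem (\<lambda>i. t i e) p)"
  unfolding df_def using assms by (intro corr_sat) (auto simp: dt_cterm)

lemma df_subst:
  assumes "df P" "\<And>i. dt (t i)"
  shows "df (\<lambda>e. P (\<lambda>i. t i e))"
  using assms corr_subst[of mem UNIV id P P t t] by (simp add: df_def dt_cterm)

lemma df_bool [df_intros]: "df (\<lambda>e. b)"
  unfolding df_def by (rule corr_bool)

lemma dt_const [df_intros]: "dt (\<lambda>e. c)"
  unfolding dt_cterm using cterm_const[of id c UNIV mem] by simp

lemma dt_var [df_intros]: "dt (\<lambda>e. e i)"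
  unfolding dt_cterm by (rule cterm_var)

lemma dt_shift: "dt a \<Longrightarrow> dt (\<lambda>e. a (\<lambda>n. e (Suc n)))"
  unfolding dt_cterm by (rule cterm_shift)

lemma df_not [df_intros]: "df P \<Longrightarrow> df (\<lambda>e. \<not> P e)"
  unfolding df_def by (rule corr_not)

lemma df_conj [df_intros]: "df P \<Longrightarrow> df Q \<Longrightarrow> df (\<lambda>e. P e \<and> Q e)"
  unfolding df_def by (rule corr_conj)

lemma df_disj [df_intros]: "df P \<Longrightarrow> df Q \<Longrightarrow> df (\<lambda>e. P e \<or> Q e)"
  using df_not[OF df_conj[OF df_not df_not], of P Q] by simp

lemma df_imp [df_intros]: "df P \<Longrightarrow> df Q \<Longrightarrow> df (\<lambda>e. P e \<longrightarrow> Q e)"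
  using df_disj[OF df_not, of P Q] by (simp only: imp_conv_disj simp_thms)

lemma df_iff [df_intros]: "df P \<Longrightarrow> df Q \<Longrightarrow> df (\<lambda>e. P e \<longleftrightarrow> Q e)"
  using df_conj[OF df_imp df_imp, of P Q Q P] by (subst iff_conv_conj_imp)

lemma df_all [df_intros]:
  "df (\<lambda>e. P (e 0) (\<lambda>n. e (Suc n))) \<Longrightarrow> df (\<lambda>e. \<forall>x. P x e)"
  unfolding df_def using corr_all[of mem UNIV id P P] by simp

lemma df_ex [df_intros]:
  "df (\<lambda>e. P (e 0) (\<lambda>n. e (Suc n))) \<Longrightarrow> df (\<lambda>e. \<exists>x. P x e)"
  unfolding df_def using corr_ex[of mem UNIV id P P] by simp

lemma df_subst1:
  assumes "df (\<lambda>e. Q (e 0))" "dt a"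
  shows "df (\<lambda>e. Q (a e))"
  using df_subst[OF assms(1), of "\<lambda>i. a"] assms(2) by simp

lemma df_subst2:
  assumes "df (\<lambda>e. Q (e 0) (e (Suc 0)))" "dt a" "dt b"
  shows "df (\<lambda>e. Q (a e) (b e))"
  using df_subst[OF assms(1), of "\<lambda>i. if i = 0 then a else b"] assms(2,3) by simp

lemma df_subst3:
  assumes "df (\<lambda>e. Q (e 0) (e (Suc 0)) (e (Suc (Suc 0))))" "dt a" "dt b" "dt c"
  shows "df (\<lambda>e. Q (a e) (b e) (c e))"
  using df_subst[OF assms(1), of "\<lambda>i. if i = 0 then a else if i = 1 then b else c"] assms(2-) by simp

lemma df_mem [df_intros]: "dt a \<Longrightarrow> dt b \<Longrightarrow> df (\<lambda>e. a e \<epsilon> b e)"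
  by (rule df_subst2) (auto simp: df_def corr_mem_var)

lemma df_eq [df_intros]: "dt a \<Longrightarrow> dt b \<Longrightarrow> df (\<lambda>e. a e = b e)"
  by (rule df_subst2) (auto simp: df_def corr_eq_var)

lemma dt_case_nat: "dt a \<Longrightarrow> (\<And>n. dt (b n)) \<Longrightarrow> dt (case i of 0 \<Rightarrow> a | Suc n \<Rightarrow> b n)"
  by (cases i) simp_all

lemma df_ex1 [df_intros]:
  assumes "df (\<lambda>e. P (e 0) (\<lambda>n. e (Suc n)))"
  shows "df (\<lambda>e. \<exists>!x. P x e)"
proof -
  have "df (\<lambda>e. \<exists>y. \<forall>x. P x e \<longleftrightarrow> x = y)"
    using df_subst[OF assms, of "case_nat (\<lambda>e. e 0) (\<lambda>n e. e (Suc (Suc n)))"]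
    by (intro df_intros) (simp add: dt_case_nat dt_var)
  moreover have "(\<exists>!x. Q x) \<longleftrightarrow> (\<exists>y. \<forall>x. Q x \<longleftrightarrow> x = y)" for Q :: "'v \<Rightarrow> bool"
    by auto
  ultimately show ?thesis by simp
qed

lemma dtI: "df (\<lambda>e. e 0 = a (\<lambda>n. e (Suc n))) \<Longrightarrow> dt a"
  by (simp add: dt_def)

lemma dt_subst:
  assumes "dt a" "\<And>i. dt (t i)"
  shows "dt (\<lambda>e. a (\<lambda>i. t i e))"
proof (rule dtI)
  have "df (\<lambda>e. (case_nat (\<lambda>e. e 0) (\<lambda>i e. t i (\<lambda>n. e (Suc n))) 0 e) =
      a (\<lambda>n. case_nat (\<lambda>e. e 0) (\<lambda>i e. t i (\<lambda>n. e (Suc n))) (Suc n) e))"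
    using df_subst[OF assms(1)[unfolded dt_def],
        of "case_nat (\<lambda>e. e 0) (\<lambda>i e. t i (\<lambda>n. e (Suc n)))"] assms(2)
    by (simp only: dt_case_nat dt_var dt_shift)
  then show "df (\<lambda>e. e 0 = a (\<lambda>i. t i (\<lambda>n. e (Suc n))))" by simp
qed

lemma dt_subst1:
  assumes "dt (\<lambda>e. Q (e 0))" "dt a"
  shows "dt (\<lambda>e. Q (a e))"
  using dt_subst[OF assms(1), of "\<lambda>i. a"] assms(2) by simp

lemma dt_subst2:
  assumes "dt (\<lambda>e. Q (e 0) (e (Suc 0)))" "dt a" "dt b"
  shows "dt (\<lambda>e. Q (a e) (b e))"
  using dt_subst[OF assms(1), of "\<lambda>i. if i = 0 then a else b"] assms(2,3) by simp

lemma dt_if [df_intros]: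
  assumes "df P" "dt a" "dt b"
  shows "dt (\<lambda>e. if P e then a e else b e)"
proof (rule dtI)
  have "df (\<lambda>e. P (\<lambda>n. e (Suc n)))" by (rule df_subst[OF assms(1) dt_var])
  then have "df (\<lambda>e. (P (\<lambda>n. e (Suc n)) \<longrightarrow> e 0 = a (\<lambda>n. e (Suc n))) \<and>
      (\<not> P (\<lambda>n. e (Suc n)) \<longrightarrow> e 0 = b (\<lambda>n. e (Suc n))))"
    using assms by (intro df_intros dt_shift)
  then show "df (\<lambda>e. e 0 = (if P (\<lambda>n. e (Suc n)) then a (\<lambda>n. e (Suc n)) else b (\<lambda>n. e (Suc n))))"
    by (rule back_subst[of df]) auto
qed

lemma dt_graph:
  assumes "df (\<lambda>e. P (e 0) (\<lambda>n. e (Suc n)))" "\<And>y e. y = a e \<longleftrightarrow> P y e"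
  shows "dt a"
  by (rule dtI) (simp add: assms)

lemma df_fix: "df (\<lambda>e. P (e 0) (\<lambda>n. e (Suc n))) \<Longrightarrow> df (\<lambda>d. P (d 0) e)"
  using df_subst[of "\<lambda>e. P (e 0) (\<lambda>n. e (Suc n))" "case_nat (\<lambda>d. d 0) (\<lambda>n d. e n)"]
  by (simp add: dt_case_nat dt_var dt_const)

lemma dt_fix: "dt (\<lambda>e. a (e 0) (\<lambda>n. e (Suc n))) \<Longrightarrow> dt (\<lambda>d. a (d 0) e)"
  using dt_subst[of "\<lambda>e. a (e 0) (\<lambda>n. e (Suc n))" "case_nat (\<lambda>d. d 0) (\<lambda>n d. e n)"]
  by (simp add: dt_case_nat dt_var dt_const)

lemma df_class:
  assumes "df (\<lambda>e. P (e 0))"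
  obtains p s where "\<And>x. P x \<longleftrightarrow> sat UNIV mem (s(0 := x)) p"
proof -
  obtain p s where p: "\<And>e. P (e 0) \<longleftrightarrow> sat UNIV mem (merge e s) p"
    using assms unfolding df_def by (rule corrE) blast
  have "P x \<longleftrightarrow> sat UNIV mem ((merge s s)(0 := x)) p" for x
  proof -
    have "(merge s s)(0 := x) = merge (s(0 := x)) s"
      by (auto simp: merge_def fun_eq_iff elim!: evenE)
    then show ?thesis using p[of "s(0 := x)"] by simp
  qed
  then show thesis by (rule that)
qed

lemma df_class2:
  assumes "df (\<lambda>e. P (e 0) (e (Suc 0)))"
  obtains p s where "\<And>x y. P x y \<longleftrightarrow> sat UNIV mem (s(0 := x, 1 := y)) p"
proof -
  obtain p s where p: "\<And>e. P (e 0) (e (Suc 0)) \<longleftrightarrow> sat UNIV mem (merge e s) p"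
    using assms unfolding df_def by (rule corrE) blast
  let ?f = "\<lambda>i. if i = 1 then 2 else if i = 2 then 1 else i :: nat"
  have inj: "inj ?f" by (auto simp: inj_def split: if_splits)
  have "P x y \<longleftrightarrow> sat UNIV mem ((\<lambda>i. merge s s (?f i))(0 := x, 1 := y)) (rename ?f p)" for x y
  proof -
    have "((\<lambda>i. merge s s (?f i))(0 := x, 1 := y)) \<circ> ?f = merge (s(0 := x, 1 := y)) s"
      by (auto simp: merge_def fun_eq_iff elim!: evenE)
    then show ?thesis using p[of "s(0 := x, 1 := y)"] by (simp only: sat_rename[OF inj]) simp
  qed
  then show thesis by (rule that)
qed

lemma df_of_class2: "df (\<lambda>e. sat UNIV mem (s(0 := e 0, 1 := e (Suc 0))) p)"
proof -
  have "dt (\<lambda>e. if i = 1 then e (Suc 0) else if i = 0 then e 0 else s i)" for i :: nat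
    by (intro df_intros)
  from df_sat[OF this, where p = p] show ?thesis by (simp add: fun_upd_def)
qed

declare df_intros [simp]

lemma ex_sep:
  assumes "df (\<lambda>e. P (e 0))"
  shows "\<exists>z. \<forall>w. w \<epsilon> z \<longleftrightarrow> w \<epsilon> x \<and> P w"
  by (rule df_class[OF assms]) (use separation[of x] in simp)

lemma ex_repl:
  assumes "df (\<lambda>e. R (e 0) (e (Suc 0)))" "\<And>w. w \<epsilon> x \<Longrightarrow> \<exists>!y. R w y"
  shows "\<exists>z. \<forall>y. y \<epsilon> z \<longleftrightarrow> (\<exists>w. w \<epsilon> x \<and> R w y)"
  by (rule df_class2[OF assms(1)]) (use replacement[of x] assms(2) in simp)

section \<open>Sets given by definable predicates and functions\<close>

lemma set_ext: "(\<And>z. z \<epsilon> x \<longleftrightarrow> z \<epsilon> y) \<Longrightarrow> x = y"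
  using extensionality by blast

lemma mem_setof:
  assumes "\<exists>y. \<forall>x. x \<epsilon> y \<longleftrightarrow> P x"
  shows "x \<epsilon> setof P \<longleftrightarrow> P x"
proof -
  have "\<exists>!y. y \<in> UNIV \<and> (\<forall>x\<in>UNIV. x \<epsilon> y \<longleftrightarrow> P x)"
    using assms by (auto intro: set_ext)
  from theI'[OF this] show ?thesis unfolding setof_def by blast
qed

text \<open>Terms denote only if the class concerned is a set, so that existence is a premise here. It has to
  hold for all assignments, as a description that fails has an unknown value.\<close>

lemma dt_setof:
  assumes "\<And>e. \<exists>y. \<forall>x. x \<epsilon> y \<longleftrightarrow> P x e"
    and "df (\<lambda>e. P (e 0) (\<lambda>n. e (Suc n)))"
  shows "dt (\<lambda>e. setof (\<lambda>x. P x e))"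
proof (rule dt_graph)
  show "y = setof (\<lambda>x. P x e) \<longleftrightarrow> (\<forall>x. x \<epsilon> y \<longleftrightarrow> P x e)" for y e
    using mem_setof[OF assms(1)] by (auto intro: set_ext)
  have "df (\<lambda>e. P (e 0) (\<lambda>n. e (Suc (Suc n))))"
    using df_subst[OF assms(2), of "case_nat (\<lambda>e. e 0) (\<lambda>n e. e (Suc (Suc n)))"]
    by (simp add: dt_case_nat dt_var)
  then show "df (\<lambda>e. \<forall>x. x \<epsilon> e 0 \<longleftrightarrow> P x (\<lambda>n. e (Suc n)))"
    by (intro df_intros)
qed

definition sep :: "'v \<Rightarrow> ('v \<Rightarrow> bool) \<Rightarrow> 'v" where
  "sep a P = setof (\<lambda>x. x \<epsilon> a \<and> P x)"

lemma mem_sep [simp]: "df (\<lambda>e. P (e 0)) \<Longrightarrow> x \<epsilon> sep a P \<longleftrightarrow> x \<epsilon> a \<and> P x"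
  unfolding sep_def by (rule mem_setof[OF ex_sep])

lemma dt_sep [df_intros, simp]:
  assumes "dt a" "df (\<lambda>e. P (e 0) (\<lambda>n. e (Suc n)))"
  shows "dt (\<lambda>e. sep (a e) (\<lambda>x. P x e))"
  unfolding sep_def
  by (rule dt_setof[OF ex_sep[OF df_fix[OF assms(2)]]])
    (intro df_conj df_mem dt_var assms(2) dt_shift[OF assms(1)])

definition repl :: "'v \<Rightarrow> ('v \<Rightarrow> 'v) \<Rightarrow> 'v" where
  "repl a t = setof (\<lambda>y. \<exists>x. x \<epsilon> a \<and> y = t x)"

lemma ex_repl_fun:
  assumes "dt (\<lambda>e. t (e 0))"
  shows "\<exists>z. \<forall>y. y \<epsilon> z \<longleftrightarrow> (\<exists>x. x \<epsilon> a \<and> y = t x)"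
proof -
  have "df (\<lambda>e. e (Suc 0) = t (e 0))"
    by (rule df_eq[OF dt_var assms])
  from ex_repl[OF this] show ?thesis by auto
qed

lemma mem_repl [simp]: "dt (\<lambda>e. t (e 0)) \<Longrightarrow> y \<epsilon> repl a t \<longleftrightarrow> (\<exists>x. x \<epsilon> a \<and> y = t x)"
  unfolding repl_def by (rule mem_setof[OF ex_repl_fun])

lemma dt_repl [df_intros, simp]:
  assumes "dt a" "dt (\<lambda>e. t (e 0) (\<lambda>n. e (Suc n)))"
  shows "dt (\<lambda>e. repl (a e) (\<lambda>x. t x e))"
proof -
  have "dt (\<lambda>e. t (e 0) (\<lambda>n. e (Suc (Suc n))))"
    using dt_subst[OF assms(2), of "case_nat (\<lambda>e. e 0) (\<lambda>n e. e (Suc (Suc n)))"]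
    by (simp add: dt_case_nat dt_var)
  then show ?thesis
    unfolding repl_def using assms(1)
    by (intro dt_setof ex_repl_fun dt_fix[OF assms(2)])
      (intro df_intros dt_shift[OF dt_shift])
qed

lemma repl_cong: "(\<And>x. x \<epsilon> a \<Longrightarrow> t x = t' x) \<Longrightarrow> repl a t = repl a t'"
  unfolding repl_def by (rule arg_cong[where f = setof]) (auto simp: fun_eq_iff)

section \<open>Elementary operations on sets\<close>

lemma mem_upair [simp]: "x \<epsilon> upair a b \<longleftrightarrow> x = a \<or> x = b"
  unfolding upair_def by (rule mem_setof) (rule pairing)

lemma dt_upair [df_intros, simp]: "dt a \<Longrightarrow> dt b \<Longrightarrow> dt (\<lambda>e. upair (a e) (b e))"
  by (rule dt_subst2) (auto simp: upair_def intro!: dt_setof pairing df_intros)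

lemma upair_eq: "upair a b = upair c d \<longleftrightarrow> a = c \<and> b = d \<or> a = d \<and> b = c"
proof
  assume "upair a b = upair c d"
  then have "x = a \<or> x = b \<longleftrightarrow> x = c \<or> x = d" for x
    using mem_upair[of x a b] mem_upair[of x c d] by simp
  then show "a = c \<and> b = d \<or> a = d \<and> b = c" by metis
qed (auto intro: set_ext)

lemma pair_eq [simp]: "pair a b = pair c d \<longleftrightarrow> a = c \<and> b = d"
  unfolding pair_def upair_eq by blast

lemma dt_pair [df_intros, simp]: "dt a \<Longrightarrow> dt b \<Longrightarrow> dt (\<lambda>e. pair (a e) (b e))"
  unfolding pair_def by (intro df_intros)

definition Cup :: "'v \<Rightarrow> 'v" where
  "Cup a = setof (\<lambda>x. \<exists>y. y \<epsilon> a \<and> x \<epsilon> y)"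

lemma mem_Cup [simp]: "x \<epsilon> Cup a \<longleftrightarrow> (\<exists>y. y \<epsilon> a \<and> x \<epsilon> y)"
  unfolding Cup_def by (rule mem_setof) (rule union)

lemma dt_Cup [df_intros, simp]: "dt a \<Longrightarrow> dt (\<lambda>e. Cup (a e))"
  by (rule dt_subst1) (auto simp: Cup_def intro!: dt_setof union df_intros)

lemma df_subset [df_intros, simp]: "dt a \<Longrightarrow> dt b \<Longrightarrow> df (\<lambda>e. subset (a e) (b e))"
  by (rule df_subst2) (auto simp: subset_def intro!: df_intros)

lemma subsetI: "(\<And>x. x \<epsilon> a \<Longrightarrow> x \<epsilon> b) \<Longrightarrow> subset a b"
  by (simp add: subset_def)

lemma subsetD: "subset a b \<Longrightarrow> x \<epsilon> a \<Longrightarrow> x \<epsilon> b"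
  by (simp add: subset_def)

lemma subset_refl [simp]: "subset a a"
  by (simp add: subset_def)

lemma mem_Power [simp]: "x \<epsilon> Power a \<longleftrightarrow> subset x a"
  unfolding Power_def by (rule mem_setof) (auto simp: subset_def power_set)

lemma dt_Power [df_intros, simp]: "dt a \<Longrightarrow> dt (\<lambda>e. Power (a e))"
  by (rule dt_subst1)
    (auto simp: Power_def subset_def intro!: dt_setof power_set df_intros)

lemma mem_adjoin [simp]: "x \<epsilon> adjoin u a \<longleftrightarrow> x \<epsilon> u \<or> x = a"
  unfolding adjoin_def by (rule mem_setof, rule exI[of _ "Cup (upair u (upair a a))"]) auto

lemma dt_adjoin [df_intros, simp]: "dt a \<Longrightarrow> dt b \<Longrightarrow> dt (\<lambda>e. adjoin (a e) (b e))"
proof (rule dt_subst2[where Q = adjoin])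
  have "adjoin u a = Cup (upair u (upair a a))" for u a
    by (rule set_ext) auto
  then show "dt (\<lambda>e. adjoin (e 0) (e (Suc 0)))" by simp
qed

lemma diff_eq_sep: "diff a b = sep a (\<lambda>x. \<not> x \<epsilon> b)"
  by (simp add: diff_def sep_def)

lemma mem_diff [simp]: "x \<epsilon> diff a b \<longleftrightarrow> x \<epsilon> a \<and> \<not> x \<epsilon> b"
  by (simp add: diff_eq_sep)

lemma dt_diff [df_intros, simp]: "dt a \<Longrightarrow> dt b \<Longrightarrow> dt (\<lambda>e. diff (a e) (b e))"
  by (rule dt_subst2) (auto simp: diff_eq_sep)

lemma mem_empty [simp]: "\<not> x \<epsilon> empty"
proof -
  have "x \<epsilon> empty \<longleftrightarrow> False"
    unfolding empty_def by (rule mem_setof, rule exI[of _ "diff x x"]) simp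
  then show ?thesis by simp
qed

lemma empty_iff: "a = empty \<longleftrightarrow> (\<forall>x. \<not> x \<epsilon> a)"
  by (auto intro: set_ext)

definition prod :: "'v \<Rightarrow> 'v \<Rightarrow> 'v" where
  "prod a b = Cup (repl a (\<lambda>x. repl b (\<lambda>y. pair x y)))"

lemma mem_prod [simp]: "p \<epsilon> prod a b \<longleftrightarrow> (\<exists>x y. x \<epsilon> a \<and> y \<epsilon> b \<and> p = pair x y)"
  by (auto simp: prod_def)

lemma dt_prod [df_intros, simp]: "dt a \<Longrightarrow> dt b \<Longrightarrow> dt (\<lambda>e. prod (a e) (b e))"
  by (rule dt_subst2) (simp_all add: prod_def)

text \<open>Application that is total: unlike \<open>app\<close>, it has a known value, and so is definable, even when
  \<open>f\<close> is not single-valued at \<open>x\<close>.\<close>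

definition ap :: "'v \<Rightarrow> 'v \<Rightarrow> 'v" where
  "ap f x = (if \<exists>!y. pair x y \<epsilon> f then THE y. pair x y \<epsilon> f else empty)"

lemma ap_graph: "y = ap f x \<longleftrightarrow>
    (\<exists>!y. pair x y \<epsilon> f) \<and> pair x y \<epsilon> f \<or> \<not> (\<exists>!y. pair x y \<epsilon> f) \<and> y = empty"
proof (cases "\<exists>!y. pair x y \<epsilon> f")
  case True
  then have "pair x (ap f x) \<epsilon> f" using theI'[OF True] by (simp add: ap_def)
  then show ?thesis using True by blast
qed (simp add: ap_def)

lemma dt_ap [df_intros, simp]: "dt a \<Longrightarrow> dt b \<Longrightarrow> dt (\<lambda>e. ap (a e) (b e))"
proof (rule dt_subst2[where Q = ap])
  show "dt (\<lambda>e. ap (e 0) (e (Suc 0)))"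
    by (rule dt_graph[OF _ ap_graph]) (intro df_intros)
qed auto

lemma df_func [df_intros, simp]: "dt f \<Longrightarrow> dt a \<Longrightarrow> dt b \<Longrightarrow> df (\<lambda>e. func (f e) (a e) (b e))"
  by (rule df_subst3) (auto simp: func_def intro!: df_intros)

lemma func_unique: "func f a b \<Longrightarrow> x \<epsilon> a \<Longrightarrow> \<exists>!y. pair x y \<epsilon> f"
  by (auto simp: func_def)

lemma app_eq_ap: "func f a b \<Longrightarrow> x \<epsilon> a \<Longrightarrow> app f x = ap f x"
  using func_unique[of f a b x] by (simp add: app_def ap_def)

lemma func_pair: "func f a b \<Longrightarrow> pair x y \<epsilon> f \<longleftrightarrow> x \<epsilon> a \<and> y = ap f x"
proof -
  assume f: "func f a b"
  show ?thesis
  proof (cases "x \<epsilon> a")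
    case True
    then show ?thesis using func_unique[OF f True] ap_graph[of y f x] by blast
  next
    case False
    then show ?thesis using f by (auto simp: func_def)
  qed
qed

lemma func_ap: "func f a b \<Longrightarrow> x \<epsilon> a \<Longrightarrow> ap f x \<epsilon> b"
  using func_pair[of f a b x "ap f x"] by (auto simp: func_def)

lemma func_mem: "func f a b \<Longrightarrow> p \<epsilon> f \<longleftrightarrow> (\<exists>x. x \<epsilon> a \<and> p = pair x (ap f x))"
  using func_pair[of f a b] unfolding func_def by blast

lemma func_mono: "func f a b \<Longrightarrow> (\<And>x. x \<epsilon> a \<Longrightarrow> ap f x \<epsilon> c) \<Longrightarrow> func f a c"
  using func_mem[of f a b] func_unique[of f a b] unfolding func_def[of f a c] by simp blast

definition lam :: "'v \<Rightarrow> ('v \<Rightarrow> 'v) \<Rightarrow> 'v" where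
  "lam a t = repl a (\<lambda>x. pair x (t x))"

lemma dt_lam [df_intros, simp]:
  "dt a \<Longrightarrow> dt (\<lambda>e. t (e 0) (\<lambda>n. e (Suc n))) \<Longrightarrow> dt (\<lambda>e. lam (a e) (\<lambda>x. t x e))"
  unfolding lam_def by (intro df_intros)

lemma pair_lam [simp]: "dt (\<lambda>e. t (e 0)) \<Longrightarrow> pair x y \<epsilon> lam a t \<longleftrightarrow> x \<epsilon> a \<and> y = t x"
  by (auto simp: lam_def)

lemma ap_lam [simp]: "dt (\<lambda>e. t (e 0)) \<Longrightarrow> x \<epsilon> a \<Longrightarrow> ap (lam a t) x = t x"
  by (simp add: ap_def)

lemma func_lam: "dt (\<lambda>e. t (e 0)) \<Longrightarrow> (\<And>x. x \<epsilon> a \<Longrightarrow> t x \<epsilon> b) \<Longrightarrow> func (lam a t) a b"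
  by (auto simp: func_def) (auto simp: lam_def)

lemma ex_funs: "\<exists>z. \<forall>f. f \<epsilon> z \<longleftrightarrow> func f a b"
proof -
  have "subset f (prod a b)" if "func f a b" for f
    using that by (auto simp: subset_def func_def)
  then show ?thesis
    by (intro exI[of _ "sep (Power (prod a b)) (\<lambda>f. func f a b)"]) auto
qed

lemma mem_funs [simp]: "f \<epsilon> funs a b \<longleftrightarrow> func f a b"
  unfolding funs_def by (rule mem_setof[OF ex_funs])

lemma dt_funs [df_intros, simp]: "dt a \<Longrightarrow> dt b \<Longrightarrow> dt (\<lambda>e. funs (a e) (b e))"
  by (rule dt_subst2) (auto simp: funs_def intro!: dt_setof ex_funs df_intros)

lemma func_onD: "func_on f a \<Longrightarrow> func f a (repl a (ap f))"
  unfolding func_on_def by (elim exE, erule func_mono) auto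

lemma func_on_lam: "dt (\<lambda>e. t (e 0)) \<Longrightarrow> func_on (lam a t) a"
  unfolding func_on_def by (rule exI[of _ "repl a t"], rule func_lam) auto

lemma func_empty [simp]: "func f empty b \<longleftrightarrow> f = empty"
  by (auto simp: func_def empty_iff)

section \<open>Bijections\<close>

lemma df_bijection [df_intros, simp]:
  "dt f \<Longrightarrow> dt a \<Longrightarrow> dt b \<Longrightarrow> df (\<lambda>e. bijection (f e) (a e) (b e))"
  by (rule df_subst3) (auto simp: bijection_def intro!: df_intros)

lemma df_eqpoll [df_intros, simp]: "dt a \<Longrightarrow> dt b \<Longrightarrow> df (\<lambda>e. eqpoll (a e) (b e))"
  by (rule df_subst2) (auto simp: eqpoll_def intro!: df_intros)

lemma bijection_iff: "bijection f a b \<longleftrightarrow> func f a b \<and>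
    (\<forall>x x'. x \<epsilon> a \<and> x' \<epsilon> a \<and> ap f x = ap f x' \<longrightarrow> x = x') \<and>
    (\<forall>y. y \<epsilon> b \<longrightarrow> (\<exists>x. x \<epsilon> a \<and> ap f x = y))"
proof (cases "func f a b")
  case True
  show ?thesis
    using func_pair[OF True] func_ap[OF True] unfolding bijection_def by (simp add: True) metis
qed (simp add: bijection_def)

lemma eqpollI:
  assumes "dt (\<lambda>e. t (e 0))"
    and "\<And>x. x \<epsilon> a \<Longrightarrow> t x \<epsilon> b"
    and "\<And>x x'. x \<epsilon> a \<Longrightarrow> x' \<epsilon> a \<Longrightarrow> t x = t x' \<Longrightarrow> x = x'"
    and "\<And>y. y \<epsilon> b \<Longrightarrow> \<exists>x. x \<epsilon> a \<and> t x = y"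
  shows "eqpoll a b"
proof -
  have "bijection (lam a t) a b"
    unfolding bijection_iff using assms by (intro conjI func_lam) (auto cong: conj_cong)
  then show ?thesis by (auto simp: eqpoll_def)
qed

lemma eqpollE:
  assumes "eqpoll a b"
  obtains f where "func f a b" "\<forall>x. x \<epsilon> a \<longrightarrow> ap f x \<epsilon> b"
    and "\<forall>x x'. x \<epsilon> a \<and> x' \<epsilon> a \<and> ap f x = ap f x' \<longrightarrow> x = x'"
    and "\<forall>y. y \<epsilon> b \<longrightarrow> (\<exists>x. x \<epsilon> a \<and> ap f x = y)"
proof -
  obtain f where "bijection f a b" using assms by (auto simp: eqpoll_def)
  then show thesis
    using func_ap[of f a b] by (intro that[of f]) (auto simp: bijection_iff)
qed

lemma eqpoll_refl [simp]: "eqpoll a a"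
  by (rule eqpollI[where t = "\<lambda>x. x"]) auto

lemma eqpoll_trans: "eqpoll a b \<Longrightarrow> eqpoll b c \<Longrightarrow> eqpoll a c"
proof -
  assume ab: "eqpoll a b" and bc: "eqpoll b c"
  obtain f where f: "func f a b" "\<forall>x. x \<epsilon> a \<longrightarrow> ap f x \<epsilon> b"
      "\<forall>x x'. x \<epsilon> a \<and> x' \<epsilon> a \<and> ap f x = ap f x' \<longrightarrow> x = x'"
      "\<forall>y. y \<epsilon> b \<longrightarrow> (\<exists>x. x \<epsilon> a \<and> ap f x = y)"
    using ab by (rule eqpollE)
  obtain g where g: "func g b c" "\<forall>x. x \<epsilon> b \<longrightarrow> ap g x \<epsilon> c"
      "\<forall>x x'. x \<epsilon> b \<and> x' \<epsilon> b \<and> ap g x = ap g x' \<longrightarrow> x = x'"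
      "\<forall>y. y \<epsilon> c \<longrightarrow> (\<exists>x. x \<epsilon> b \<and> ap g x = y)"
    using bc by (rule eqpollE)
  show ?thesis
    by (rule eqpollI[where t = "\<lambda>x. ap g (ap f x)"]) (simp, (use f g in metis)+)
qed

lemma eqpoll_sym: "eqpoll a b \<Longrightarrow> eqpoll b a"
proof -
  assume "eqpoll a b"
  then obtain f where f: "func f a b" "\<forall>x. x \<epsilon> a \<longrightarrow> ap f x \<epsilon> b"
      "\<forall>x x'. x \<epsilon> a \<and> x' \<epsilon> a \<and> ap f x = ap f x' \<longrightarrow> x = x'"
      "\<forall>y. y \<epsilon> b \<longrightarrow> (\<exists>x. x \<epsilon> a \<and> ap f x = y)"
    by (rule eqpollE)
  \<comment> \<open>The inverse is the converse relation, read as a function.\<close>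
  define g where "g = repl a (\<lambda>x. pair (ap f x) x)"
  have g: "pair y x \<epsilon> g \<longleftrightarrow> x \<epsilon> a \<and> y = ap f x" for x y
    by (auto simp: g_def)
  have "ap g (ap f x) = x" if "x \<epsilon> a" for x
    using ap_graph[of x g "ap f x"] that f(3) unfolding g by metis
  then show ?thesis
    by (intro eqpollI[where t = "ap g"]) (simp, (use f in metis)+)
qed

section \<open>Foundation and ordinals\<close>

lemma mem_minimal: "x \<epsilon> a \<Longrightarrow> \<exists>m. m \<epsilon> a \<and> \<not> (\<exists>z. z \<epsilon> a \<and> z \<epsilon> m)"
  using foundation[of a] by blast

lemma mem_irrefl [simp]: "\<not> x \<epsilon> x"
  using mem_minimal[of x "upair x x"] by auto

lemma mem_asym: "x \<epsilon> y \<Longrightarrow> \<not> y \<epsilon> x"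
  using mem_minimal[of x "upair x y"] by auto

lemma df_trans_set [df_intros, simp]: "dt a \<Longrightarrow> df (\<lambda>e. trans_set (a e))"
  by (rule df_subst1) (auto simp: trans_set_def intro!: df_intros)

lemma df_Ord [df_intros, simp]: "dt a \<Longrightarrow> df (\<lambda>e. Ord (a e))"
  by (rule df_subst1) (auto simp: Ord_def intro!: df_intros)

lemma df_le [df_intros, simp]: "dt a \<Longrightarrow> dt b \<Longrightarrow> df (\<lambda>e. le (a e) (b e))"
  by (rule df_subst2) (auto simp: le_def intro!: df_intros)

lemma Ord_trans: "Ord \<alpha> \<Longrightarrow> \<beta> \<epsilon> \<alpha> \<Longrightarrow> \<gamma> \<epsilon> \<beta> \<Longrightarrow> \<gamma> \<epsilon> \<alpha>"
  unfolding Ord_def trans_set_def by blast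

lemma Ord_mem: "Ord \<alpha> \<Longrightarrow> \<beta> \<epsilon> \<alpha> \<Longrightarrow> Ord \<beta>"
  unfolding Ord_def trans_set_def by blast

lemma OrdI:
  "(\<And>y z. y \<epsilon> x \<Longrightarrow> z \<epsilon> y \<Longrightarrow> z \<epsilon> x) \<Longrightarrow> (\<And>y. y \<epsilon> x \<Longrightarrow> Ord y) \<Longrightarrow> Ord x"
  unfolding Ord_def trans_set_def by blast

lemma least_Ord:
  assumes "df (\<lambda>e. P (e 0))" "Ord \<alpha>" "P \<alpha>"
  shows "\<exists>\<beta>. Ord \<beta> \<and> P \<beta> \<and> (\<forall>\<gamma>. \<gamma> \<epsilon> \<beta> \<longrightarrow> \<not> P \<gamma>)"
proof -
  have "\<alpha> \<epsilon> sep (adjoin \<alpha> \<alpha>) P" using assms by simp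
  from mem_minimal[OF this] obtain m where
    m: "m \<epsilon> sep (adjoin \<alpha> \<alpha>) P" "\<not> (\<exists>z. z \<epsilon> sep (adjoin \<alpha> \<alpha>) P \<and> z \<epsilon> m)" by blast
  have "\<not> P \<gamma>" if "\<gamma> \<epsilon> m" for \<gamma>
    using m that assms Ord_trans[OF assms(2), of m \<gamma>] by auto
  moreover have "Ord m" "P m" using m(1) assms Ord_mem by auto
  ultimately show ?thesis by blast
qed

text \<open>Take \<open>a\<close> least among the ordinals that are incomparable with some ordinal, and \<open>b\<close> least among
  those incomparable with \<open>a\<close>. Then every element of one is an element of the other.\<close>

lemma Ord_linear: "Ord \<alpha> \<Longrightarrow> Ord \<beta> \<Longrightarrow> \<alpha> \<epsilon> \<beta> \<or> \<alpha> = \<beta> \<or> \<beta> \<epsilon> \<alpha>"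
proof (rule ccontr)
  let ?C = "\<lambda>\<alpha> \<beta>. \<alpha> \<epsilon> \<beta> \<or> \<alpha> = \<beta> \<or> \<beta> \<epsilon> \<alpha>"
  assume "Ord \<alpha>" "Ord \<beta>" "\<not> ?C \<alpha> \<beta>"
  then have "Ord \<alpha>" "\<exists>\<beta>. Ord \<beta> \<and> \<not> ?C \<alpha> \<beta>" by blast+
  then have "\<exists>a. Ord a \<and> (\<exists>\<beta>. Ord \<beta> \<and> \<not> ?C a \<beta>) \<and>
      (\<forall>\<gamma>. \<gamma> \<epsilon> a \<longrightarrow> \<not> (\<exists>\<beta>. Ord \<beta> \<and> \<not> ?C \<gamma> \<beta>))"
    by (intro least_Ord[of "\<lambda>a. \<exists>\<beta>. Ord \<beta> \<and> \<not> ?C a \<beta>"] df_intros)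
  then obtain a \<beta>' where a: "Ord a" "Ord \<beta>'" "\<not> ?C a \<beta>'"
      and a_min: "\<And>\<gamma> \<beta>. \<gamma> \<epsilon> a \<Longrightarrow> Ord \<beta> \<Longrightarrow> ?C \<gamma> \<beta>"
    by blast
  have "\<exists>b. Ord b \<and> \<not> ?C a b \<and> (\<forall>\<gamma>. \<gamma> \<epsilon> b \<longrightarrow> \<not> \<not> ?C a \<gamma>)"
    using a(2,3) by (intro least_Ord[of "\<lambda>b. \<not> ?C a b"] df_intros)
  then obtain b where b: "Ord b" "\<not> ?C a b" and b_min: "\<And>\<gamma>. \<gamma> \<epsilon> b \<Longrightarrow> ?C a \<gamma>"
    by blast
  have "a = b"
  proof (rule set_ext, rule iffI)
    fix z assume z: "z \<epsilon> a"
    then show "z \<epsilon> b" using a_min[OF z b(1)] b a(1) Ord_trans[of a z b] by blast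
  next
    fix z assume z: "z \<epsilon> b"
    then show "z \<epsilon> a" using b_min[OF z] b Ord_trans[of b z a] by blast
  qed
  then show False using b by blast
qed

lemma Ord_subset: "Ord \<alpha> \<Longrightarrow> Ord \<beta> \<Longrightarrow> subset \<alpha> \<beta> \<longleftrightarrow> le \<alpha> \<beta>"
  using Ord_linear[of \<alpha> \<beta>] Ord_trans mem_irrefl unfolding le_def subset_def by blast

lemma Ord_empty [simp]: "Ord empty"
  by (rule OrdI) auto

lemma Ord_succ [simp]: "Ord \<alpha> \<Longrightarrow> Ord (adjoin \<alpha> \<alpha>)"
  by (rule OrdI) (auto intro: Ord_mem Ord_trans)

lemma Ord_Cup: "(\<And>x. x \<epsilon> a \<Longrightarrow> Ord x) \<Longrightarrow> Ord (Cup a)"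
  by (rule OrdI) (auto, meson Ord_trans, meson Ord_mem)

lemma Ord_bound:
  assumes "\<And>x. x \<epsilon> a \<Longrightarrow> Ord x"
  shows "\<exists>\<beta>. Ord \<beta> \<and> (\<forall>x. x \<epsilon> a \<longrightarrow> x \<epsilon> \<beta>)"
proof (intro exI conjI allI impI)
  let ?\<beta> = "adjoin (Cup a) (Cup a)"
  show "Ord ?\<beta>" using assms by (simp add: Ord_Cup)
  show "x \<epsilon> ?\<beta>" if "x \<epsilon> a" for x
  proof -
    have "subset x (Cup a)" using that by (auto simp: subset_def)
    then show ?thesis using assms that Ord_Cup[of a] Ord_subset[of x "Cup a"] by (auto simp: le_def)
  qed
qed

lemma no_set_of_all_Ord: "\<exists>\<alpha>. Ord \<alpha> \<and> \<not> \<alpha> \<epsilon> a"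
proof -
  obtain \<beta> where \<beta>: "Ord \<beta>" "\<forall>x. x \<epsilon> sep a Ord \<longrightarrow> x \<epsilon> \<beta>"
    using Ord_bound[of "sep a Ord"] by auto
  then have "\<not> \<beta> \<epsilon> a" using mem_irrefl[of \<beta>] by auto
  then show ?thesis using \<beta>(1) by blast
qed

lemma succ_inject: "adjoin m m = adjoin n n \<Longrightarrow> m = n"
  using mem_asym[of m n] by (metis mem_adjoin)

section \<open>The natural numbers\<close>

text \<open>The description of \<open>omega\<close> denotes: an inductive set contains every number, for a least
  number outside it would be neither empty nor a successor.\<close>

lemma mem_omega: "n \<epsilon> omega \<longleftrightarrow>
    Ord n \<and> (\<forall>m. m \<epsilon> n \<or> m = n \<longrightarrow> m = empty \<or> (\<exists>k. m = adjoin k k))"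
proof -
  let ?nat = "\<lambda>n. Ord n \<and> (\<forall>m. m \<epsilon> n \<or> m = n \<longrightarrow> m = empty \<or> (\<exists>k. m = adjoin k k))"
  obtain z where z0: "empty \<epsilon> z" and z_succ: "\<And>x. x \<epsilon> z \<Longrightarrow> adjoin x x \<epsilon> z"
  proof -
    obtain z e where e: "e \<epsilon> z" "\<forall>w. \<not> w \<epsilon> e"
      and z: "\<forall>x. x \<epsilon> z \<longrightarrow> (\<exists>y. y \<epsilon> z \<and> (\<forall>w. w \<epsilon> y \<longleftrightarrow> w \<epsilon> x \<or> w = x))"
      using infinity by blast
    have "e = empty" using e by (simp add: empty_iff)
    moreover have "y = adjoin x x" if "\<forall>w. w \<epsilon> y \<longleftrightarrow> w \<epsilon> x \<or> w = x" for x y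
      using that by (intro set_ext) simp
    ultimately show thesis using e z that[of z] by metis
  qed
  have "n \<epsilon> z" if "?nat n" for n
  proof (rule ccontr)
    assume "\<not> n \<epsilon> z"
    have d: "df (\<lambda>e. \<not> e 0 \<epsilon> z)" by simp
    from mem_minimal[of n "sep (adjoin n n) (\<lambda>m. \<not> m \<epsilon> z)"] \<open>\<not> n \<epsilon> z\<close>
    obtain m where m: "m \<epsilon> n \<or> m = n" "\<not> m \<epsilon> z"
      "\<And>k. k \<epsilon> n \<or> k = n \<Longrightarrow> k \<epsilon> m \<Longrightarrow> k \<epsilon> z"
      by auto
    from m(1) that have "m = empty \<or> (\<exists>k. m = adjoin k k)" by blast
    moreover have "k \<epsilon> z" if "m = adjoin k k" for k
      using m(1) m(3)[of k] that \<open>?nat n\<close> Ord_trans[of n m k] by auto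
    ultimately show False using m(2) z0 z_succ by auto
  qed
  then show ?thesis
    unfolding omega_def
    by (intro mem_setof exI[of _ "sep z ?nat"]) auto
qed

lemma omega_Ord_mem: "n \<epsilon> omega \<Longrightarrow> Ord n"
  by (simp add: mem_omega)

lemma omega_trans: "n \<epsilon> omega \<Longrightarrow> m \<epsilon> n \<Longrightarrow> m \<epsilon> omega"
  unfolding mem_omega by (auto intro: Ord_mem dest: Ord_trans)

lemma Ord_omega [simp]: "Ord omega"
  by (rule OrdI) (auto intro: omega_trans omega_Ord_mem)

lemma empty_in_omega [simp]: "empty \<epsilon> omega"
  by (simp add: mem_omega)

lemma succ_in_omega [simp]: "n \<epsilon> omega \<Longrightarrow> adjoin n n \<epsilon> omega"
  unfolding mem_omega by auto

lemma omega_cases: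
  assumes "n \<epsilon> omega"
  obtains "n = empty" | k where "k \<epsilon> omega" "n = adjoin k k"
  using assms omega_trans[OF assms] unfolding mem_omega[of n] by auto

lemma omega_induct:
  assumes "df (\<lambda>e. P (e 0))" "P empty" "\<And>n. n \<epsilon> omega \<Longrightarrow> P n \<Longrightarrow> P (adjoin n n)"
    and "n \<epsilon> omega"
  shows "P n"
proof (rule ccontr)
  assume "\<not> P n"
  with assms obtain m where m: "m \<epsilon> omega" "\<not> P m" "\<And>k. k \<epsilon> omega \<Longrightarrow> k \<epsilon> m \<Longrightarrow> P k"
    using mem_minimal[of n "sep omega (\<lambda>n. \<not> P n)"] by auto
  from m(1) show False
    by (rule omega_cases) (use m assms(2,3) in auto)
qed

lemma num_in_omega [simp]: "num i \<epsilon> omega"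
  by (induction i) auto

lemma num_mem: "i < k \<Longrightarrow> num i \<epsilon> num k"
  by (induction k) (auto simp: less_Suc_eq)

lemma num_eq [simp]: "num i = num k \<longleftrightarrow> i = k"
  using num_mem[of i k] num_mem[of k i] mem_irrefl by (metis nat_neq_iff)

section \<open>Well-founded recursion\<close>

text \<open>The predecessors of \<open>x\<close> form the set \<open>pr x\<close>. As there is separation only within sets, the
  premise \<open>cl\<close> provides a set containing \<open>x\<close> that is closed under predecessors.\<close>

lemma wf_induct:
  assumes cl: "\<And>x. \<exists>A. x \<epsilon> A \<and> (\<forall>y. y \<epsilon> A \<longrightarrow> subset (pr y) A)"
    and wf: "\<And>S x. x \<epsilon> S \<Longrightarrow> \<exists>m. m \<epsilon> S \<and> \<not> (\<exists>z. z \<epsilon> S \<and> z \<epsilon> pr m)"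
    and P: "df (\<lambda>e. P (e 0))"
    and step: "\<And>x. (\<And>z. z \<epsilon> pr x \<Longrightarrow> P z) \<Longrightarrow> P x"
  shows "P x"
proof (rule ccontr)
  assume "\<not> P x"
  obtain A where A: "x \<epsilon> A" "\<And>y z. y \<epsilon> A \<Longrightarrow> z \<epsilon> pr y \<Longrightarrow> z \<epsilon> A"
    using cl[of x] unfolding subset_def by blast
  obtain m where "m \<epsilon> A" "\<not> P m" "\<And>z. z \<epsilon> A \<Longrightarrow> z \<epsilon> pr m \<Longrightarrow> P z"
    using wf[of x "sep A (\<lambda>x. \<not> P x)"] \<open>\<not> P x\<close> A(1) P by auto
  then show False using step A(2) by blast
qed

text \<open>As usual, the solution is the union of the partial solutions on closed sets (\<open>attempt\<close>), and any
  two of these agree. At a minimal point \<open>m\<close> outside all of them, collecting one partial solution for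
  each predecessor would require choice. This is avoided by restricting to a closed set \<open>A\<close> that contains
  \<open>m\<close>: the points of \<open>A\<close> where some partial solution is defined form a closed set, and the common
  values on it, extended to \<open>m\<close>, are a partial solution.\<close>

lemma wf_recursion:
  assumes pr: "dt (\<lambda>e. pr (e 0))" and G: "dt (\<lambda>e. G (e 0))"
    and cl: "\<And>x. \<exists>A. x \<epsilon> A \<and> (\<forall>y. y \<epsilon> A \<longrightarrow> subset (pr y) A)"
    and wf: "\<And>S x. x \<epsilon> S \<Longrightarrow> \<exists>m. m \<epsilon> S \<and> \<not> (\<exists>z. z \<epsilon> S \<and> z \<epsilon> pr m)"
  shows "\<exists>F. dt (\<lambda>e. F (e 0)) \<and> (\<forall>x. F x = G (repl (pr x) F))"
proof -
  note [simp] = dt_subst1[OF pr] dt_subst1[OF G]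
  define attempt where "attempt h A \<longleftrightarrow> (\<forall>y. y \<epsilon> A \<longrightarrow> subset (pr y) A) \<and>
    (\<forall>x. x \<epsilon> A \<longrightarrow> ap h x = G (repl (pr x) (\<lambda>z. ap h z)))" for h A
  have df_attempt [simp]: "df (\<lambda>e. attempt (h e) (A e))" if "dt h" "dt A" for h A
    by (rule df_subst2[OF _ that]) (simp add: attempt_def)
  have att_closed: "z \<epsilon> A" if "attempt h A" "y \<epsilon> A" "z \<epsilon> pr y" for h A y z
    using that by (auto simp: attempt_def subset_def)
  have unique: "ap h x = ap h' x"
    if att: "attempt h A" "attempt h' A'" and x: "x \<epsilon> A" "x \<epsilon> A'" for h A h' A' x
  proof (rule ccontr)
    assume "ap h x \<noteq> ap h' x"
    then obtain m where m: "m \<epsilon> A" "m \<epsilon> A'" "ap h m \<noteq> ap h' m"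
      "\<And>z. z \<epsilon> A \<Longrightarrow> z \<epsilon> A' \<Longrightarrow> z \<epsilon> pr m \<Longrightarrow> ap h z = ap h' z"
      using wf[of x "sep A (\<lambda>x. x \<epsilon> A' \<and> ap h x \<noteq> ap h' x)"] x by auto
    have "repl (pr m) (ap h) = repl (pr m) (ap h')"
      using m att by (intro repl_cong) (auto simp: attempt_def subset_def)
    then show False using m(1-3) att by (auto simp: attempt_def)
  qed
  define F where "F x = (if \<exists>h A. attempt h A \<and> x \<epsilon> A
    then ap (SOME h. \<exists>A. attempt h A \<and> x \<epsilon> A) x else empty)" for x
  have F_eq: "F x = ap h x" if "attempt h A" "x \<epsilon> A" for h A x
  proof -
    let ?h = "SOME h. \<exists>A. attempt h A \<and> x \<epsilon> A"
    have "\<exists>A. attempt ?h A \<and> x \<epsilon> A"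
      by (rule someI_ex) (use that in blast)
    then obtain A' where A': "attempt ?h A'" "x \<epsilon> A'" by blast
    have "F x = ap ?h x"
      unfolding F_def by (rule if_P) (use that in blast)
    also have "\<dots> = ap h x" by (rule unique[OF A'(1) that(1) A'(2) that(2)])
    finally show ?thesis .
  qed
  have graph: "y = F x \<longleftrightarrow> (\<exists>h A. attempt h A \<and> x \<epsilon> A \<and> y = ap h x) \<or>
      \<not> (\<exists>h A. attempt h A \<and> x \<epsilon> A) \<and> y = empty" for x y
  proof (cases "\<exists>h A. attempt h A \<and> x \<epsilon> A")
    case True
    then show ?thesis using F_eq by metis
  next
    case False
    then have "F x = empty" unfolding F_def by (rule if_not_P)
    then show ?thesis using False by metis
  qed
  have dF: "dt (\<lambda>e. F (e 0))"
    by (rule dt_graph[OF _ graph]) (intro df_intros; simp)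
  note [simp] = dt_subst1[OF dF]
  have F_step: "F x = G (repl (pr x) F)" if "attempt h' A'" "x \<epsilon> A'" for x h' A'
  proof -
    have "repl (pr x) (ap h') = repl (pr x) F"
      using that by (intro repl_cong) (auto simp: attempt_def subset_def F_eq[OF that(1)])
    then show ?thesis using that F_eq[OF that] by (simp add: attempt_def)
  qed
  have total: "\<exists>h A. attempt h A \<and> x \<epsilon> A" for x
  proof (rule ccontr)
    let ?Q = "\<lambda>x. \<exists>h A. attempt h A \<and> x \<epsilon> A"
    assume nx: "\<not> ?Q x"
    obtain A where A: "x \<epsilon> A" "\<And>y z. y \<epsilon> A \<Longrightarrow> z \<epsilon> pr y \<Longrightarrow> z \<epsilon> A"
      using cl[of x] unfolding subset_def by blast
    have "x \<epsilon> sep A (\<lambda>x. \<not> ?Q x)" using A(1) nx by simp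
    from wf[OF this] have "\<exists>m. m \<epsilon> A \<and> \<not> ?Q m \<and> (\<forall>z. z \<epsilon> A \<and> z \<epsilon> pr m \<longrightarrow> ?Q z)"
      by simp blast
    then obtain m where m: "m \<epsilon> A" "\<not> ?Q m" "\<And>z. z \<epsilon> A \<Longrightarrow> z \<epsilon> pr m \<Longrightarrow> ?Q z" by blast
    define B where "B = adjoin (sep A (\<lambda>x. \<exists>h A. attempt h A \<and> x \<epsilon> A)) m"
    define h where "h = lam B (\<lambda>x. G (repl (pr x) F))"
    have sub: "z \<epsilon> A \<and> (\<exists>h A. attempt h A \<and> z \<epsilon> A)" if "y \<epsilon> B" "z \<epsilon> pr y" for y z
      using that A(2) m(1,3) att_closed unfolding B_def by simp blast
    have h: "ap h x = G (repl (pr x) F)" if "x \<epsilon> B" for x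
      using that by (simp add: h_def)
    have "attempt h B"
      unfolding attempt_def
    proof (intro conjI allI impI)
      fix y assume y: "y \<epsilon> B"
      show "subset (pr y) B" using sub[OF y] by (auto simp: subset_def B_def)
      have "ap h z = F z" if z: "z \<epsilon> pr y" for z
      proof -
        have "z \<epsilon> B" using sub[OF y z] by (simp add: B_def)
        then show ?thesis using sub[OF y z] h[of z] F_step by metis
      qed
      then show "ap h y = G (repl (pr y) (\<lambda>z. ap h z))"
        using h[OF y] repl_cong[of "pr y" "ap h" F] by simp
    qed
    moreover have "m \<epsilon> B" by (simp add: B_def)
    ultimately show False using m(2) by blast
  qed
  have "F x = G (repl (pr x) F)" for x using total F_step by blast
  with dF show ?thesis by blast
qed

text \<open>The predecessor of a successor number is recovered as the union of the singleton of values, hence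
  the use of \<open>Cup\<close>; the empty set of values marks the number zero.\<close>

lemma omega_recursion:
  assumes H: "dt (\<lambda>e. H (e 0))"
  shows "\<exists>F. dt (\<lambda>e. F (e 0)) \<and> F empty = a \<and>
    (\<forall>n. n \<epsilon> omega \<longrightarrow> F (adjoin n n) = H (F n))"
proof -
  note [simp] = dt_subst1[OF H]
  let ?pr = "\<lambda>n. sep omega (\<lambda>m. n = adjoin m m)"
  let ?G = "\<lambda>s. if s = empty then a else H (Cup s)"
  have "\<exists>F. dt (\<lambda>e. F (e 0)) \<and> (\<forall>n. F n = ?G (repl (?pr n) F))"
  proof (rule wf_recursion)
    show "\<exists>A. x \<epsilon> A \<and> (\<forall>y. y \<epsilon> A \<longrightarrow> subset (?pr y) A)" for x
      by (rule exI[of _ "adjoin omega x"]) (simp add: subset_def)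
    show "\<exists>m. m \<epsilon> S \<and> \<not> (\<exists>z. z \<epsilon> S \<and> z \<epsilon> ?pr m)" if "x \<epsilon> S" for S x
      using mem_minimal[OF that] by simp (metis mem_adjoin)
  qed simp_all
  then obtain F where F: "dt (\<lambda>e. F (e 0))" "\<And>n. F n = ?G (repl (?pr n) F)" by blast
  note [simp] = dt_subst1[OF F(1)]
  have "repl (?pr empty) F = empty"
    unfolding empty_iff by (simp add: empty_iff) (metis mem_adjoin mem_empty)
  then have "F empty = a" by (subst F(2)) simp
  moreover have "F (adjoin n n) = H (F n)" if n: "n \<epsilon> omega" for n
  proof -
    from n have mem: "y \<epsilon> repl (?pr (adjoin n n)) F \<longleftrightarrow> y = F n" for y
      by (auto dest: succ_inject)
    then have "repl (?pr (adjoin n n)) F \<noteq> empty" using mem_empty by metis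
    moreover have "Cup (repl (?pr (adjoin n n)) F) = F n"
      by (rule set_ext) (simp only: mem_Cup mem, blast)
    ultimately show "F (adjoin n n) = H (F n)"
      by (subst F(2)) (simp only: if_False)
  qed
  ultimately show ?thesis using F(1) by blast
qed

text \<open>The union of \<open>a\<close>, \<open>Cup a\<close>, \<open>Cup (Cup a)\<close> and so on.\<close>

lemma transitive_superset: "\<exists>t. trans_set t \<and> subset a t"
proof -
  obtain F where F: "dt (\<lambda>e. F (e 0))" "F empty = a"
      "\<And>n. n \<epsilon> omega \<Longrightarrow> F (adjoin n n) = Cup (F n)"
    using omega_recursion[of Cup a] by auto
  let ?t = "Cup (repl omega F)"
  have mem: "x \<epsilon> ?t \<longleftrightarrow> (\<exists>n. n \<epsilon> omega \<and> x \<epsilon> F n)" for x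
    using F(1) by auto
  have "trans_set ?t"
    unfolding trans_set_def mem using F(3) succ_in_omega by (metis mem_Cup)
  moreover have "subset a ?t"
    unfolding subset_def mem using F(2) empty_in_omega by blast
  ultimately show ?thesis by blast
qed

lemma mem_closed_superset: "\<exists>A. x \<epsilon> A \<and> (\<forall>y. y \<epsilon> A \<longrightarrow> subset y A)"
  using transitive_superset[of "upair x x"] by (auto simp: trans_set_def subset_def)

lemma mem_induct:
  assumes "df (\<lambda>e. P (e 0))" "\<And>x. (\<And>z. z \<epsilon> x \<Longrightarrow> P z) \<Longrightarrow> P x"
  shows "P x"
  by (rule wf_induct[of "\<lambda>x. x"]) (use assms mem_minimal mem_closed_superset in auto)

lemma mem_recursion:
  assumes "dt (\<lambda>e. G (e 0))"
  shows "\<exists>F. dt (\<lambda>e. F (e 0)) \<and> (\<forall>x. F x = G (repl x F))"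
  by (rule wf_recursion[of "\<lambda>x. x" G]) (use assms mem_minimal mem_closed_superset in auto)

section \<open>Collection and choice\<close>

text \<open>Replacement turns into collection when the values can be chosen canonically.\<close>

lemma least_Ord_repl:
  assumes R: "df (\<lambda>e. R (e 0) (e (Suc 0)))"
    and ex: "\<And>x. x \<epsilon> a \<Longrightarrow> \<exists>\<alpha>. Ord \<alpha> \<and> R x \<alpha>"
  shows "\<exists>b. (\<forall>\<beta>. \<beta> \<epsilon> b \<longrightarrow> Ord \<beta>) \<and> (\<forall>x. x \<epsilon> a \<longrightarrow> (\<exists>\<beta>. \<beta> \<epsilon> b \<and> R x \<beta>))"
proof -
  note [simp] = df_subst2[OF R]
  let ?Q = "\<lambda>x \<alpha>. Ord \<alpha> \<and> R x \<alpha> \<and> (\<forall>\<gamma>. \<gamma> \<epsilon> \<alpha> \<longrightarrow> \<not> R x \<gamma>)"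
  have unique: "\<exists>!\<alpha>. ?Q x \<alpha>" if x: "x \<epsilon> a" for x
  proof -
    obtain \<alpha> where "Ord \<alpha>" "R x \<alpha>" using ex[OF x] by blast
    then have "\<exists>\<beta>. ?Q x \<beta>" by (intro least_Ord) simp_all
    then show ?thesis using Ord_linear by blast
  qed
  have "\<exists>b. \<forall>y. y \<epsilon> b \<longleftrightarrow> (\<exists>x. x \<epsilon> a \<and> ?Q x y)"
    by (rule ex_repl[OF _ unique]) simp_all
  then obtain b where b: "\<And>y. y \<epsilon> b \<longleftrightarrow> (\<exists>x. x \<epsilon> a \<and> ?Q x y)" by blast
  have "\<exists>\<beta>. \<beta> \<epsilon> b \<and> R x \<beta>" if x: "x \<epsilon> a" for x
  proof -
    obtain \<beta> where \<beta>: "?Q x \<beta>" using ex1_implies_ex[OF unique[OF x]] by blast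
    then have "\<beta> \<epsilon> b" unfolding b using x by blast
    then show ?thesis using \<beta> by blast
  qed
  then show ?thesis using b by blast
qed

text \<open>The recursion \<open>L x = Cup {Power (L y) | y \<in> x}\<close> runs over all sets, and not only over ordinals.
  This makes it simple to see that every set is included in some \<open>L x\<close>, namely \<open>x \<subseteq> L x\<close>; bounding
  \<open>L x\<close> by a level with an ordinal index is a separate induction.\<close>

lemma ordinal_hierarchy:
  "\<exists>L. dt (\<lambda>e. L (e 0)) \<and> (\<forall>x. \<exists>\<alpha>. Ord \<alpha> \<and> x \<epsilon> L \<alpha>)"
proof -
  obtain L where L: "dt (\<lambda>e. L (e 0))" "\<And>x. L x = Cup (repl (repl x L) Power)"
    using mem_recursion[of "\<lambda>s. Cup (repl s Power)"] by auto
  note [simp] = dt_subst1[OF L(1)]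
  have mem_L: "z \<epsilon> L x \<longleftrightarrow> (\<exists>y. y \<epsilon> x \<and> subset z (L y))" for x z
    by (subst L(2)) (simp, metis mem_Power)
  have self: "subset x (L x)" for x
  proof (rule mem_induct[of "\<lambda>x. subset x (L x)"])
    fix x assume "\<And>z. z \<epsilon> x \<Longrightarrow> subset z (L z)"
    then show "subset x (L x)" by (intro subsetI) (unfold mem_L, blast)
  qed simp
  have bound: "\<exists>\<alpha>. Ord \<alpha> \<and> subset (L x) (L \<alpha>)" for x
  proof (rule mem_induct[of "\<lambda>x. \<exists>\<alpha>. Ord \<alpha> \<and> subset (L x) (L \<alpha>)"])
    fix x assume "\<And>z. z \<epsilon> x \<Longrightarrow> \<exists>\<alpha>. Ord \<alpha> \<and> subset (L z) (L \<alpha>)"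
    then have "\<exists>b. (\<forall>\<beta>. \<beta> \<epsilon> b \<longrightarrow> Ord \<beta>) \<and> (\<forall>z. z \<epsilon> x \<longrightarrow> (\<exists>\<beta>. \<beta> \<epsilon> b \<and> subset (L z) (L \<beta>)))"
      by (intro least_Ord_repl) simp_all
    then obtain b where b: "\<And>\<beta>. \<beta> \<epsilon> b \<Longrightarrow> Ord \<beta>" "\<And>z. z \<epsilon> x \<Longrightarrow> \<exists>\<beta>. \<beta> \<epsilon> b \<and> subset (L z) (L \<beta>)"
      by blast
    obtain \<beta> where \<beta>: "Ord \<beta>" "\<And>y. y \<epsilon> b \<Longrightarrow> y \<epsilon> \<beta>"
      using Ord_bound[OF b(1)] by blast
    have "subset (L x) (L \<beta>)"
    proof (rule subsetI)
      fix w assume "w \<epsilon> L x"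
      then obtain z where z: "z \<epsilon> x" "subset w (L z)" unfolding mem_L by blast
      then obtain \<gamma> where "\<gamma> \<epsilon> b" "subset (L z) (L \<gamma>)" using b(2) by blast
      then have "subset w (L \<gamma>)" "\<gamma> \<epsilon> \<beta>" using z(2) \<beta>(2) by (auto simp: subset_def)
      then show "w \<epsilon> L \<beta>" unfolding mem_L by blast
    qed
    then show "\<exists>\<alpha>. Ord \<alpha> \<and> subset (L x) (L \<alpha>)" using \<beta>(1) by blast
  qed simp
  have "\<exists>\<alpha>. Ord \<alpha> \<and> x \<epsilon> L \<alpha>" for x
  proof -
    obtain \<alpha> where "Ord \<alpha>" "subset (L x) (L \<alpha>)" using bound by blast
    moreover from this have "subset x (L \<alpha>)" using self[of x] by (auto simp: subset_def)
    then have "x \<epsilon> L (adjoin \<alpha> \<alpha>)" unfolding mem_L by (intro exI[of _ \<alpha>]) simp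
    ultimately show ?thesis by (intro exI[of _ "adjoin \<alpha> \<alpha>"]) simp
  qed
  with L(1) show ?thesis by blast
qed

text \<open>Least levels of the hierarchy serve as canonical values.\<close>

lemma collection:
  assumes R: "df (\<lambda>e. R (e 0) (e (Suc 0)))"
    and ex: "\<And>x. x \<epsilon> a \<Longrightarrow> \<exists>y. R x y"
  shows "\<exists>b. \<forall>x. x \<epsilon> a \<longrightarrow> (\<exists>y. y \<epsilon> b \<and> R x y)"
proof -
  note [simp] = df_subst2[OF R]
  obtain L where L: "dt (\<lambda>e. L (e 0))" "\<And>x. \<exists>\<alpha>. Ord \<alpha> \<and> x \<epsilon> L \<alpha>"
    using ordinal_hierarchy by blast
  note [simp] = dt_subst1[OF L(1)]
  have "\<exists>\<alpha>. Ord \<alpha> \<and> (\<exists>y. y \<epsilon> L \<alpha> \<and> R x y)" if "x \<epsilon> a" for x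
    using ex[OF that] L(2) by blast
  then have "\<exists>c. (\<forall>\<beta>. \<beta> \<epsilon> c \<longrightarrow> Ord \<beta>) \<and> (\<forall>x. x \<epsilon> a \<longrightarrow> (\<exists>\<beta>. \<beta> \<epsilon> c \<and> (\<exists>y. y \<epsilon> L \<beta> \<and> R x y)))"
    by (intro least_Ord_repl) simp_all
  then obtain c where c: "\<And>x. x \<epsilon> a \<Longrightarrow> \<exists>\<beta>. \<beta> \<epsilon> c \<and> (\<exists>y. y \<epsilon> L \<beta> \<and> R x y)" by blast
  show ?thesis
    by (rule exI[of _ "Cup (repl c L)"]) (simp, use c in blast)
qed

text \<open>The axiom of choice provides transversals of disjoint families, so the subsets of \<open>b\<close> are made
  disjoint by tagging their elements.\<close>

lemma choice_function: "\<exists>c. \<forall>y. subset y b \<and> y \<noteq> empty \<longrightarrow> ap c y \<epsilon> y"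
proof -
  let ?tag = "\<lambda>y. repl y (\<lambda>z. pair y z)"
  let ?F = "repl (sep (Power b) (\<lambda>y. y \<noteq> empty)) ?tag"
  have F: "f \<epsilon> ?F \<longleftrightarrow> (\<exists>y. subset y b \<and> y \<noteq> empty \<and> f = ?tag y)" for f
    by auto
  have mem_tag: "p \<epsilon> ?tag y \<longleftrightarrow> (\<exists>z. z \<epsilon> y \<and> p = pair y z)" for p y
    by simp
  have "\<exists>w. w \<epsilon> f" if f: "f \<epsilon> ?F" for f
  proof -
    obtain y where y: "y \<noteq> empty" "f = ?tag y" using f unfolding F by blast
    then obtain z where "z \<epsilon> y" unfolding empty_iff by blast
    then show ?thesis unfolding y(2) mem_tag by blast
  qed
  moreover have "f = f'" if w: "f \<epsilon> ?F" "f' \<epsilon> ?F" "w \<epsilon> f" "w \<epsilon> f'" for f f' w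
  proof -
    obtain y y' where y: "f = ?tag y" "f' = ?tag y'" using w(1,2) unfolding F by blast
    show ?thesis using w(3,4) unfolding y mem_tag by auto
  qed
  ultimately have "\<exists>c. \<forall>f. f \<epsilon> ?F \<longrightarrow> (\<exists>!w. w \<epsilon> f \<and> w \<epsilon> c)"
    by (intro choice[rule_format]) blast
  then obtain c where c: "\<And>f. f \<epsilon> ?F \<Longrightarrow> \<exists>!w. w \<epsilon> f \<and> w \<epsilon> c" by blast
  define d where "d = sep c (\<lambda>p. \<exists>y z. z \<epsilon> y \<and> p = pair y z)"
  have "ap d y \<epsilon> y" if "subset y b" "y \<noteq> empty" for y
  proof -
    have "\<exists>!w. w \<epsilon> ?tag y \<and> w \<epsilon> c" using c[of "?tag y"] that F by blast
    then have "\<exists>!z. z \<epsilon> y \<and> pair y z \<epsilon> c" unfolding mem_tag by (metis pair_eq)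
    then have "\<exists>!z. pair y z \<epsilon> d" by (simp add: d_def conj_commute)
    then have "pair y (ap d y) \<epsilon> d" using ap_graph by blast
    then show ?thesis by (auto simp: d_def)
  qed
  then show ?thesis by blast
qed

lemma class_choice:
  assumes R: "df (\<lambda>e. R (e 0) (e (Suc 0)))"
    and ex: "\<And>x. x \<epsilon> a \<Longrightarrow> \<exists>y. R x y"
  shows "\<exists>g. func_on g a \<and> (\<forall>x. x \<epsilon> a \<longrightarrow> R x (ap g x))"
proof -
  note [simp] = df_subst2[OF R]
  obtain b where b: "\<And>x. x \<epsilon> a \<Longrightarrow> \<exists>y. y \<epsilon> b \<and> R x y"
    using collection[OF R ex] by blast
  obtain c where c: "\<And>y. subset y b \<Longrightarrow> y \<noteq> empty \<Longrightarrow> ap c y \<epsilon> y"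
    using choice_function[of b] by blast
  have "ap c (sep b (R x)) \<epsilon> sep b (R x)" if "x \<epsilon> a" for x
    using b[OF that] by (intro c) (auto simp: subset_def empty_iff)
  then show ?thesis
    by (intro exI[of _ "lam a (\<lambda>x. ap c (sep b (R x)))"] conjI func_on_lam) auto
qed

section \<open>Cardinals\<close>

text \<open>The well-ordering theorem. The enumeration must stop, because an injective one of all ordinals
  would make them a set.\<close>

lemma eqpoll_Ord: "\<exists>\<alpha>. Ord \<alpha> \<and> eqpoll x \<alpha>"
proof -
  obtain c where c: "\<And>y. subset y x \<Longrightarrow> y \<noteq> empty \<Longrightarrow> ap c y \<epsilon> y"
    using choice_function[of x] by blast
  \<comment> \<open>Enumerate \<open>x\<close> by choosing new elements as long as possible; the value
    \<open>x\<close>, which is not an element of \<open>x\<close>, signals that nothing is left.\<close>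
  let ?G = "\<lambda>s. if diff x s = empty then x else ap c (diff x s)"
  obtain F where F: "dt (\<lambda>e. F (e 0))" "\<And>\<alpha>. F \<alpha> = ?G (repl \<alpha> F)"
    using mem_recursion[of ?G] by auto
  note [simp] = dt_subst1[OF F(1)]
  have new: "F \<alpha> \<epsilon> diff x (repl \<alpha> F)" if "F \<alpha> \<noteq> x" for \<alpha>
  proof -
    have "diff x (repl \<alpha> F) \<noteq> empty" using that by (subst (asm) F(2)) (auto split: if_splits)
    moreover from this have "F \<alpha> = ap c (diff x (repl \<alpha> F))" by (subst F(2)) simp
    ultimately show ?thesis using c[of "diff x (repl \<alpha> F)"] by (auto simp: subset_def)
  qed
  have differ: "F \<alpha> \<noteq> F \<beta>" if "\<beta> \<epsilon> \<alpha>" "F \<alpha> \<noteq> x" for \<alpha> \<beta>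
    using new[OF that(2)] that(1) by auto
  have inj: "\<alpha> = \<beta>" if "Ord \<alpha>" "Ord \<beta>" "F \<alpha> = F \<beta>" "F \<alpha> \<noteq> x" for \<alpha> \<beta>
    using Ord_linear[OF that(1,2)] differ[of \<alpha> \<beta>] differ[of \<beta> \<alpha>] that(3,4) by metis
  have "\<exists>\<alpha>. Ord \<alpha> \<and> F \<alpha> = x"
  proof (rule ccontr)
    assume no: "\<nexists>\<alpha>. Ord \<alpha> \<and> F \<alpha> = x"
    let ?R = "\<lambda>y \<alpha>. Ord \<alpha> \<and> F \<alpha> = y"
    let ?B = "sep x (\<lambda>y. \<exists>\<alpha>. ?R y \<alpha>)"
    have "\<exists>z. \<forall>\<alpha>. \<alpha> \<epsilon> z \<longleftrightarrow> (\<exists>y. y \<epsilon> ?B \<and> ?R y \<alpha>)"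
    proof (rule ex_repl)
      show "\<exists>!\<alpha>. ?R y \<alpha>" if "y \<epsilon> ?B" for y
        using that inj no by auto
    qed simp
    then obtain z where z: "\<And>\<alpha>. \<alpha> \<epsilon> z \<longleftrightarrow> (\<exists>y. y \<epsilon> ?B \<and> ?R y \<alpha>)" by blast
    have "\<alpha> \<epsilon> z" if "Ord \<alpha>" for \<alpha>
      unfolding z using new[of \<alpha>] no that by auto
    then show False using no_set_of_all_Ord[of z] by blast
  qed
  then obtain \<alpha>' where "Ord \<alpha>'" "F \<alpha>' = x" by blast
  then have "\<exists>\<alpha>. Ord \<alpha> \<and> F \<alpha> = x \<and> (\<forall>\<gamma>. \<gamma> \<epsilon> \<alpha> \<longrightarrow> \<not> F \<gamma> = x)"
    by (intro least_Ord) simp_all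
  then obtain \<alpha> where \<alpha>: "Ord \<alpha>" "F \<alpha> = x" "\<And>\<gamma>. \<gamma> \<epsilon> \<alpha> \<Longrightarrow> F \<gamma> \<noteq> x" by blast
  have "diff x (repl \<alpha> F) = empty"
  proof (rule ccontr)
    assume *: "diff x (repl \<alpha> F) \<noteq> empty"
    then have "ap c (diff x (repl \<alpha> F)) \<epsilon> diff x (repl \<alpha> F)"
      by (intro c) (auto simp: subset_def)
    moreover have "F \<alpha> = ap c (diff x (repl \<alpha> F))" using * by (subst F(2)) simp
    ultimately show False using \<alpha>(2) by simp
  qed
  then have onto: "\<exists>\<gamma>. \<gamma> \<epsilon> \<alpha> \<and> F \<gamma> = y" if "y \<epsilon> x" for y
    using that unfolding empty_iff by (simp, metis)
  have "eqpoll \<alpha> x"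
  proof (rule eqpollI[of F])
    show "F \<gamma> \<epsilon> x" if "\<gamma> \<epsilon> \<alpha>" for \<gamma>
      using new[OF \<alpha>(3)[OF that]] by simp
    show "\<gamma> = \<gamma>'" if "\<gamma> \<epsilon> \<alpha>" "\<gamma>' \<epsilon> \<alpha>" "F \<gamma> = F \<gamma>'" for \<gamma> \<gamma>'
      using that inj \<alpha> Ord_mem by blast
  qed (simp_all add: onto)
  then show ?thesis using \<alpha>(1) eqpoll_sym by blast
qed

lemma df_is_initial [df_intros, simp]: "dt a \<Longrightarrow> df (\<lambda>e. is_initial (a e))"
  by (rule df_subst1) (auto simp: is_initial_def intro!: df_intros)

lemma is_initial_Ord: "is_initial \<alpha> \<Longrightarrow> Ord \<alpha>"
  by (simp add: is_initial_def)

lemma is_initial_unique: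
  assumes "is_initial \<alpha>" "is_initial \<beta>" "eqpoll \<alpha> \<beta>"
  shows "\<alpha> = \<beta>"
  using assms Ord_linear[of \<alpha> \<beta>] eqpoll_sym[OF assms(3)] unfolding is_initial_def by auto

lemma ex_initial: "\<exists>\<alpha>. is_initial \<alpha> \<and> eqpoll x \<alpha>"
proof -
  obtain \<alpha>' where "Ord \<alpha>'" "eqpoll x \<alpha>'" using eqpoll_Ord by blast
  then have "\<exists>\<alpha>. Ord \<alpha> \<and> eqpoll x \<alpha> \<and> (\<forall>\<gamma>. \<gamma> \<epsilon> \<alpha> \<longrightarrow> \<not> eqpoll x \<gamma>)"
    by (intro least_Ord) simp_all
  then show ?thesis using eqpoll_trans unfolding is_initial_def by blast
qed

lemma ex1_initial: "\<exists>!\<alpha>. is_initial \<alpha> \<and> eqpoll x \<alpha>"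
  using ex_initial[of x] is_initial_unique eqpoll_trans eqpoll_sym by metis

lemma card_initial [simp]: "is_initial (card x)"
  and eqpoll_card: "eqpoll x (card x)"
proof -
  have "\<exists>!\<alpha>. \<alpha> \<in> UNIV \<and> is_initial \<alpha> \<and> eqpoll x \<alpha>" using ex1_initial by simp
  from theI'[OF this] show "is_initial (card x)" "eqpoll x (card x)"
    unfolding card_def by blast+
qed

lemma card_eqI: "is_initial \<alpha> \<Longrightarrow> eqpoll x \<alpha> \<Longrightarrow> card x = \<alpha>"
  using ex1_initial[of x] card_initial eqpoll_card by blast

lemma dt_card [df_intros, simp]: "dt a \<Longrightarrow> dt (\<lambda>e. card (a e))"
proof (rule dt_subst1[where Q = card])
  have "y = card x \<longleftrightarrow> is_initial y \<and> eqpoll x y" for x y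
    using card_eqI card_initial eqpoll_card by auto
  then show "dt (\<lambda>e. card (e 0))" by (intro dt_graph[of "\<lambda>y e. is_initial y \<and> eqpoll (e 0) y"]) simp_all
qed

lemma Ord_card [simp]: "Ord (card x)"
  by (rule is_initial_Ord) simp

lemma le_mem_trans: "Ord \<gamma> \<Longrightarrow> le \<alpha> \<beta> \<Longrightarrow> \<beta> \<epsilon> \<gamma> \<Longrightarrow> \<alpha> \<epsilon> \<gamma>"
  unfolding le_def using Ord_trans by blast

lemma card_Ord_le: "Ord \<alpha> \<Longrightarrow> le (card \<alpha>) \<alpha>"
proof -
  assume \<alpha>: "Ord \<alpha>"
  have "\<not> \<alpha> \<epsilon> card \<alpha>"
    using card_initial[of \<alpha>] eqpoll_sym[OF eqpoll_card[of \<alpha>]] unfolding is_initial_def by blast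
  then show ?thesis using Ord_linear[OF \<alpha> Ord_card, of \<alpha>] unfolding le_def by auto
qed

text \<open>This is the argument of Cantor and Bernstein, for a set \<open>b\<close> included in \<open>a\<close>: move the
  points of the closure of \<open>a - b\<close> under the injection, and fix the others.\<close>

lemma eqpoll_of_inj_subset:
  assumes t: "dt (\<lambda>e. t (e 0))" and ba: "subset b a"
    and tb: "\<And>x. x \<epsilon> a \<Longrightarrow> t x \<epsilon> b"
    and inj: "\<And>x x'. x \<epsilon> a \<Longrightarrow> x' \<epsilon> a \<Longrightarrow> t x = t x' \<Longrightarrow> x = x'"
  shows "eqpoll a b"
proof -
  note [simp] = dt_subst1[OF t]
  define closed where "closed z \<longleftrightarrow> (\<forall>x. x \<epsilon> a \<and> \<not> x \<epsilon> b \<longrightarrow> x \<epsilon> z) \<and>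
    (\<forall>x. x \<epsilon> z \<longrightarrow> t x \<epsilon> z)" for z
  have [simp]: "df (\<lambda>e. closed (z e))" if "dt z" for z
    by (rule df_subst1[OF _ that]) (simp add: closed_def)
  define c where "c = sep a (\<lambda>x. \<forall>z. closed z \<and> subset z a \<longrightarrow> x \<epsilon> z)"
  have c: "x \<epsilon> c \<longleftrightarrow> x \<epsilon> a \<and> (\<forall>z. closed z \<and> subset z a \<longrightarrow> x \<epsilon> z)" for x
    by (simp add: c_def)
  have ba': "x \<epsilon> a" if "x \<epsilon> b" for x using ba that by (rule subsetD)
  have c1: "x \<epsilon> c" if "x \<epsilon> a" "\<not> x \<epsilon> b" for x
    using that unfolding c closed_def by blast
  have c2: "t x \<epsilon> c" if "x \<epsilon> c" for x
    using that ba' tb unfolding c closed_def by blast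
  have c3: "\<exists>x. x \<epsilon> c \<and> t x = y" if y: "y \<epsilon> c" "y \<epsilon> b" for y
  proof (rule ccontr)
    assume no: "\<nexists>x. x \<epsilon> c \<and> t x = y"
    let ?z = "sep c (\<lambda>x. x \<noteq> y)"
    have "closed ?z" unfolding closed_def using c1 c2 y(2) no by auto
    moreover have "subset ?z a" by (auto simp: subset_def c)
    ultimately have "y \<epsilon> ?z" using y(1) unfolding c by blast
    then show False by simp
  qed
  show ?thesis
  proof (rule eqpollI[of "\<lambda>x. if x \<epsilon> c then t x else x"])
    fix x x' assume "x \<epsilon> a" "x' \<epsilon> a" "(if x \<epsilon> c then t x else x) = (if x' \<epsilon> c then t x' else x')"
    then show "x = x'" using inj c2 by (auto split: if_splits)
  next
    fix y assume y: "y \<epsilon> b"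
    show "\<exists>x. x \<epsilon> a \<and> (if x \<epsilon> c then t x else x) = y"
    proof (cases "y \<epsilon> c")
      case True
      then obtain x where "x \<epsilon> c" "t x = y" using c3 y by blast
      moreover from this have "x \<epsilon> a" by (simp add: c)
      ultimately show ?thesis by auto
    next
      case False
      then show ?thesis using ba' y by auto
    qed
  qed (use tb c1 in auto)
qed

text \<open>Otherwise an injection would map \<open>card a\<close> into its element \<open>card b\<close>, which is a subset of it.\<close>

lemma card_le_of_inj:
  assumes t: "dt (\<lambda>e. t (e 0))"
    and tb: "\<And>x. x \<epsilon> a \<Longrightarrow> t x \<epsilon> b"
    and inj: "\<And>x x'. x \<epsilon> a \<Longrightarrow> x' \<epsilon> a \<Longrightarrow> t x = t x' \<Longrightarrow> x = x'"
  shows "le (card a) (card b)"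
proof (rule ccontr)
  note [simp] = dt_subst1[OF t]
  assume "\<not> le (card a) (card b)"
  then have ba: "card b \<epsilon> card a" using Ord_linear[of "card a" "card b"] unfolding le_def by auto
  obtain f where f: "func f (card a) a"
      "\<forall>x x'. x \<epsilon> card a \<and> x' \<epsilon> card a \<and> ap f x = ap f x' \<longrightarrow> x = x'"
    using eqpoll_sym[OF eqpoll_card[of a]] by (auto elim: eqpollE)
  obtain g where g: "func g b (card b)"
      "\<forall>x x'. x \<epsilon> b \<and> x' \<epsilon> b \<and> ap g x = ap g x' \<longrightarrow> x = x'"
    using eqpoll_card[of b] by (auto elim: eqpollE)
  have "eqpoll (card a) (card b)"
  proof (rule eqpoll_of_inj_subset[of "\<lambda>x. ap g (t (ap f x))"])
    show "subset (card b) (card a)" using ba Ord_trans[OF Ord_card] by (auto simp: subset_def)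
    show "ap g (t (ap f x)) \<epsilon> card b" if "x \<epsilon> card a" for x
      using func_ap[OF g(1)] tb func_ap[OF f(1) that] by blast
    show "x = x'" if "x \<epsilon> card a" "x' \<epsilon> card a" "ap g (t (ap f x)) = ap g (t (ap f x'))" for x x'
      using that f(2) g(2) inj tb func_ap[OF f(1)] by metis
  qed simp
  then show False using card_initial[of a] ba unfolding is_initial_def by blast
qed

lemma card_le_of_subset: "subset a b \<Longrightarrow> le (card a) (card b)"
  by (rule card_le_of_inj[of "\<lambda>x. x"]) (auto simp: subset_def)

lemma card_eqpoll: "eqpoll a b \<Longrightarrow> card a = card b"
  by (rule card_eqI) (use eqpoll_trans eqpoll_card in \<open>auto\<close>)

lemma card_le_of_surj:
  assumes t: "dt (\<lambda>e. t (e 0))" and onto: "\<And>y. y \<epsilon> b \<Longrightarrow> \<exists>x. x \<epsilon> a \<and> t x = y"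
  shows "le (card b) (card a)"
proof -
  note [simp] = dt_subst1[OF t]
  obtain g where g: "\<And>y. y \<epsilon> b \<Longrightarrow> ap g y \<epsilon> a \<and> t (ap g y) = y"
    using class_choice[of "\<lambda>y x. x \<epsilon> a \<and> t x = y" b] onto by auto
  show ?thesis
    by (rule card_le_of_inj[of "ap g"]) (simp, use g in blast, use g in metis)
qed

lemma card_initial_eq: "is_initial \<alpha> \<Longrightarrow> card \<alpha> = \<alpha>"
  by (rule card_eqI) simp_all

text \<open>The reason why families indexed below a cardinal can be replaced by their ranges.\<close>

lemma card_image_less:
  assumes "dt (\<lambda>e. t (e 0))" "is_initial \<kappa>" "\<nu> \<epsilon> \<kappa>"
  shows "card (repl \<nu> t) \<epsilon> \<kappa>"
proof -
  have "le (card (repl \<nu> t)) (card \<nu>)"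
    by (rule card_le_of_surj[of t]) (use assms(1) in auto)
  moreover have \<kappa>: "Ord \<kappa>" using assms(2) by (rule is_initial_Ord)
  moreover have "le (card \<nu>) \<nu>" using card_Ord_le Ord_mem[OF \<kappa> assms(3)] by blast
  ultimately show ?thesis
    using le_mem_trans[OF \<kappa>] assms(3) by blast
qed

lemma uncountable_cardinal_facts:
  assumes "uncountable_cardinal \<kappa>"
  shows "is_initial \<kappa>" "Ord \<kappa>" "num i \<epsilon> \<kappa>" "omega \<epsilon> \<kappa>" "empty \<epsilon> \<kappa>"
proof -
  show \<kappa>: "is_initial \<kappa>" "omega \<epsilon> \<kappa>" using assms by (auto simp: uncountable_cardinal_def)
  then show "Ord \<kappa>" by (simp add: is_initial_Ord)
  then show "num i \<epsilon> \<kappa>" "empty \<epsilon> \<kappa>" using \<kappa>(2) Ord_trans num_in_omega empty_in_omega by blast+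
qed

text \<open>An infinite \<open>\<nu>\<close> is equipollent to its successor, by shifting the numbers to make room.\<close>

lemma succ_less_cardinal:
  assumes \<delta>: "uncountable_cardinal \<delta>" and \<nu>: "\<nu> \<epsilon> \<delta>"
  shows "adjoin \<nu> \<nu> \<epsilon> \<delta>"
proof (rule ccontr)
  note \<delta>_facts = uncountable_cardinal_facts[OF \<delta>]
  have Ord: "Ord \<nu>" by (rule Ord_mem[OF \<delta>_facts(2) \<nu>])
  assume not_less: "\<not> adjoin \<nu> \<nu> \<epsilon> \<delta>"
  then have "\<not> \<nu> \<epsilon> omega" using Ord_trans[OF \<delta>_facts(2,4)] succ_in_omega by blast
  then have omega_\<nu>: "n \<epsilon> \<nu>" if "n \<epsilon> omega" for n
    using Ord_linear[OF Ord Ord_omega] Ord_trans[OF Ord] that by metis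
  have "subset (adjoin \<nu> \<nu>) \<delta>" using \<nu> Ord_trans[OF \<delta>_facts(2)] by (auto simp: subset_def)
  then have "adjoin \<nu> \<nu> = \<delta>"
    using not_less Ord_subset[OF Ord_succ[OF Ord] \<delta>_facts(2)] by (simp add: le_def)
  moreover have "eqpoll (adjoin \<nu> \<nu>) \<nu>"
  proof (rule eqpoll_of_inj_subset)
    let ?t = "\<lambda>x. if x = \<nu> then empty else if x \<epsilon> omega then adjoin x x else x"
    show "dt (\<lambda>e. ?t (e 0))" by simp
    show "subset \<nu> (adjoin \<nu> \<nu>)" by (simp add: subset_def)
    show "?t x \<epsilon> \<nu>" if "x \<epsilon> adjoin \<nu> \<nu>" for x
      using that omega_\<nu> by auto
    have "adjoin x x \<noteq> empty" for x using mem_empty[of x] mem_adjoin[of x x x] by metis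
    then show "x = x'" if "x \<epsilon> adjoin \<nu> \<nu>" "x' \<epsilon> adjoin \<nu> \<nu>" "?t x = ?t x'" for x x'
      using that succ_inject succ_in_omega empty_in_omega by (metis (full_types))
  qed
  ultimately show False using \<delta>_facts(1) \<nu> unfolding is_initial_def by simp
qed

section \<open>From filter extensions to strong compactness\<close>

lemma mem_Pk [simp]: "x \<epsilon> Pk \<kappa> a \<longleftrightarrow> subset x a \<and> card x \<epsilon> \<kappa>"
  unfolding Pk_def by (rule mem_setof, rule exI[of _ "sep (Power a) (\<lambda>x. card x \<epsilon> \<kappa>)"]) simp

lemma card_upair_less:
  assumes "uncountable_cardinal \<kappa>"
  shows "card (upair a b) \<epsilon> \<kappa>"
proof -
  have "upair a b = repl (num 2) (\<lambda>i. if i = num 0 then a else b)"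
  proof (rule set_ext)
    have two: "i \<epsilon> num 2 \<longleftrightarrow> i = num 0 \<or> i = num 1" for i by (auto simp: numeral_2_eq_2)
    show "x \<epsilon> upair a b \<longleftrightarrow> x \<epsilon> repl (num 2) (\<lambda>i. if i = num 0 then a else b)" for x
      by (auto simp: two simp del: num.simps) (metis num_eq zero_neq_one One_nat_def)
  qed
  then show ?thesis
    using card_image_less[of "\<lambda>i. if i = num 0 then a else b" \<kappa> "num 2"] uncountable_cardinal_facts[OF assms]
    by simp
qed

text \<open>Subsets of \<open>a\<close> are coded by characteristic functions on \<open>\<theta>\<close>.\<close>

lemma card_Power_le:
  assumes "le (card a) \<theta>" "Ord \<theta>"
  shows "le (card (Power a)) (cexp (num 2) \<theta>)"
proof -
  obtain g where g: "func g a (card a)"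
      "\<forall>x x'. x \<epsilon> a \<and> x' \<epsilon> a \<and> ap g x = ap g x' \<longrightarrow> x = x'"
    using eqpoll_card[of a] by (auto elim: eqpollE)
  have g\<theta>: "ap g x \<epsilon> \<theta>" if "x \<epsilon> a" for x
    using func_ap[OF g(1) that] assms Ord_trans unfolding le_def by blast
  let ?\<chi> = "\<lambda>y. lam \<theta> (\<lambda>i. if \<exists>x. x \<epsilon> y \<and> ap g x = i then num 1 else num 0)"
  have \<chi>: "ap (?\<chi> y) (ap g x) = num 1 \<longleftrightarrow> x \<epsilon> y" if "subset y a" "x \<epsilon> a" for x y
  proof -
    have "(\<exists>x'. x' \<epsilon> y \<and> ap g x' = ap g x) \<longleftrightarrow> x \<epsilon> y"
      using g(2) that subsetD[OF that(1)] by metis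
    moreover have "ap (?\<chi> y) (ap g x) = (if \<exists>x'. x' \<epsilon> y \<and> ap g x' = ap g x then num 1 else num 0)"
      by (rule ap_lam) (simp_all add: g\<theta> that(2) del: num.simps)
    ultimately show ?thesis by (simp del: num.simps)
  qed
  have "le (card (Power a)) (card (funs \<theta> (num 2)))"
  proof (rule card_le_of_inj[of ?\<chi>])
    show "?\<chi> y \<epsilon> funs \<theta> (num 2)" for y
      using num_mem[of 0 2] num_mem[of 1 2] unfolding mem_funs
      by (intro func_lam) (simp_all del: num.simps)
    show "y = y'" if y: "y \<epsilon> Power a" "y' \<epsilon> Power a" "?\<chi> y = ?\<chi> y'" for y y'
    proof (rule set_ext)
      have sub: "subset y a" "subset y' a" using y by simp_all
      show "x \<epsilon> y \<longleftrightarrow> x \<epsilon> y'" for x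
      proof (cases "x \<epsilon> a")
        case True
        show ?thesis
          unfolding \<chi>[OF sub(1) True, symmetric] \<chi>[OF sub(2) True, symmetric] y(3) by (rule refl)
      next
        case False
        then show ?thesis using subsetD[OF sub(1)] subsetD[OF sub(2)] by blast
      qed
    qed
  qed simp
  then show ?thesis by (simp add: cexp_def)
qed

lemma card_Pk_le:
  assumes "Ord \<kappa>"
  shows "le (card (Pk \<kappa> l)) (cexp_less l \<kappa>)"
proof -
  let ?seq = "\<lambda>f. \<exists>\<alpha>. \<alpha> \<epsilon> \<kappa> \<and> func f \<alpha> l"
  have "subset f (prod \<kappa> l)" if "?seq f" for f
    using that Ord_trans[OF assms] unfolding func_def subset_def mem_prod by blast
  then have seq: "f \<epsilon> setof ?seq \<longleftrightarrow> ?seq f" for f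
    by (intro mem_setof exI[of _ "sep (Power (prod \<kappa> l)) ?seq"]) auto
  let ?ran = "\<lambda>f. sep l (\<lambda>y. \<exists>x. pair x y \<epsilon> f)"
  have "le (card (Pk \<kappa> l)) (card (setof ?seq))"
  proof (rule card_le_of_surj[of ?ran])
    fix x assume "x \<epsilon> Pk \<kappa> l"
    then have x: "subset x l" "card x \<epsilon> \<kappa>" by simp_all
    obtain h where h: "func h (card x) x" "\<forall>y. y \<epsilon> x \<longrightarrow> (\<exists>i. i \<epsilon> card x \<and> ap h i = y)"
      using eqpoll_sym[OF eqpoll_card[of x]] by (auto elim: eqpollE)
    have "func h (card x) l"
      by (rule func_mono[OF h(1)]) (use func_ap[OF h(1)] x(1) in \<open>auto simp: subset_def\<close>)
    then have "h \<epsilon> setof ?seq" unfolding seq using x(2) by blast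
    moreover have "?ran h = x"
      by (rule set_ext) (use func_pair[OF h(1)] func_ap[OF h(1)] h(2) x(1) in \<open>auto simp: subset_def\<close>)
    ultimately show "\<exists>f. f \<epsilon> setof ?seq \<and> ?ran f = x" by blast
  qed simp
  then show ?thesis by (simp add: cexp_less_def)
qed

lemma mem_Cup_upair: "z \<epsilon> Cup (upair a b) \<longleftrightarrow> z \<epsilon> a \<or> z \<epsilon> b"
  by auto

lemma filter_base_Power: "filter_base x (Power x)"
  by (auto simp: filter_base_def subset_def)

text \<open>The supersets of single cones \<open>{x | a \<in> x}\<close> already form a filter: completeness asks for a common
  element of fewer than \<open>\<kappa>\<close> sets, and the cones below them provide one.\<close>

lemma strongly_compact_of_filter_extension:
  assumes \<kappa>: "uncountable_cardinal \<kappa>" and l: "uncountable_cardinal l"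
    and ext: "filter_extension_property \<delta> \<kappa> (cexp (num 2) (cexp_less l \<kappa>))"
  shows "strongly_compact \<delta> \<kappa> l"
proof -
  note \<kappa>' = uncountable_cardinal_facts[OF \<kappa>] and l' = uncountable_cardinal_facts[OF l]
  define X where "X = Pk \<kappa> l"
  define cone where "cone a = sep X (\<lambda>x. a \<epsilon> x)" for a
  have [simp]: "dt (\<lambda>e. cone (a e))" if "dt a" for a
    by (rule dt_subst1[OF _ that]) (simp add: cone_def)
  have cone: "x \<epsilon> cone a \<longleftrightarrow> x \<epsilon> X \<and> a \<epsilon> x" for x a by (simp add: cone_def)
  define F where "F = sep (Power X) (\<lambda>Y. \<exists>a. a \<epsilon> l \<and> subset (cone a) Y)"
  have F: "Y \<epsilon> F \<longleftrightarrow> subset Y X \<and> (\<exists>a. a \<epsilon> l \<and> subset (cone a) Y)" for Y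
    by (simp add: F_def)
  have "le (card (Power X)) (cexp (num 2) (cexp_less l \<kappa>))"
    unfolding X_def by (rule card_Power_le[OF card_Pk_le[OF \<kappa>'(2)]]) (simp add: cexp_less_def)
  moreover have "complete_filter \<kappa> X (Power X) F"
    unfolding complete_filter_def
  proof (intro conjI allI impI)
    show "subset F (Power X)" by (simp add: subset_def F)
    show "X \<epsilon> F" unfolding F using l'(5) by (auto simp: subset_def cone)
    show "\<not> empty \<epsilon> F"
    proof
      assume "empty \<epsilon> F"
      then obtain a where a: "a \<epsilon> l" "subset (cone a) empty" unfolding F by blast
      have "upair a a \<epsilon> cone a"
        using a(1) card_upair_less[OF \<kappa>, of a a] by (auto simp: cone X_def subset_def)
      then show False using a(2) by (auto simp: subset_def)
    qed
  next
    fix Y Z assume "Y \<epsilon> Power X \<and> Z \<epsilon> Power X \<and> subset Z Y \<and> Z \<epsilon> F"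
    then show "Y \<epsilon> F" unfolding F by (auto simp: subset_def)
  next
    fix \<mu> Y assume Y: "\<mu> \<epsilon> \<kappa> \<and> func Y \<mu> F"
    then have "\<exists>a. a \<epsilon> l \<and> subset (cone a) (ap Y i)" if "i \<epsilon> \<mu>" for i
      using func_ap[of Y \<mu> F i] that F by blast
    then have "\<exists>g. func_on g \<mu> \<and> (\<forall>i. i \<epsilon> \<mu> \<longrightarrow> ap g i \<epsilon> l \<and> subset (cone (ap g i)) (ap Y i))"
      by (intro class_choice[of "\<lambda>i a. a \<epsilon> l \<and> subset (cone a) (ap Y i)"]) simp_all
    then obtain g where g: "\<And>i. i \<epsilon> \<mu> \<Longrightarrow> ap g i \<epsilon> l \<and> subset (cone (ap g i)) (ap Y i)" by blast
    \<comment> \<open>The set of the chosen points is a common element of their cones.\<close>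
    let ?x = "repl \<mu> (ap g)"
    have "card ?x \<epsilon> \<kappa>" using Y \<kappa>'(1) by (intro card_image_less) auto
    then have x: "?x \<epsilon> X" using g by (auto simp: X_def subset_def)
    moreover have "?x \<epsilon> app Y i" if "i \<epsilon> \<mu>" for i
    proof -
      have "?x \<epsilon> cone (ap g i)" using x that unfolding cone by auto
      then show ?thesis using g[OF that] Y that by (auto simp: subset_def app_eq_ap)
    qed
    ultimately show "\<exists>x. x \<epsilon> X \<and> (\<forall>i. i \<epsilon> \<mu> \<longrightarrow> x \<epsilon> app Y i)" by blast
  qed
  ultimately obtain U where U: "subset F U" "complete_filter \<delta> X (Power X) U" "measures X (Power X) U"
    using ext filter_base_Power unfolding filter_extension_property_def by blast
  have "cone a \<epsilon> U" if "a \<epsilon> l" for a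
  proof (rule subsetD[OF U(1)])
    have "subset (cone a) X" by (simp add: subset_def cone)
    then show "cone a \<epsilon> F" unfolding F using that subset_refl by blast
  qed
  then have "fine \<kappa> l U"
    by (simp add: fine_def cone_def sep_def X_def)
  then show ?thesis using U unfolding strongly_compact_def X_def by blast
qed

section \<open>From compactness to filter extensions\<close>

text \<open>Propositional formulas suffice: a set \<open>Y\<close> of \<open>E\<close> serves as a relation symbol
  without arguments, to be read as ``\<open>Y\<close> belongs to the ultrafilter''.\<close>

definition atom_fm :: "'v \<Rightarrow> 'v" where
  "atom_fm Y = fRel Y empty"

lemma dt_formulas [df_intros, simp]:
  "dt a \<Longrightarrow> dt (\<lambda>e. atom_fm (a e))" "dt a \<Longrightarrow> dt (\<lambda>e. fNeg (a e))"
  "dt a \<Longrightarrow> dt (\<lambda>e. fConj (a e))" "dt a \<Longrightarrow> dt (\<lambda>e. fDisj (a e))"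
  by (simp_all add: atom_fm_def fRel_def fNeg_def fConj_def fDisj_def)

lemma formula_eq [simp]:
  "atom_fm Y = atom_fm Z \<longleftrightarrow> Y = Z" "fRel r ts = atom_fm Y \<longleftrightarrow> r = Y \<and> ts = empty"
  "fNeg p = fNeg q \<longleftrightarrow> p = q" "fConj p = fConj q \<longleftrightarrow> p = q" "fDisj p = fDisj q \<longleftrightarrow> p = q"
  "fRel r ts \<noteq> fNeg q" "fRel r ts \<noteq> fConj q" "fRel r ts \<noteq> fDisj q"
  "atom_fm Y \<noteq> fNeg q" "atom_fm Y \<noteq> fConj q" "atom_fm Y \<noteq> fDisj q"
  "fNeg p \<noteq> atom_fm Y" "fNeg p \<noteq> fConj q" "fNeg p \<noteq> fDisj q"
  "fConj p \<noteq> atom_fm Y" "fConj p \<noteq> fNeg q" "fConj p \<noteq> fDisj q"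
  "fDisj p \<noteq> atom_fm Y" "fDisj p \<noteq> fNeg q" "fDisj p \<noteq> fConj q"
  "fEq t t' \<noteq> atom_fm Y" "fEq t t' \<noteq> fNeg q" "fEq t t' \<noteq> fConj q" "fEq t t' \<noteq> fDisj q"
  "fEx m p \<noteq> atom_fm Y" "fEx m p \<noteq> fNeg q" "fEx m p \<noteq> fConj q" "fEx m p \<noteq> fDisj q"
  "fAll m p \<noteq> atom_fm Y" "fAll m p \<noteq> fNeg q" "fAll m p \<noteq> fConj q" "fAll m p \<noteq> fDisj q"
  by (simp_all add: atom_fm_def fRel_def fNeg_def fConj_def fDisj_def fEq_def fEx_def fAll_def
      del: num.simps)

lemma card_empty [simp]: "card empty = empty"
  by (rule card_initial_eq) (simp add: is_initial_def)

lemmas truth_set_Rel = conjunct1[OF conjunct2[OF iffD1[OF truth_set_def]]]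
lemmas truth_set_Neg = conjunct1[OF conjunct2[OF conjunct2[OF iffD1[OF truth_set_def]]]]
lemmas truth_set_Conj =
  conjunct1[OF conjunct2[OF conjunct2[OF conjunct2[OF iffD1[OF truth_set_def]]]]]
lemmas truth_set_Disj =
  conjunct1[OF conjunct2[OF conjunct2[OF conjunct2[OF conjunct2[OF iffD1[OF truth_set_def]]]]]]

text \<open>The conjunctions of fewer than \<open>\<delta>\<close> atoms without a common point (\<open>unsat\<close>) express both the
  completeness of the extension and, applied to two atoms, its closure under supersets.\<close>

lemma filter_extension_of_compact:
  assumes \<delta>: "uncountable_cardinal \<delta>" and \<kappa>: "uncountable_cardinal \<kappa>"
    and compact: "compact_cardinal \<delta> \<kappa> \<mu>"
  shows "filter_extension_property \<delta> \<kappa> \<mu>"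
  unfolding filter_extension_property_def
proof (intro allI impI)
  fix X E F
  assume "filter_base X E \<and> le (card E) \<mu> \<and> complete_filter \<kappa> X E F"
  then have XE: "X \<epsilon> E" and E: "\<And>Y. Y \<epsilon> E \<Longrightarrow> subset Y X \<and> diff X Y \<epsilon> E"
    and E_le: "le (card E) \<mu>" and FE: "subset F E" and XF: "X \<epsilon> F"
    and F: "\<And>\<nu> Y. \<nu> \<epsilon> \<kappa> \<Longrightarrow> func Y \<nu> F \<Longrightarrow> \<exists>x. x \<epsilon> X \<and> (\<forall>i. i \<epsilon> \<nu> \<longrightarrow> x \<epsilon> app Y i)"
    by (auto simp: filter_base_def complete_filter_def)
  note \<delta>' = uncountable_cardinal_facts[OF \<delta>] and \<kappa>' = uncountable_cardinal_facts[OF \<kappa>]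
  define ar where "ar = lam E (\<lambda>_. empty)"
  have ar: "func ar E omega" unfolding ar_def by (rule func_lam) simp_all
  have app_ar [simp]: "app ar Y = empty" if "Y \<epsilon> E" for Y
    using app_eq_ap[OF ar that] that by (simp add: ar_def)
  define At where "At = repl E atom_fm"
  have At: "p \<epsilon> At \<longleftrightarrow> (\<exists>Y. Y \<epsilon> E \<and> p = atom_fm Y)" for p by (simp add: At_def)
  define C where "C = Cup (upair (Cup (upair At (repl (Power At) fDisj)))
    (Cup (upair (repl (Power At) fConj) (repl (Power At) (\<lambda>\<Phi>. fNeg (fConj \<Phi>))))))"
  have C: "p \<epsilon> C \<longleftrightarrow> (\<exists>Y. Y \<epsilon> E \<and> p = atom_fm Y) \<or> (\<exists>\<Phi>. subset \<Phi> At \<and> p = fDisj \<Phi>) \<or>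
      (\<exists>\<Phi>. subset \<Phi> At \<and> p = fConj \<Phi>) \<or> (\<exists>\<Phi>. subset \<Phi> At \<and> p = fNeg (fConj \<Phi>))" for p
    unfolding C_def mem_Cup_upair At_def by simp
  have subset_upair: "subset (upair (atom_fm Y) (atom_fm Z)) At" if "Y \<epsilon> E" "Z \<epsilon> E" for Y Z
    using that by (auto simp: subset_def At)
  define unsat where "unsat \<Phi> \<longleftrightarrow> subset \<Phi> At \<and> card \<Phi> \<epsilon> \<delta> \<and>
    \<not> (\<exists>x. x \<epsilon> X \<and> (\<forall>Y. atom_fm Y \<epsilon> \<Phi> \<longrightarrow> x \<epsilon> Y))" for \<Phi>
  have [simp]: "df (\<lambda>e. unsat (a e))" if "dt a" for a
    by (rule df_subst1[OF _ that]) (simp add: unsat_def)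
  define T where "T = sep C (\<lambda>p. (\<exists>Y. Y \<epsilon> F \<and> p = atom_fm Y) \<or>
    (\<exists>Y. Y \<epsilon> E \<and> p = fDisj (upair (atom_fm Y) (atom_fm (diff X Y)))) \<or>
    (\<exists>\<Phi>. unsat \<Phi> \<and> p = fNeg (fConj \<Phi>)))"
  have T: "p \<epsilon> T \<longleftrightarrow> (\<exists>Y. Y \<epsilon> F \<and> p = atom_fm Y) \<or>
    (\<exists>Y. Y \<epsilon> E \<and> p = fDisj (upair (atom_fm Y) (atom_fm (diff X Y)))) \<or>
    (\<exists>\<Phi>. unsat \<Phi> \<and> p = fNeg (fConj \<Phi>))" for p
    unfolding T_def using subsetD[OF FE] E subset_upair
    by (simp add: C unsat_def) blast

  have sentence: "is_sentence \<delta> E E ar p" if p: "p \<epsilon> T" for p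
    unfolding is_sentence_def
  proof (intro allI impI)
    fix D assume "formation_closed \<delta> E E ar D"
    moreover have "subset empty omega \<and> card empty \<epsilon> omega" by (simp add: subset_def)
    ultimately have D: "\<And>r ts. r \<epsilon> E \<Longrightarrow> func_on ts (app ar r) \<Longrightarrow>
          (\<forall>i. i \<epsilon> app ar r \<longrightarrow> is_term E E ar empty (app ts i)) \<Longrightarrow> pair (fRel r ts) empty \<epsilon> D"
      "\<And>p. pair p empty \<epsilon> D \<Longrightarrow> pair (fNeg p) empty \<epsilon> D"
      "\<And>\<Phi>. card \<Phi> \<epsilon> \<delta> \<Longrightarrow> (\<forall>p. p \<epsilon> \<Phi> \<longrightarrow> pair p empty \<epsilon> D) \<Longrightarrow>
          pair (fConj \<Phi>) empty \<epsilon> D \<and> pair (fDisj \<Phi>) empty \<epsilon> D"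
      unfolding formation_closed_def by blast+
    have atom: "pair (atom_fm Y) empty \<epsilon> D" if "Y \<epsilon> E" for Y
      unfolding atom_fm_def using that by (intro D(1)) (simp_all add: func_on_def)
    consider Y where "Y \<epsilon> E" "p = atom_fm Y"
      | Y where "Y \<epsilon> E" "p = fDisj (upair (atom_fm Y) (atom_fm (diff X Y)))"
      | \<Phi> where "unsat \<Phi>" "p = fNeg (fConj \<Phi>)"
      using p subsetD[OF FE] unfolding T by blast
    then show "pair p empty \<epsilon> D"
    proof cases
      case (2 Y)
      then show ?thesis
        using D(3)[OF card_upair_less[OF \<delta>], of "atom_fm Y" "atom_fm (diff X Y)"] atom E by auto
    next
      case (3 \<Phi>)
      then have "card \<Phi> \<epsilon> \<delta>" "\<forall>q. q \<epsilon> \<Phi> \<longrightarrow> pair q empty \<epsilon> D"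
        using atom by (auto simp: unsat_def subset_def At)
      from D(3)[OF this] show ?thesis using 3(2) D(2) by blast
    qed (simp add: atom)
  qed

  have small: "has_model E E ar T'" if T': "subset T' T" "card T' \<epsilon> \<kappa>" for T'
  proof -
    \<comment> \<open>Only the atoms asserted by \<open>T'\<close> constrain the point; there are fewer than \<open>\<kappa>\<close>.\<close>
    let ?G = "sep F (\<lambda>Y. atom_fm Y \<epsilon> T')"
    have "le (card ?G) (card T')"
      by (rule card_le_of_inj[of atom_fm]) auto
    then have G\<kappa>: "card ?G \<epsilon> \<kappa>" using le_mem_trans \<kappa>'(2) T'(2) by blast
    obtain h where h: "func h (card ?G) ?G" "\<forall>Y. Y \<epsilon> ?G \<longrightarrow> (\<exists>i. i \<epsilon> card ?G \<and> ap h i = Y)"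
      using eqpoll_sym[OF eqpoll_card[of ?G]] by (auto elim: eqpollE)
    have "func h (card ?G) F"
      by (rule func_mono[OF h(1)]) (use func_ap[OF h(1)] in simp)
    from F[OF G\<kappa> this] obtain x where x: "x \<epsilon> X" "\<And>i. i \<epsilon> card ?G \<Longrightarrow> x \<epsilon> app h i" by blast
    have xG: "x \<epsilon> Y" if "Y \<epsilon> F" "atom_fm Y \<epsilon> T'" for Y
    proof -
      have "Y \<epsilon> ?G" using that by simp
      then obtain i where "i \<epsilon> card ?G" "ap h i = Y" using h(2) by blast
      then show ?thesis using x(2)[of i] app_eq_ap[OF h(1)] by simp
    qed
    \<comment> \<open>The structure has a single point, and \<open>atom_fm Y\<close> holds in it if \<open>x\<close> is an element of \<open>Y\<close>.\<close>
    define I where "I = lam E (\<lambda>Y. if x \<epsilon> Y then num 1 else empty)"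
    have I: "func_on I E" unfolding I_def by (rule func_on_lam) simp
    have app_I: "app I Y = (if x \<epsilon> Y then num 1 else empty)" if "Y \<epsilon> E" for Y
      using app_eq_ap[OF func_onD[OF I] that] that by (simp add: I_def)
    have "is_structure E E ar (num 1) I"
      unfolding is_structure_def using I by (auto simp: app_I subset_def)
    moreover have "satisfies E E ar (num 1) I p s" if p: "p \<epsilon> T'" and s: "func s omega (num 1)" for p s
    proof -
      \<comment> \<open>The truth value at \<open>x\<close> of the four kinds of formulas that occur.\<close>
      define tv where "tv p \<longleftrightarrow> (\<exists>Y. p = atom_fm Y \<and> x \<epsilon> Y) \<or>
        (\<exists>\<Phi>. p = fDisj \<Phi> \<and> (\<exists>Y. atom_fm Y \<epsilon> \<Phi> \<and> x \<epsilon> Y)) \<or>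
        (\<exists>\<Phi>. p = fConj \<Phi> \<and> (\<forall>Y. atom_fm Y \<epsilon> \<Phi> \<longrightarrow> x \<epsilon> Y)) \<or>
        (\<exists>\<Phi>. p = fNeg (fConj \<Phi>) \<and> \<not> (\<forall>Y. atom_fm Y \<epsilon> \<Phi> \<longrightarrow> x \<epsilon> Y))" for p
      have [simp]: "df (\<lambda>e. tv (a e))" if "dt a" for a
        by (rule df_subst1[OF _ that]) (simp add: tv_def)
      have tv: "tv (atom_fm Y) \<longleftrightarrow> x \<epsilon> Y" "tv (fDisj \<Phi>) \<longleftrightarrow> (\<exists>Y. atom_fm Y \<epsilon> \<Phi> \<and> x \<epsilon> Y)"
        "tv (fConj \<Phi>) \<longleftrightarrow> (\<forall>Y. atom_fm Y \<epsilon> \<Phi> \<longrightarrow> x \<epsilon> Y)"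
        "tv (fNeg (fConj \<Phi>)) \<longleftrightarrow> \<not> (\<forall>Y. atom_fm Y \<epsilon> \<Phi> \<longrightarrow> x \<epsilon> Y)" for Y \<Phi>
        by (auto simp: tv_def)
      define S where "S = sep (prod C (funs omega (num 1))) (\<lambda>q. \<exists>p s. q = pair p s \<and> tv p)"
      have S: "pair p s \<epsilon> S \<longleftrightarrow> p \<epsilon> C \<and> func s omega (num 1) \<and> tv p" for p s
        by (simp add: S_def)
      have rel_C: "fRel r ts \<epsilon> C \<longleftrightarrow> r \<epsilon> E \<and> ts = empty" for r ts
        by (auto simp: C)
      have conj_C: "fConj \<Phi> \<epsilon> C \<longleftrightarrow> subset \<Phi> At" and disj_C: "fDisj \<Phi> \<epsilon> C \<longleftrightarrow> subset \<Phi> At"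
        and neg_C: "fNeg p \<epsilon> C \<longleftrightarrow> (\<exists>\<Phi>. subset \<Phi> At \<and> p = fConj \<Phi>)" for \<Phi> p
        by (auto simp: C)
      have no_C: "\<not> fEq t t' \<epsilon> C" "\<not> fEx m q \<epsilon> C" "\<not> fAll m q \<epsilon> C" for t t' m q
        by (auto simp: C)
      have At_C: "q \<epsilon> C" if "subset \<Phi> At" "q \<epsilon> \<Phi>" for \<Phi> q
        using subsetD[OF that] by (auto simp: At C)
      have At_ex: "\<exists>Y. q = atom_fm Y" if "subset \<Phi> At" "q \<epsilon> \<Phi>" for \<Phi> q
        using subsetD[OF that] by (auto simp: At)
      have "truth_set E E ar (num 1) I C S"
        unfolding truth_set_def
      proof (intro conjI allI impI)
        fix r ts s assume r: "fRel r ts \<epsilon> C" and s: "func s omega (num 1)"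
        then have r': "r \<epsilon> E" "ts = empty" by (auto simp: rel_C)
        show "pair (fRel r ts) s \<epsilon> S \<longleftrightarrow> (\<exists>as. func as (app ar r) (num 1) \<and> as \<epsilon> app I r \<and>
            (\<forall>i. i \<epsilon> app ar r \<longrightarrow> term_value E E ar (num 1) I s (app ts i) (app as i)))"
          using r s r' tv(1)[of r] unfolding S by (simp add: app_I atom_fm_def)
      next
        fix \<Phi> s assume "fDisj \<Phi> \<epsilon> C" and s: "func s omega (num 1)"
        then show "pair (fDisj \<Phi>) s \<epsilon> S \<longleftrightarrow> (\<exists>p. p \<epsilon> \<Phi> \<and> pair p s \<epsilon> S)"
          unfolding S disj_C tv using At_C At_ex tv(1) by metis
      next
        fix \<Phi> s assume "fConj \<Phi> \<epsilon> C" and s: "func s omega (num 1)"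
        then show "pair (fConj \<Phi>) s \<epsilon> S \<longleftrightarrow> (\<forall>p. p \<epsilon> \<Phi> \<longrightarrow> pair p s \<epsilon> S)"
          unfolding S conj_C tv using At_C At_ex tv(1) by metis
      next
        fix p s assume "fNeg p \<epsilon> C" and s: "func s omega (num 1)"
        then show "pair (fNeg p) s \<epsilon> S \<longleftrightarrow> \<not> pair p s \<epsilon> S"
          unfolding S neg_C by (auto simp: tv conj_C)
      qed (use no_C At_C in \<open>auto simp: neg_C conj_C disj_C intro: subsetI\<close>)
      moreover have "p \<epsilon> T" using T'(1) p by (rule subsetD)
      then have "p \<epsilon> C" by (simp add: T_def)
      moreover have "tv p"
      proof -
        consider Y where "Y \<epsilon> F" "p = atom_fm Y"
          | Y where "Y \<epsilon> E" "p = fDisj (upair (atom_fm Y) (atom_fm (diff X Y)))"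
          | \<Phi> where "unsat \<Phi>" "p = fNeg (fConj \<Phi>)"
          using \<open>p \<epsilon> T\<close> unfolding T by blast
        then show ?thesis
        proof cases
          case (1 Y)
          then show ?thesis using xG p by (simp add: tv)
        next
          case (2 Y)
          then show ?thesis using x(1) unfolding 2(2) tv by (cases "x \<epsilon> Y") auto
        next
          case (3 \<Phi>)
          then show ?thesis using x(1) unfolding 3(2) tv unsat_def by blast
        qed
      qed
      ultimately show ?thesis unfolding satisfies_def using S s by blast
    qed
    ultimately show ?thesis unfolding has_model_def by blast
  qed

  have "language E E ar" using ar by (simp add: language_def)
  then have "has_model E E ar T"
    using compact E_le sentence small unfolding compact_cardinal_def by blast
  then obtain A I where AI: "is_structure E E ar A I"
    and sat_T: "\<And>p s. p \<epsilon> T \<Longrightarrow> func s omega A \<Longrightarrow> satisfies E E ar A I p s"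
    unfolding has_model_def by blast
  obtain a where "a \<epsilon> A" using AI unfolding is_structure_def by blast
  then have s: "func (lam omega (\<lambda>_. a)) omega A" by (intro func_lam) simp_all
  define s where "s = lam omega (\<lambda>_. a)"
  have s: "func s omega A" using s by (simp add: s_def)
  have app_I: "app I Y = ap I Y" if "Y \<epsilon> E" for Y
    using AI that app_eq_ap unfolding is_structure_def func_on_def by blast
  define U where "U = sep E (\<lambda>Y. empty \<epsilon> ap I Y)"
  have U: "Y \<epsilon> U \<longleftrightarrow> Y \<epsilon> E \<and> empty \<epsilon> ap I Y" for Y by (simp add: U_def)
  have atom: "pair (atom_fm Y) s \<epsilon> S \<longleftrightarrow> Y \<epsilon> U"
    if "truth_set E E ar A I D S" "atom_fm Y \<epsilon> D" "Y \<epsilon> E" for D S Y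
  proof -
    have "pair (atom_fm Y) s \<epsilon> S \<longleftrightarrow> (\<exists>as. func as (app ar Y) A \<and> as \<epsilon> app I Y \<and>
        (\<forall>i. i \<epsilon> app ar Y \<longrightarrow> term_value E E ar A I s (app empty i) (app as i)))"
      using truth_set_Rel[OF that(1)] that(2) s unfolding atom_fm_def by blast
    then show ?thesis using that(3) by (simp add: app_I U)
  qed
  have FU: "subset F U"
  proof (rule subsetI)
    fix Y assume Y: "Y \<epsilon> F"
    then have "atom_fm Y \<epsilon> T" unfolding T by blast
    from sat_T[OF this s] show "Y \<epsilon> U"
      unfolding satisfies_def using atom subsetD[OF FE Y] by blast
  qed
  have measure: "Y \<epsilon> U \<or> diff X Y \<epsilon> U" if Y: "Y \<epsilon> E" for Y
  proof -
    let ?\<Phi> = "upair (atom_fm Y) (atom_fm (diff X Y))"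
    have "fDisj ?\<Phi> \<epsilon> T" unfolding T using Y by blast
    from sat_T[OF this s] obtain D S where D: "fDisj ?\<Phi> \<epsilon> D" "truth_set E E ar A I D S"
        "pair (fDisj ?\<Phi>) s \<epsilon> S"
      unfolding satisfies_def by blast
    then have "subset ?\<Phi> D" "\<exists>p. p \<epsilon> ?\<Phi> \<and> pair p s \<epsilon> S"
      using s truth_set_Disj[OF D(2)] by blast+
    then show ?thesis using atom[OF D(2)] Y E by (auto simp: subset_def)
  qed
  have inter: "\<exists>x. x \<epsilon> X \<and> (\<forall>Y. Y \<epsilon> H \<longrightarrow> x \<epsilon> Y)" if H: "subset H U" "card H \<epsilon> \<delta>" for H
  proof (rule ccontr)
    assume no: "\<nexists>x. x \<epsilon> X \<and> (\<forall>Y. Y \<epsilon> H \<longrightarrow> x \<epsilon> Y)"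
    let ?\<Phi> = "repl H atom_fm"
    have HE: "Y \<epsilon> E" if "Y \<epsilon> H" for Y using subsetD[OF H(1) that] by (simp add: U)
    have "le (card ?\<Phi>) (card H)" by (rule card_le_of_surj[of atom_fm]) auto
    then have "card ?\<Phi> \<epsilon> \<delta>" using le_mem_trans \<delta>'(2) H(2) by blast
    then have "unsat ?\<Phi>" using no HE by (auto simp: unsat_def subset_def At)
    then have "fNeg (fConj ?\<Phi>) \<epsilon> T" unfolding T by blast
    from sat_T[OF this s] obtain D S where D: "fNeg (fConj ?\<Phi>) \<epsilon> D" "truth_set E E ar A I D S"
        "pair (fNeg (fConj ?\<Phi>)) s \<epsilon> S"
      unfolding satisfies_def by blast
    then have "fConj ?\<Phi> \<epsilon> D" "\<not> pair (fConj ?\<Phi>) s \<epsilon> S"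
      using s truth_set_Neg[OF D(2)] by blast+
    then have sub: "subset ?\<Phi> D" and "\<not> (\<forall>p. p \<epsilon> ?\<Phi> \<longrightarrow> pair p s \<epsilon> S)"
      using s truth_set_Conj[OF D(2)] by blast+
    then obtain Y where Y: "Y \<epsilon> H" "\<not> pair (atom_fm Y) s \<epsilon> S" by auto
    moreover have "atom_fm Y \<epsilon> D" using sub Y(1) by (auto simp: subset_def)
    ultimately show False using atom[OF D(2)] HE subsetD[OF H(1)] by blast
  qed
  have "complete_filter \<delta> X E U"
    unfolding complete_filter_def
  proof (intro conjI allI impI)
    show "subset U E" by (simp add: subset_def U)
    show "X \<epsilon> U" using subsetD[OF FU XF] .
    show "\<not> empty \<epsilon> U"
      using inter[of "upair empty empty"] card_upair_less[OF \<delta>] by (auto simp: subset_def)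
  next
    fix Y Z assume YZ: "Y \<epsilon> E \<and> Z \<epsilon> E \<and> subset Z Y \<and> Z \<epsilon> U"
    show "Y \<epsilon> U"
    proof (rule ccontr)
      assume "\<not> Y \<epsilon> U"
      then have "subset (upair Z (diff X Y)) U" using measure YZ by (auto simp: subset_def)
      from inter[OF this card_upair_less[OF \<delta>]] show False
        using YZ by (auto simp: subset_def)
    qed
  next
    fix \<nu> Y assume Y: "\<nu> \<epsilon> \<delta> \<and> func Y \<nu> U"
    let ?H = "repl \<nu> (ap Y)"
    have "subset ?H U" using Y func_ap by (auto simp: subset_def)
    moreover have "card ?H \<epsilon> \<delta>" using Y \<delta>'(1) by (intro card_image_less) auto
    ultimately obtain x where x: "x \<epsilon> X" "\<And>Z. Z \<epsilon> ?H \<Longrightarrow> x \<epsilon> Z" using inter by blast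
    have "x \<epsilon> app Y i" if "i \<epsilon> \<nu>" for i
      using x(2)[of "ap Y i"] that Y app_eq_ap[of Y \<nu> U i] by auto
    then show "\<exists>x. x \<epsilon> X \<and> (\<forall>i. i \<epsilon> \<nu> \<longrightarrow> x \<epsilon> app Y i)"
      using x(1) by blast
  qed
  then show "\<exists>U. subset F U \<and> complete_filter \<delta> X E U \<and> measures X E U"
    using FU measure unfolding measures_def by blast
qed

end

section \<open>Elementary embeddings\<close>

locale embedding = ZFC mem
  for mem :: "'v \<Rightarrow> 'v \<Rightarrow> bool"  (infix "\<epsilon>" 50) +
  fixes j :: "'v \<Rightarrow> 'v" and W :: "'v set"
  assumes definable_j: "definable_map j" and transitive_W: "transitive_class W"
    and elementary: "elementary_embedding j W"
begin

lemma j_in_W [simp]: "j x \<in> W"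
  using elementary by (auto simp: elementary_embedding_def)

lemma range_j: "range j \<subseteq> W"
  by auto

lemma W_trans: "x \<in> W \<Longrightarrow> y \<epsilon> x \<Longrightarrow> y \<in> W"
  using transitive_W by (auto simp: transitive_class_def)

lemma dt_j [df_intros, simp]: "dt a \<Longrightarrow> dt (\<lambda>e. j (a e))"
proof (rule dt_subst1[of j])
  obtain p s where p: "\<And>x y. j x = y \<longleftrightarrow> sat UNIV mem (s(0 := x, 1 := y)) p"
    using definable_j unfolding definable_map_def by blast
  have "df (\<lambda>e. sat UNIV mem (s(0 := e (Suc 0), 1 := e 0)) p)"
    by (rule df_subst2[OF df_of_class2]) simp_all
  then show "dt (\<lambda>e. j (e 0))"
    unfolding dt_def p[symmetric] by (simp add: eq_commute)
qed

text \<open>The predicate \<open>Q\<close> is the interpretation of \<open>P\<close> in \<open>W\<close>, with the parameters moved by \<open>j\<close>.\<close>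

abbreviation trf :: "((nat \<Rightarrow> 'v) \<Rightarrow> bool) \<Rightarrow> ((nat \<Rightarrow> 'v) \<Rightarrow> bool) \<Rightarrow> bool" where
  "trf \<equiv> corr mem W j"

abbreviation trt :: "((nat \<Rightarrow> 'v) \<Rightarrow> 'v) \<Rightarrow> ((nat \<Rightarrow> 'v) \<Rightarrow> 'v) \<Rightarrow> bool" where
  "trt \<equiv> cterm mem W j"

lemma transfer: "trf (\<lambda>e. P) (\<lambda>e. Q) \<Longrightarrow> P \<longleftrightarrow> Q"
  by (rule corr_closed) (use elementary in \<open>auto simp: elementary_embedding_def\<close>)

named_theorems trf_intros

lemma trt_const [trf_intros]: "trt (\<lambda>e. c) (\<lambda>e. j c)"
  by (rule cterm_const) simp

lemma trt_var [trf_intros]: "trt (\<lambda>e. e i) (\<lambda>e. e i)"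
  by (rule cterm_var)

lemma trf_subst2:
  assumes "trf (\<lambda>e. P (e 0) (e (Suc 0))) (\<lambda>e. Q (e 0) (e (Suc 0)))" "trt a a'" "trt b b'"
  shows "trf (\<lambda>e. P (a e) (b e)) (\<lambda>e. Q (a' e) (b' e))"
  using corr_subst[OF assms(1) range_j, of "\<lambda>i. if i = 0 then a else b" "\<lambda>i. if i = 0 then a' else b'"]
    assms(2,3) by simp

lemma trf_subst1:
  assumes "trf (\<lambda>e. P (e 0)) (\<lambda>e. Q (e 0))" "trt a a'"
  shows "trf (\<lambda>e. P (a e)) (\<lambda>e. Q (a' e))"
  by (rule corr_subst[OF assms(1) range_j assms(2)])

lemma trf_subst3:
  assumes "trf (\<lambda>e. P (e 0) (e (Suc 0)) (e (Suc (Suc 0)))) (\<lambda>e. Q (e 0) (e (Suc 0)) (e (Suc (Suc 0))))"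
    and "trt a a'" "trt b b'" "trt c c'"
  shows "trf (\<lambda>e. P (a e) (b e) (c e)) (\<lambda>e. Q (a' e) (b' e) (c' e))"
  using corr_subst[OF assms(1) range_j, of "\<lambda>i. if i = 0 then a else if i = 1 then b else c"
      "\<lambda>i. if i = 0 then a' else if i = 1 then b' else c'"] assms(2-) by simp

lemma trf_mem [trf_intros]: "trt a a' \<Longrightarrow> trt b b' \<Longrightarrow> trf (\<lambda>e. a e \<epsilon> b e) (\<lambda>e. a' e \<epsilon> b' e)"
  by (rule trf_subst2[of mem mem]) (rule corr_mem_var)

lemma trf_eq [trf_intros]: "trt a a' \<Longrightarrow> trt b b' \<Longrightarrow> trf (\<lambda>e. a e = b e) (\<lambda>e. a' e = b' e)"
  by (rule trf_subst2[of "(=)" "(=)"]) (rule corr_eq_var)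

lemmas [trf_intros] = corr_not corr_conj corr_all corr_ex

lemma trf_disj [trf_intros]: "trf P P' \<Longrightarrow> trf Q Q' \<Longrightarrow> trf (\<lambda>e. P e \<or> Q e) (\<lambda>e. P' e \<or> Q' e)"
  using corr_not[OF corr_conj[OF corr_not corr_not], of mem W j P P' Q Q'] by simp

lemma trf_imp [trf_intros]: "trf P P' \<Longrightarrow> trf Q Q' \<Longrightarrow> trf (\<lambda>e. P e \<longrightarrow> Q e) (\<lambda>e. P' e \<longrightarrow> Q' e)"
  using trf_disj[OF corr_not, of P P' Q Q'] by simp

text \<open>Bounded quantifiers need no relativization, as \<open>W\<close> is transitive. So a notion with a definition
  by bounded quantifiers has the same meaning in \<open>W\<close>.\<close>

lemma trf_ball [trf_intros]:
  assumes "trt a a'"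
    and "trf (\<lambda>e. P (e 0) (\<lambda>n. e (Suc n))) (\<lambda>e. Q (e 0) (\<lambda>n. e (Suc n)))"
  shows "trf (\<lambda>e. \<forall>x. x \<epsilon> a e \<longrightarrow> P x e) (\<lambda>e. \<forall>x. x \<epsilon> a' e \<longrightarrow> Q x e)"
proof -
  have "trf (\<lambda>e. \<forall>x. x \<epsilon> a e \<longrightarrow> P x e) (\<lambda>e. \<forall>x\<in>W. x \<epsilon> a' e \<longrightarrow> Q x e)"
    by (intro corr_all trf_imp trf_mem trt_var cterm_shift[OF assms(1)] assms(2))
  then show ?thesis
  proof (rule corr_cong)
    fix e :: "nat \<Rightarrow> 'v" assume "range e \<subseteq> W"
    then have "a' e \<in> W" using assms(1) by (simp add: cterm_def)
    then show "(\<forall>x. x \<epsilon> a' e \<longrightarrow> Q x e) \<longleftrightarrow> (\<forall>x\<in>W. x \<epsilon> a' e \<longrightarrow> Q x e)"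
      using W_trans by blast
  qed simp
qed

lemma trf_bex [trf_intros]:
  assumes "trt a a'"
    and "trf (\<lambda>e. P (e 0) (\<lambda>n. e (Suc n))) (\<lambda>e. Q (e 0) (\<lambda>n. e (Suc n)))"
  shows "trf (\<lambda>e. \<exists>x. x \<epsilon> a e \<and> P x e) (\<lambda>e. \<exists>x. x \<epsilon> a' e \<and> Q x e)"
  using corr_not[OF trf_ball[OF assms(1) corr_not[OF assms(2)]]] by simp

lemma j_mem: "j x \<epsilon> j y \<longleftrightarrow> x \<epsilon> y"
  by (rule transfer[symmetric]) (intro trf_intros)

section \<open>Absolute notions\<close>

text \<open>A definition of ordered pairs by bounded quantifiers, which shows that they are absolute.\<close>

lemma pair_bounded: "p = pair a b \<longleftrightarrow> (\<exists>u. u \<epsilon> p \<and> (\<exists>v. v \<epsilon> p \<and>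
    (\<forall>w. w \<epsilon> p \<longrightarrow> w = u \<or> w = v) \<and> a \<epsilon> u \<and> (\<forall>w. w \<epsilon> u \<longrightarrow> w = a) \<and>
    a \<epsilon> v \<and> b \<epsilon> v \<and> (\<forall>w. w \<epsilon> v \<longrightarrow> w = a \<or> w = b)))" (is "_ \<longleftrightarrow> ?R")
proof
  assume "p = pair a b"
  then show ?R
    by (intro exI[of _ "upair a a"] exI[of _ "upair a b"] conjI) (auto simp: pair_def)
next
  assume ?R
  then obtain u v where uv: "u \<epsilon> p" "v \<epsilon> p" "\<And>w. w \<epsilon> p \<Longrightarrow> w = u \<or> w = v"
    and u: "a \<epsilon> u" "\<And>w. w \<epsilon> u \<Longrightarrow> w = a"
    and v: "a \<epsilon> v" "b \<epsilon> v" "\<And>w. w \<epsilon> v \<Longrightarrow> w = a \<or> w = b" by blast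
  have "u = upair a a" by (rule set_ext, unfold mem_upair) (use u in blast)
  moreover have "v = upair a b" by (rule set_ext, unfold mem_upair) (use v in blast)
  moreover have "p = upair u v" by (rule set_ext, unfold mem_upair) (use uv in blast)
  ultimately show "p = pair a b" by (simp add: pair_def)
qed

lemma trf_eq_pair [trf_intros]:
  "trt p p' \<Longrightarrow> trt a a' \<Longrightarrow> trt b b' \<Longrightarrow> trf (\<lambda>e. p e = pair (a e) (b e)) (\<lambda>e. p' e = pair (a' e) (b' e))"
  by (rule trf_subst3[of "\<lambda>p a b. p = pair a b" "\<lambda>p a b. p = pair a b"])
    (unfold pair_bounded, intro trf_intros)

lemma trf_pair_mem [trf_intros]:
  "trt a a' \<Longrightarrow> trt b b' \<Longrightarrow> trt f f' \<Longrightarrow> trf (\<lambda>e. pair (a e) (b e) \<epsilon> f e) (\<lambda>e. pair (a' e) (b' e) \<epsilon> f' e)"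
proof (rule trf_subst3[of "\<lambda>a b f. pair a b \<epsilon> f" "\<lambda>a b f. pair a b \<epsilon> f"])
  have "trf (\<lambda>e. \<exists>p. p \<epsilon> e (Suc (Suc 0)) \<and> p = pair (e 0) (e (Suc 0)))
      (\<lambda>e. \<exists>p. p \<epsilon> e (Suc (Suc 0)) \<and> p = pair (e 0) (e (Suc 0)))"
    by (intro trf_bex trf_eq_pair trt_var)
  then show "trf (\<lambda>e. pair (e 0) (e (Suc 0)) \<epsilon> e (Suc (Suc 0)))
      (\<lambda>e. pair (e 0) (e (Suc 0)) \<epsilon> e (Suc (Suc 0)))"
    by (rule corr_cong) auto
qed

lemma trf_subset [trf_intros]: "trt a a' \<Longrightarrow> trt b b' \<Longrightarrow> trf (\<lambda>e. subset (a e) (b e)) (\<lambda>e. subset (a' e) (b' e))"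
  by (rule trf_subst2[of subset subset]) (unfold subset_def, intro trf_intros)

lemma trans_set_iff: "trans_set x \<longleftrightarrow> (\<forall>y. y \<epsilon> x \<longrightarrow> subset y x)"
  by (auto simp: trans_set_def subset_def)

lemma trf_trans_set [trf_intros]: "trt a a' \<Longrightarrow> trf (\<lambda>e. trans_set (a e)) (\<lambda>e. trans_set (a' e))"
  by (rule trf_subst1[of trans_set trans_set]) (unfold trans_set_iff, intro trf_intros)

lemma Ord_iff: "Ord x \<longleftrightarrow> trans_set x \<and> (\<forall>y. y \<epsilon> x \<longrightarrow> trans_set y)"
  by (simp add: Ord_def)

lemma trf_Ord [trf_intros]: "trt a a' \<Longrightarrow> trf (\<lambda>e. Ord (a e)) (\<lambda>e. Ord (a' e))"
  by (rule trf_subst1[of Ord Ord]) (unfold Ord_iff, intro trf_intros)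

lemma j_Ord: "Ord (j \<alpha>) \<longleftrightarrow> Ord \<alpha>"
  by (rule transfer[symmetric]) (intro trf_intros)

lemma bijection_bounded: "bijection f a b \<longleftrightarrow>
    (\<forall>p. p \<epsilon> f \<longrightarrow> (\<exists>x. x \<epsilon> a \<and> (\<exists>y. y \<epsilon> b \<and> p = pair x y))) \<and>
    (\<forall>x. x \<epsilon> a \<longrightarrow> (\<exists>y. y \<epsilon> b \<and> pair x y \<epsilon> f \<and> (\<forall>z. z \<epsilon> b \<longrightarrow> pair x z \<epsilon> f \<longrightarrow> z = y))) \<and>
    (\<forall>y. y \<epsilon> b \<longrightarrow> (\<exists>x. x \<epsilon> a \<and> pair x y \<epsilon> f \<and> (\<forall>z. z \<epsilon> a \<longrightarrow> pair z y \<epsilon> f \<longrightarrow> z = x)))"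
proof (cases "\<forall>p. p \<epsilon> f \<longrightarrow> (\<exists>x. x \<epsilon> a \<and> (\<exists>y. y \<epsilon> b \<and> p = pair x y))")
  case True
  then have dom: "x \<epsilon> a \<and> y \<epsilon> b" if "pair x y \<epsilon> f" for x y using that by fastforce
  have "(\<exists>!y. pair x y \<epsilon> f) \<longleftrightarrow> (\<exists>y. y \<epsilon> b \<and> pair x y \<epsilon> f \<and> (\<forall>z. z \<epsilon> b \<longrightarrow> pair x z \<epsilon> f \<longrightarrow> z = y))" for x
    using dom by blast
  moreover have "(\<exists>!x. pair x y \<epsilon> f) \<longleftrightarrow> (\<exists>x. x \<epsilon> a \<and> pair x y \<epsilon> f \<and> (\<forall>z. z \<epsilon> a \<longrightarrow> pair z y \<epsilon> f \<longrightarrow> z = x))" for y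
    using dom by blast
  ultimately show ?thesis using True by (simp add: bijection_def func_def)
next
  case False
  then have "\<not> func f a b" unfolding func_def by (simp only: bex_UNIV ball_UNIV) blast
  then have "\<not> bijection f a b" by (simp add: bijection_def)
  then show ?thesis using False by (simp only: simp_thms)
qed

lemma trf_bijection [trf_intros]:
  "trt f f' \<Longrightarrow> trt a a' \<Longrightarrow> trt b b' \<Longrightarrow> trf (\<lambda>e. bijection (f e) (a e) (b e)) (\<lambda>e. bijection (f' e) (a' e) (b' e))"
  by (rule trf_subst3[of bijection bijection]) (unfold bijection_bounded, intro trf_intros)

section \<open>Cardinality in the target\<close>

lemma W_upair: "a \<in> W \<Longrightarrow> b \<in> W \<Longrightarrow> upair a b \<in> W"
proof -
  assume ab: "a \<in> W" "b \<in> W"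
  have "(\<forall>a b. \<exists>z. (\<forall>w. w \<epsilon> z \<longrightarrow> w = a \<or> w = b) \<and> a \<epsilon> z \<and> b \<epsilon> z) \<longleftrightarrow>
      (\<forall>a\<in>W. \<forall>b\<in>W. \<exists>z\<in>W. (\<forall>w. w \<epsilon> z \<longrightarrow> w = a \<or> w = b) \<and> a \<epsilon> z \<and> b \<epsilon> z)"
    by (rule transfer) (intro trf_intros)
  moreover have "\<exists>z. (\<forall>w. w \<epsilon> z \<longrightarrow> w = a \<or> w = b) \<and> a \<epsilon> z \<and> b \<epsilon> z" for a b
    by (rule exI[of _ "upair a b"]) simp
  ultimately obtain z where "z \<in> W" "(\<forall>w. w \<epsilon> z \<longrightarrow> w = a \<or> w = b) \<and> a \<epsilon> z \<and> b \<epsilon> z"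
    using ab by blast
  moreover from this have "z = upair a b" by (intro set_ext) (unfold mem_upair, blast)
  ultimately show ?thesis by simp
qed

interpretation target: set_structure W mem .

lemma upair_W: "a \<in> W \<Longrightarrow> b \<in> W \<Longrightarrow> target.upair a b = upair a b"
  unfolding target.upair_def target.setof_def
proof (rule the_equality)
  fix y assume "a \<in> W" "b \<in> W" "y \<in> W \<and> (\<forall>x\<in>W. x \<epsilon> y \<longleftrightarrow> x = a \<or> x = b)"
  then show "y = upair a b" using W_trans by (intro set_ext) auto
qed (auto simp: W_upair)

lemma pair_W: "a \<in> W \<Longrightarrow> b \<in> W \<Longrightarrow> target.pair a b = pair a b"
  by (simp add: target.pair_def pair_def upair_W W_upair)

lemma pair_W_D: "f \<in> W \<Longrightarrow> pair x y \<epsilon> f \<Longrightarrow> x \<in> W \<and> y \<in> W"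
proof -
  assume "f \<in> W" "pair x y \<epsilon> f"
  then have "upair x y \<in> W" using W_trans[of "pair x y" "upair x y"] W_trans[of f] by (simp add: pair_def)
  then show ?thesis using W_trans[of "upair x y"] by simp
qed

lemma ball_W: "a \<in> W \<Longrightarrow> (\<forall>x\<in>W. x \<epsilon> a \<longrightarrow> P x) \<longleftrightarrow> (\<forall>x. x \<epsilon> a \<longrightarrow> P x)"
  using W_trans by blast

lemma func_W: "f \<in> W \<Longrightarrow> a \<in> W \<Longrightarrow> b \<in> W \<Longrightarrow> target.func f a b \<longleftrightarrow> func f a b"
proof -
  assume W: "f \<in> W" "a \<in> W" "b \<in> W"
  have 1: "(\<exists>x\<in>W. \<exists>y\<in>W. x \<epsilon> a \<and> y \<epsilon> b \<and> p = target.pair x y) \<longleftrightarrow> (\<exists>x y. x \<epsilon> a \<and> y \<epsilon> b \<and> p = pair x y)" for p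
    using W W_trans pair_W by metis
  have 2: "(y \<in> W \<and> target.pair x y \<epsilon> f) \<longleftrightarrow> pair x y \<epsilon> f" if "x \<in> W" for x y
    using W that pair_W pair_W_D by metis
  have "(\<exists>!y. y \<in> W \<and> target.pair x y \<epsilon> f) \<longleftrightarrow> (\<exists>!y. pair x y \<epsilon> f)" if "x \<in> W" for x
    by (simp add: 2[OF that])
  then have "(\<forall>x\<in>W. x \<epsilon> a \<longrightarrow> (\<exists>!y. y \<in> W \<and> target.pair x y \<epsilon> f)) \<longleftrightarrow>
      (\<forall>x. x \<epsilon> a \<longrightarrow> (\<exists>!y. pair x y \<epsilon> f))"
    unfolding ball_W[OF W(2)] by (intro all_cong1 imp_cong refl) (use W_trans[OF W(2)] in simp)
  moreover have "(\<forall>p\<in>W. p \<epsilon> f \<longrightarrow> (\<exists>x\<in>W. \<exists>y\<in>W. x \<epsilon> a \<and> y \<epsilon> b \<and> p = target.pair x y)) \<longleftrightarrow>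
      (\<forall>p. p \<epsilon> f \<longrightarrow> (\<exists>x y. x \<epsilon> a \<and> y \<epsilon> b \<and> p = pair x y))"
    unfolding 1 ball_W[OF W(1)] by (rule refl)
  ultimately show ?thesis
    unfolding target.func_def func_def by simp
qed

lemma bijection_W: "f \<in> W \<Longrightarrow> a \<in> W \<Longrightarrow> b \<in> W \<Longrightarrow> target.bijection f a b \<longleftrightarrow> bijection f a b"
proof -
  assume W: "f \<in> W" "a \<in> W" "b \<in> W"
  have 2: "(x \<in> W \<and> target.pair x y \<epsilon> f) \<longleftrightarrow> pair x y \<epsilon> f" if "y \<in> W" for x y
    using W that pair_W pair_W_D by metis
  have "(\<exists>!x. x \<in> W \<and> target.pair x y \<epsilon> f) \<longleftrightarrow> (\<exists>!x. pair x y \<epsilon> f)" if "y \<in> W" for y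
    by (simp add: 2[OF that])
  then have "(\<forall>y\<in>W. y \<epsilon> b \<longrightarrow> (\<exists>!x. x \<in> W \<and> target.pair x y \<epsilon> f)) \<longleftrightarrow>
      (\<forall>y. y \<epsilon> b \<longrightarrow> (\<exists>!x. pair x y \<epsilon> f))"
    unfolding ball_W[OF W(3)] by (intro all_cong1 imp_cong refl) (use W_trans[OF W(3)] in simp)
  then show ?thesis
    unfolding target.bijection_def bijection_def func_W[OF W] by simp
qed

lemma eqpoll_W: "a \<in> W \<Longrightarrow> b \<in> W \<Longrightarrow> target.eqpoll a b \<longleftrightarrow> (\<exists>f\<in>W. bijection f a b)"
  by (auto simp: target.eqpoll_def bijection_W)

lemma Ord_W: "x \<in> W \<Longrightarrow> target.Ord x \<longleftrightarrow> Ord x"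
  unfolding target.Ord_def target.trans_set_def Ord_def trans_set_def using W_trans by blast

text \<open>The notion of an initial ordinal relativized to \<open>W\<close>, with the absolute parts simplified.\<close>

definition initial_W :: "'v \<Rightarrow> bool" where
  "initial_W \<alpha> \<longleftrightarrow> Ord \<alpha> \<and> (\<forall>\<beta>. \<beta> \<epsilon> \<alpha> \<longrightarrow> \<not> (\<exists>f\<in>W. bijection f \<alpha> \<beta>))"

lemma is_initial_W: "\<alpha> \<in> W \<Longrightarrow> target.is_initial \<alpha> \<longleftrightarrow> initial_W \<alpha>"
  unfolding target.is_initial_def initial_W_def using W_trans Ord_W eqpoll_W by metis

lemma trf_eqpoll [trf_intros]:
  "trt a a' \<Longrightarrow> trt b b' \<Longrightarrow> trf (\<lambda>e. eqpoll (a e) (b e)) (\<lambda>e. \<exists>f\<in>W. bijection f (a' e) (b' e))"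
  by (rule trf_subst2[of eqpoll "\<lambda>a b. \<exists>f\<in>W. bijection f a b"])
    (simp add: eqpoll_def, intro trf_intros)

lemma trf_is_initial [trf_intros]: "trt a a' \<Longrightarrow> trf (\<lambda>e. is_initial (a e)) (\<lambda>e. initial_W (a' e))"
  by (rule trf_subst1[of is_initial initial_W])
    (unfold is_initial_def initial_W_def ball_UNIV, intro trf_intros)

text \<open>That \<open>W\<close> computes cardinalities is inherited from the universe, by elementarity.\<close>

lemma ex1_initial_W:
  assumes "x \<in> W"
  shows "\<exists>\<alpha>\<in>W. initial_W \<alpha> \<and> (\<exists>f\<in>W. bijection f x \<alpha>) \<and>
    (\<forall>\<beta>\<in>W. initial_W \<beta> \<longrightarrow> (\<exists>f\<in>W. bijection f x \<beta>) \<longrightarrow> \<beta> = \<alpha>)"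
proof -
  have "(\<forall>x. \<exists>\<alpha>. is_initial \<alpha> \<and> eqpoll x \<alpha> \<and> (\<forall>\<beta>. is_initial \<beta> \<longrightarrow> eqpoll x \<beta> \<longrightarrow> \<beta> = \<alpha>)) \<longleftrightarrow>
      (\<forall>x\<in>W. \<exists>\<alpha>\<in>W. initial_W \<alpha> \<and> (\<exists>f\<in>W. bijection f x \<alpha>) \<and>
        (\<forall>\<beta>\<in>W. initial_W \<beta> \<longrightarrow> (\<exists>f\<in>W. bijection f x \<beta>) \<longrightarrow> \<beta> = \<alpha>))"
    by (rule transfer) (intro trf_intros)
  moreover have "\<exists>\<alpha>. is_initial \<alpha> \<and> eqpoll x \<alpha> \<and> (\<forall>\<beta>. is_initial \<beta> \<longrightarrow> eqpoll x \<beta> \<longrightarrow> \<beta> = \<alpha>)" for x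
    using ex1_initial[of x] by blast
  ultimately show ?thesis using assms by blast
qed

lemma card_W_eqI:
  assumes "x \<in> W" "\<alpha> \<in> W" "initial_W \<alpha>" "\<exists>f\<in>W. bijection f x \<alpha>"
  shows "set_structure.card W mem x = \<alpha>"
  unfolding target.card_def
proof (rule the_equality)
  show "\<alpha> \<in> W \<and> target.is_initial \<alpha> \<and> target.eqpoll x \<alpha>"
    using assms by (simp add: is_initial_W eqpoll_W)
  fix \<beta> assume "\<beta> \<in> W \<and> target.is_initial \<beta> \<and> target.eqpoll x \<beta>"
  then have \<beta>: "\<beta> \<in> W" "initial_W \<beta>" "\<exists>f\<in>W. bijection f x \<beta>"
    using assms(1) by (auto simp: is_initial_W eqpoll_W)
  obtain \<gamma> where \<gamma>: "\<And>\<beta>. \<beta> \<in> W \<Longrightarrow> initial_W \<beta> \<Longrightarrow> \<exists>f\<in>W. bijection f x \<beta> \<Longrightarrow> \<beta> = \<gamma>"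
    using ex1_initial_W[OF assms(1)] by blast
  show "\<beta> = \<alpha>" using \<gamma>[OF \<beta>] \<gamma>[OF assms(2-4)] by (rule trans[OF _ sym])
qed

lemma card_W_bijection: "x \<in> W \<Longrightarrow> \<exists>f\<in>W. bijection f x (set_structure.card W mem x)"
proof -
  assume "x \<in> W"
  then obtain \<alpha> where \<alpha>: "\<alpha> \<in> W" "initial_W \<alpha>" "\<exists>f\<in>W. bijection f x \<alpha>"
    using ex1_initial_W[of x] by blast
  then show ?thesis using card_W_eqI[OF \<open>x \<in> W\<close> \<alpha>] by simp
qed

text \<open>For the least counterexample \<open>\<beta>\<close>, elementarity makes \<open>j \<beta>\<close> a smaller one.\<close>

lemma j_Ord_not_less: "Ord \<alpha> \<Longrightarrow> \<not> j \<alpha> \<epsilon> \<alpha>"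
proof
  assume "Ord \<alpha>" "j \<alpha> \<epsilon> \<alpha>"
  then have "\<exists>\<beta>. Ord \<beta> \<and> j \<beta> \<epsilon> \<beta> \<and> (\<forall>\<gamma>. \<gamma> \<epsilon> \<beta> \<longrightarrow> \<not> j \<gamma> \<epsilon> \<gamma>)"
    by (intro least_Ord) simp_all
  then show False using j_mem by blast
qed

end

section \<open>Ultrapowers of the universe\<close>

locale ultrapower = ZFC mem
  for mem :: "'v \<Rightarrow> 'v \<Rightarrow> bool"  (infix "\<epsilon>" 50) +
  fixes \<delta> X U :: 'v
  assumes uncountable_\<delta>: "uncountable_cardinal \<delta>"
    and complete_U: "complete_filter \<delta> X (Power X) U"
    and measures_U: "measures X (Power X) U"
begin

lemmas \<delta>_facts = uncountable_cardinal_facts[OF uncountable_\<delta>]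

lemma X_in_U: "X \<epsilon> U" and empty_notin_U: "\<not> empty \<epsilon> U"
  using complete_U unfolding complete_filter_def by blast+

lemma U_subset: "Y \<epsilon> U \<Longrightarrow> subset Y X"
proof -
  have "subset U (Power X)" using complete_U unfolding complete_filter_def by blast
  then show "Y \<epsilon> U \<Longrightarrow> subset Y X" using subsetD[of U "Power X" Y] by simp
qed

lemma U_upward: "Z \<epsilon> U \<Longrightarrow> subset Z Y \<Longrightarrow> subset Y X \<Longrightarrow> Y \<epsilon> U"
proof -
  have "\<forall>Y Z. Y \<epsilon> Power X \<and> Z \<epsilon> Power X \<and> subset Z Y \<and> Z \<epsilon> U \<longrightarrow> Y \<epsilon> U"
    using complete_U unfolding complete_filter_def by blast
  then show "Z \<epsilon> U \<Longrightarrow> subset Z Y \<Longrightarrow> subset Y X \<Longrightarrow> Y \<epsilon> U"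
    using U_subset unfolding mem_Power by blast
qed

lemma U_measures: "subset Y X \<Longrightarrow> Y \<epsilon> U \<or> diff X Y \<epsilon> U"
  using measures_U by (simp add: measures_def)

lemma U_meets:
  assumes t: "dt (\<lambda>e. t (e 0))" and \<nu>: "\<nu> \<epsilon> \<delta>" and tU: "\<And>i. i \<epsilon> \<nu> \<Longrightarrow> t i \<epsilon> U"
  shows "\<exists>x. x \<epsilon> X \<and> (\<forall>i. i \<epsilon> \<nu> \<longrightarrow> x \<epsilon> t i)"
proof -
  have f: "func (lam \<nu> t) \<nu> U" using t tU by (rule func_lam)
  have "\<forall>\<nu> Y. \<nu> \<epsilon> \<delta> \<and> func Y \<nu> U \<longrightarrow> (\<exists>x. x \<epsilon> X \<and> (\<forall>i. i \<epsilon> \<nu> \<longrightarrow> x \<epsilon> app Y i))"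
    using complete_U unfolding complete_filter_def by blast
  then obtain x where x: "x \<epsilon> X" "\<And>i. i \<epsilon> \<nu> \<Longrightarrow> x \<epsilon> app (lam \<nu> t) i" using f \<nu> by blast
  have "x \<epsilon> t i" if "i \<epsilon> \<nu>" for i
    using x(2)[OF that] app_eq_ap[OF f that] ap_lam[OF t that] by simp
  then show ?thesis using x(1) by blast
qed

definition large :: "('v \<Rightarrow> bool) \<Rightarrow> bool" where
  "large P \<longleftrightarrow> sep X P \<epsilon> U"

lemma df_large [df_intros, simp]:
  "df (\<lambda>e. P (e 0) (\<lambda>n. e (Suc n))) \<Longrightarrow> df (\<lambda>e. large (\<lambda>x. P x e))"
  unfolding large_def by (intro df_intros)

lemma large_mono:
  assumes "df (\<lambda>e. P (e 0))" "df (\<lambda>e. Q (e 0))" "large P" "\<And>x. x \<epsilon> X \<Longrightarrow> P x \<Longrightarrow> Q x"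
  shows "large Q"
  using assms(3) unfolding large_def
  by (rule U_upward) (use assms in \<open>auto simp: subset_def\<close>)

lemma large_cong:
  assumes "df (\<lambda>e. P (e 0))" "df (\<lambda>e. Q (e 0))" "\<And>x. x \<epsilon> X \<Longrightarrow> P x \<longleftrightarrow> Q x"
  shows "large P \<longleftrightarrow> large Q"
  using assms large_mono[of P Q] large_mono[of Q P] by blast

text \<open>Any two members of \<open>U\<close> have a common element, which excludes that both properties are large; that
  one of them is large holds because \<open>U\<close> measures every subset of \<open>X\<close>.\<close>

lemma large_not:
  assumes P: "df (\<lambda>e. P (e 0))"
  shows "large (\<lambda>x. \<not> P x) \<longleftrightarrow> \<not> large P"
proof
  assume not_P: "large (\<lambda>x. \<not> P x)"
  show "\<not> large P"
  proof
    assume large_P: "large P"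
    let ?t = "\<lambda>i. if i = empty then sep X P else sep X (\<lambda>x. \<not> P x)"
    have "\<exists>x. x \<epsilon> X \<and> (\<forall>i. i \<epsilon> num 2 \<longrightarrow> x \<epsilon> ?t i)"
    proof (rule U_meets)
      show "?t i \<epsilon> U" for i using large_P not_P by (simp add: large_def)
    qed (simp_all add: \<delta>_facts del: num.simps)
    then obtain x where "x \<epsilon> ?t (num 0)" "x \<epsilon> ?t (num 1)"
      using num_mem[of 0 2] num_mem[of 1 2] by (metis zero_less_numeral one_less_numeral_iff semiring_norm(76))
    moreover have "num 1 \<noteq> empty" using num_eq[of 1 0] by simp
    ultimately show False using P by (simp del: num.simps(2)) 
  qed
next
  assume "\<not> large P"
  moreover have "diff X (sep X P) = sep X (\<lambda>x. \<not> P x)"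
    by (rule set_ext) (use P in auto)
  ultimately show "large (\<lambda>x. \<not> P x)"
    using U_measures[of "sep X P"] P unfolding large_def by (auto simp: subset_def)
qed

lemma large_all:
  assumes P: "df (\<lambda>e. P (e 0) (e (Suc 0)))" and \<nu>: "\<nu> \<epsilon> \<delta>"
    and lP: "\<And>i. i \<epsilon> \<nu> \<Longrightarrow> large (P i)"
  shows "large (\<lambda>x. \<forall>i. i \<epsilon> \<nu> \<longrightarrow> P i x)"
proof (rule ccontr)
  note [simp] = df_subst2[OF P]
  let ?Q = "\<lambda>x. \<forall>i. i \<epsilon> \<nu> \<longrightarrow> P i x"
  assume "\<not> large ?Q"
  then have nQ: "large (\<lambda>x. \<not> ?Q x)" by (subst large_not) simp_all
  \<comment> \<open>The complement joins the family as the member with the index \<open>\<nu>\<close>.\<close>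
  let ?t = "\<lambda>i. if i \<epsilon> \<nu> then sep X (P i) else sep X (\<lambda>x. \<not> ?Q x)"
  have "adjoin \<nu> \<nu> \<epsilon> \<delta>"
    using succ_less_cardinal[OF uncountable_\<delta> \<nu>] .
  then have "\<exists>x. x \<epsilon> X \<and> (\<forall>i. i \<epsilon> adjoin \<nu> \<nu> \<longrightarrow> x \<epsilon> ?t i)"
    by (intro U_meets) (use lP nQ in \<open>simp_all add: large_def\<close>)
  then obtain x where x: "x \<epsilon> X" "\<And>i. i \<epsilon> adjoin \<nu> \<nu> \<Longrightarrow> x \<epsilon> ?t i" by blast
  have "P i x" if "i \<epsilon> \<nu>" for i using x(2)[of i] that by simp
  moreover have "\<not> ?Q x" using x(2)[of \<nu>] by simp
  ultimately show False by blast
qed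

lemma large_conj:
  assumes "df (\<lambda>e. P (e 0))" "df (\<lambda>e. Q (e 0))"
  shows "large (\<lambda>x. P x \<and> Q x) \<longleftrightarrow> large P \<and> large Q"
proof
  assume "large (\<lambda>x. P x \<and> Q x)"
  then show "large P \<and> large Q"
    using large_mono[of "\<lambda>x. P x \<and> Q x" P] large_mono[of "\<lambda>x. P x \<and> Q x" Q] assms by simp
next
  note [simp] = df_subst1[OF assms(1)] df_subst1[OF assms(2)]
  assume lPQ: "large P \<and> large Q"
  have two: "i \<epsilon> num 2 \<longleftrightarrow> i = empty \<or> i = num 1" for i by (auto simp: numeral_2_eq_2)
  have "large (\<lambda>x. \<forall>i. i \<epsilon> num 2 \<longrightarrow> (if i = empty then P x else Q x))"
  proof (rule large_all)
    show "large (\<lambda>x. if i = empty then P x else Q x)" for i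
      using lPQ by (cases "i = empty") simp_all
  qed (simp_all add: if_bool_eq_conj \<delta>_facts del: num.simps)
  then show "large (\<lambda>x. P x \<and> Q x)"
    by (rule large_mono[rotated 2])
      (use num_eq[of 0 1] in \<open>auto simp: two if_bool_eq_conj\<close>)
qed

lemma large_const: "large (\<lambda>x. b) \<longleftrightarrow> b"
proof -
  have "sep X (\<lambda>x. True) = X" "sep X (\<lambda>x. False) = empty"
    by (auto intro!: set_ext)
  then show ?thesis using X_in_U empty_notin_U by (cases b) (simp_all add: large_def)
qed

lemma large_ex:
  assumes P: "df (\<lambda>e. P (e 0) (e (Suc 0)))" and \<nu>: "\<nu> \<epsilon> \<delta>"
    and ex: "large (\<lambda>x. \<exists>i. i \<epsilon> \<nu> \<and> P i x)"
  shows "\<exists>i. i \<epsilon> \<nu> \<and> large (P i)"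
proof (rule ccontr)
  note [simp] = df_subst2[OF P]
  assume "\<not> ?thesis"
  then have "large (\<lambda>x. \<forall>i. i \<epsilon> \<nu> \<longrightarrow> \<not> P i x)"
    by (intro large_all \<nu>) (auto simp: large_not)
  then have "large (\<lambda>x. \<not> (\<exists>i. i \<epsilon> \<nu> \<and> P i x))"
    by (rule large_mono[rotated 2]) auto
  then show False using ex by (subst (asm) large_not) simp_all
qed

text \<open>Every set \<open>f\<close> represents an element of the ultrapower, by its values \<open>ap f x\<close>.\<close>

definition eqU :: "'v \<Rightarrow> 'v \<Rightarrow> bool" where
  "eqU f g \<longleftrightarrow> large (\<lambda>x. ap f x = ap g x)"

definition memU :: "'v \<Rightarrow> 'v \<Rightarrow> bool" where
  "memU f g \<longleftrightarrow> large (\<lambda>x. ap f x \<epsilon> ap g x)"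

lemma df_eqU [df_intros, simp]: "dt a \<Longrightarrow> dt b \<Longrightarrow> df (\<lambda>e. eqU (a e) (b e))"
  by (rule df_subst2[of eqU]) (simp_all add: eqU_def)

lemma df_memU [df_intros, simp]: "dt a \<Longrightarrow> dt b \<Longrightarrow> df (\<lambda>e. memU (a e) (b e))"
  by (rule df_subst2[of memU]) (simp_all add: memU_def)

lemma eqU_sym: "eqU f g \<Longrightarrow> eqU g f"
  by (simp add: eqU_def eq_commute)

lemma eqU_trans: "eqU f g \<Longrightarrow> eqU g h \<Longrightarrow> eqU f h"
proof -
  assume "eqU f g" "eqU g h"
  then have "large (\<lambda>x. ap f x = ap g x \<and> ap g x = ap h x)"
    by (simp add: large_conj eqU_def)
  then show ?thesis unfolding eqU_def by (rule large_mono[rotated 2]) simp_all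
qed

lemma memU_cong: "eqU f f' \<Longrightarrow> eqU g g' \<Longrightarrow> memU f g \<Longrightarrow> memU f' g'"
proof -
  assume "eqU f f'" "eqU g g'" "memU f g"
  then have "large (\<lambda>x. (ap f x = ap f' x \<and> ap g x = ap g' x) \<and> ap f x \<epsilon> ap g x)"
    by (simp add: large_conj eqU_def memU_def)
  then show ?thesis unfolding memU_def by (rule large_mono[rotated 2]) auto
qed

text \<open>The elements of \<open>f\<close> in the ultrapower are represented by a set of functions, because their
  values may be taken from the values of \<open>f\<close>.\<close>

definition val_elems :: "'v \<Rightarrow> 'v" where
  "val_elems f = adjoin (Cup (repl X (ap f))) empty"

definition reps :: "'v \<Rightarrow> 'v" where
  "reps f = sep (funs X (val_elems f)) (\<lambda>g. memU g f)"

lemma dt_val_elems [df_intros, simp]: "dt a \<Longrightarrow> dt (\<lambda>e. val_elems (a e))"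
  by (rule dt_subst1[of val_elems]) (simp_all add: val_elems_def)

lemma dt_reps [df_intros, simp]: "dt a \<Longrightarrow> dt (\<lambda>e. reps (a e))"
  by (rule dt_subst1[of reps]) (simp_all add: reps_def)

lemma reps_memU: "g \<epsilon> reps f \<Longrightarrow> memU g f"
  by (simp add: reps_def)

lemma memU_reps: "memU g f \<Longrightarrow> \<exists>g'. g' \<epsilon> reps f \<and> eqU g g'"
proof -
  assume g: "memU g f"
  let ?g = "lam X (\<lambda>x. if ap g x \<epsilon> ap f x then ap g x else empty)"
  have "eqU g ?g"
    unfolding eqU_def using g[unfolded memU_def] by (rule large_mono[rotated 2]) auto
  moreover have "func ?g X (val_elems f)"
    by (rule func_lam) (auto simp: val_elems_def)
  moreover have "memU ?g f" using memU_cong[OF \<open>eqU g ?g\<close> _ g, of f] by (simp add: eqU_def large_const)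
  ultimately show ?thesis by (auto simp: reps_def)
qed

text \<open>The functions into a transitive set that contains all values of \<open>f\<close> are closed under \<open>reps\<close>.\<close>

lemma reps_closed: "\<exists>A. f \<epsilon> A \<and> (\<forall>g. g \<epsilon> A \<longrightarrow> subset (reps g) A)"
proof -
  obtain T where T: "trans_set T" "subset (val_elems f) T"
    using transitive_superset by blast
  have elems_T: "subset (val_elems g) T" if "g \<epsilon> funs X T" for g
  proof -
    have "empty \<epsilon> T" using T(2) by (auto simp: subset_def val_elems_def)
    moreover have "z \<epsilon> T" if "x \<epsilon> X" "z \<epsilon> ap g x" for x z
    proof -
      have "ap g x \<epsilon> T" using \<open>g \<epsilon> funs X T\<close> that(1) func_ap by simp
      then show ?thesis using that(2) T(1) unfolding trans_set_def by blast
    qed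
    ultimately show ?thesis by (auto simp: subset_def val_elems_def)
  qed
  have reps_T: "subset (reps g) (funs X T)" if "subset (val_elems g) T" for g
    using that func_mono func_ap by (simp add: subset_def reps_def) blast
  show ?thesis
  proof (intro exI conjI allI impI)
    show "f \<epsilon> adjoin (funs X T) f" by simp
    fix g assume "g \<epsilon> adjoin (funs X T) f"
    then have "subset (reps g) (funs X T)" using elems_T T(2) reps_T by auto
    then show "subset (reps g) (adjoin (funs X T) f)" by (simp add: subset_def)
  qed
qed

text \<open>A set without minimal elements yields a sequence that descends at almost all coordinates for
  each step. As countably many steps are fewer than \<open>\<delta>\<close>, some coordinate descends at all of them.\<close>

lemma reps_minimal: "f \<epsilon> S \<Longrightarrow> \<exists>m. m \<epsilon> S \<and> \<not> (\<exists>z. z \<epsilon> S \<and> z \<epsilon> reps m)"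
proof (rule ccontr)
  assume f: "f \<epsilon> S" and "\<nexists>m. m \<epsilon> S \<and> \<not> (\<exists>z. z \<epsilon> S \<and> z \<epsilon> reps m)"
  then have "\<exists>g. func_on g S \<and> (\<forall>m. m \<epsilon> S \<longrightarrow> ap g m \<epsilon> S \<and> ap g m \<epsilon> reps m)"
    by (intro class_choice[of "\<lambda>m z. z \<epsilon> S \<and> z \<epsilon> reps m"]) (simp, blast)
  then obtain g where g: "\<And>m. m \<epsilon> S \<Longrightarrow> ap g m \<epsilon> S \<and> memU (ap g m) m"
    using reps_memU by blast
  obtain F where F: "dt (\<lambda>e. F (e 0))" "F empty = f"
      "\<And>n. n \<epsilon> omega \<Longrightarrow> F (adjoin n n) = ap g (F n)"
    using omega_recursion[of "ap g" f] by auto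
  note [simp] = dt_subst1[OF F(1)]
  have FS: "F n \<epsilon> S" if "n \<epsilon> omega" for n
    by (rule omega_induct[OF _ _ _ that, of "\<lambda>n. F n \<epsilon> S"]) (simp_all add: F f g)
  let ?t = "\<lambda>n. sep X (\<lambda>x. ap (F (adjoin n n)) x \<epsilon> ap (F n) x)"
  have "?t n \<epsilon> U" if "n \<epsilon> omega" for n
    using g[OF FS[OF that]] F(3)[OF that] by (simp add: memU_def large_def)
  then have "\<exists>x. x \<epsilon> X \<and> (\<forall>n. n \<epsilon> omega \<longrightarrow> x \<epsilon> ?t n)"
    by (intro U_meets) (simp_all add: \<delta>_facts)
  then obtain x where x: "x \<epsilon> X" "\<And>n. n \<epsilon> omega \<Longrightarrow> x \<epsilon> ?t n" by blast
  let ?D = "repl omega (\<lambda>n. ap (F n) x)"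
  have D: "y \<epsilon> ?D \<longleftrightarrow> (\<exists>n. n \<epsilon> omega \<and> y = ap (F n) x)" for y by simp
  have "ap (F empty) x \<epsilon> ?D" unfolding D using empty_in_omega by blast
  from mem_minimal[OF this] obtain m where m: "m \<epsilon> ?D" "\<not> (\<exists>z. z \<epsilon> ?D \<and> z \<epsilon> m)" by blast
  then obtain n where n: "n \<epsilon> omega" "\<not> (\<exists>z. z \<epsilon> ?D \<and> z \<epsilon> ap (F n) x)"
    unfolding D by blast
  moreover have "ap (F (adjoin n n)) x \<epsilon> ?D" unfolding D using n(1) succ_in_omega by blast
  moreover have "ap (F (adjoin n n)) x \<epsilon> ap (F n) x" using x(2)[OF n(1)] by simp
  ultimately show False by blast
qed

section \<open>The transitive collapse\<close>

definition collapse :: "'v \<Rightarrow> 'v" where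
  "collapse = (SOME F. dt (\<lambda>e. F (e 0)) \<and> (\<forall>f. F f = repl (reps f) F))"

lemma collapse_spec: "dt (\<lambda>e. collapse (e 0)) \<and> (\<forall>f. collapse f = repl (reps f) collapse)"
proof -
  have "\<exists>F. dt (\<lambda>e. F (e 0)) \<and> (\<forall>f. F f = repl (reps f) F)"
    by (rule wf_recursion[of reps "\<lambda>s. s"]) (simp, simp, rule reps_closed, rule reps_minimal)
  then show ?thesis
    unfolding collapse_def by (rule someI_ex[of "\<lambda>F. dt (\<lambda>e. F (e 0)) \<and> (\<forall>f. F f = repl (reps f) F)"])
qed

lemmas dt_collapse [df_intros, simp] = dt_subst1[OF conjunct1[OF collapse_spec]]

lemma mem_collapse: "y \<epsilon> collapse f \<longleftrightarrow> (\<exists>g. g \<epsilon> reps f \<and> y = collapse g)"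
  by (subst collapse_spec[THEN conjunct2, rule_format]) simp

lemma reps_induct: "df (\<lambda>e. P (e 0)) \<Longrightarrow> (\<And>f. (\<And>g. g \<epsilon> reps f \<Longrightarrow> P g) \<Longrightarrow> P f) \<Longrightarrow> P f"
  by (rule wf_induct[of reps P]) (use reps_closed reps_minimal in blast)+

lemma collapse_eqU: "eqU f f' \<Longrightarrow> collapse f = collapse f'"
proof -
  have "\<forall>f'. eqU f f' \<longrightarrow> collapse f = collapse f'"
  proof (rule reps_induct[of "\<lambda>f. \<forall>f'. eqU f f' \<longrightarrow> collapse f = collapse f'"])
    fix f assume IH: "\<And>g. g \<epsilon> reps f \<Longrightarrow> \<forall>g'. eqU g g' \<longrightarrow> collapse g = collapse g'"
    show "\<forall>f'. eqU f f' \<longrightarrow> collapse f = collapse f'"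
    proof (intro allI impI set_ext)
      fix f' y assume ff': "eqU f f'"
      have refl: "eqU g g" for g by (simp add: eqU_def large_const)
      show "y \<epsilon> collapse f \<longleftrightarrow> y \<epsilon> collapse f'"
      proof
        assume "y \<epsilon> collapse f"
        then obtain g where g: "g \<epsilon> reps f" "y = collapse g" by (auto simp: mem_collapse)
        then obtain g' where "g' \<epsilon> reps f'" "eqU g g'"
          using memU_reps memU_cong[OF refl ff' reps_memU] by blast
        then show "y \<epsilon> collapse f'" using g IH unfolding mem_collapse by blast
      next
        assume "y \<epsilon> collapse f'"
        then obtain g' where g': "g' \<epsilon> reps f'" "y = collapse g'" by (auto simp: mem_collapse)
        then obtain g where "g \<epsilon> reps f" "eqU g' g"
          using memU_reps memU_cong[OF refl eqU_sym[OF ff'] reps_memU] by blast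
        then show "y \<epsilon> collapse f" using g' IH eqU_sym unfolding mem_collapse by metis
      qed
    qed
  qed simp
  then show "eqU f f' \<Longrightarrow> collapse f = collapse f'" by blast
qed

lemma collapse_memI: "memU g f \<Longrightarrow> collapse g \<epsilon> collapse f"
  using memU_reps[of g f] collapse_eqU unfolding mem_collapse by blast

text \<open>Extensionality of the ultrapower: if \<open>f\<close> and \<open>f'\<close> differ at almost all coordinates, then choosing
  an element of the one outside the other at each coordinate yields an element of the ultrapower that
  distinguishes them.\<close>

lemma collapse_inject: "collapse f = collapse f' \<Longrightarrow> eqU f f'"
proof -
  have "\<forall>f'. collapse f = collapse f' \<longrightarrow> eqU f f'"
  proof (rule reps_induct[of "\<lambda>f. \<forall>f'. collapse f = collapse f' \<longrightarrow> eqU f f'"])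
    fix f assume IH: "\<And>g. g \<epsilon> reps f \<Longrightarrow> \<forall>g'. collapse g = collapse g' \<longrightarrow> eqU g g'"
    show "\<forall>f'. collapse f = collapse f' \<longrightarrow> eqU f f'"
    proof (intro allI impI)
      fix f' assume eq: "collapse f = collapse f'"
      have refl: "eqU g g" for g by (simp add: eqU_def large_const)
      have sub: "large (\<lambda>x. \<not> (\<exists>z. z \<epsilon> ap a x \<and> \<not> z \<epsilon> ap b x))"
        if ab: "\<And>g. memU g a \<Longrightarrow> memU g b" for a b
      proof -
        obtain g where g: "\<And>x. x \<epsilon> X \<Longrightarrow> \<exists>z. z \<epsilon> ap a x \<and> \<not> z \<epsilon> ap b x \<Longrightarrow>
            ap g x \<epsilon> ap a x \<and> \<not> ap g x \<epsilon> ap b x"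
          using class_choice[of "\<lambda>x z. (\<exists>z. z \<epsilon> ap a x \<and> \<not> z \<epsilon> ap b x) \<longrightarrow> z \<epsilon> ap a x \<and> \<not> z \<epsilon> ap b x" X]
          by auto
        have "\<not> large (\<lambda>x. \<exists>z. z \<epsilon> ap a x \<and> \<not> z \<epsilon> ap b x)"
        proof
          assume "large (\<lambda>x. \<exists>z. z \<epsilon> ap a x \<and> \<not> z \<epsilon> ap b x)"
          then have "large (\<lambda>x. ap g x \<epsilon> ap a x \<and> \<not> ap g x \<epsilon> ap b x)"
            by (rule large_mono[rotated 2]) (use g in auto)
          then have "memU g a" "\<not> memU g b"
            by (simp_all add: large_conj large_not memU_def)
          then show False using ab by blast
        qed
        then show ?thesis by (subst large_not) simp_all
      qed
      have trans: "memU g b"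
        if ab: "collapse a = collapse b" "memU g a"
          and inj: "\<And>g h. g \<epsilon> reps a \<Longrightarrow> h \<epsilon> reps b \<Longrightarrow> collapse g = collapse h \<Longrightarrow> eqU g h"
        for a b g
      proof -
        obtain g0 where g0: "g0 \<epsilon> reps a" "eqU g g0" using memU_reps ab(2) by blast
        then have "collapse g0 \<epsilon> collapse b" using ab(1) mem_collapse by metis
        then obtain g1 where g1: "g1 \<epsilon> reps b" "collapse g0 = collapse g1" using mem_collapse by blast
        then have "eqU g1 g" using inj[OF g0(1)] g0(2) eqU_sym eqU_trans by blast
        then show ?thesis using memU_cong[OF _ refl reps_memU[OF g1(1)]] by blast
      qed
      have 1: "memU g f'" if "memU g f" for g
        using trans[OF eq that] IH by blast
      have 2: "memU g f" if "memU g f'" for g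
        using trans[OF eq[symmetric] that] IH eqU_sym by metis
      have "large (\<lambda>x. \<not> (\<exists>z. z \<epsilon> ap f x \<and> \<not> z \<epsilon> ap f' x) \<and> \<not> (\<exists>z. z \<epsilon> ap f' x \<and> \<not> z \<epsilon> ap f x))"
        using sub[OF 1] sub[OF 2] by (subst large_conj) simp_all
      then show "eqU f f'"
        unfolding eqU_def by (rule large_mono[rotated 2]) (auto intro!: set_ext)
    qed
  qed simp
  then show "collapse f = collapse f' \<Longrightarrow> eqU f f'" by blast
qed

lemma collapse_eq_iff: "collapse f = collapse f' \<longleftrightarrow> eqU f f'"
  using collapse_eqU collapse_inject by blast

lemma collapse_mem_iff: "collapse g \<epsilon> collapse f \<longleftrightarrow> memU g f"
proof
  assume "collapse g \<epsilon> collapse f"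
  then obtain g' where "g' \<epsilon> reps f" "collapse g = collapse g'" using mem_collapse by blast
  moreover have "eqU f f" by (simp add: eqU_def large_const)
  ultimately show "memU g f"
    using collapse_inject reps_memU memU_cong[of g' g f f] eqU_sym by blast
qed (rule collapse_memI)

lemma df_sat_values: "df (\<lambda>e. sat UNIV mem (\<lambda>i. ap (F i) (e 0)) p)"
  by (rule df_sat) simp

text \<open>In the step for the quantifier, collection and choice for classes provide a function that picks
  a counterexample at every coordinate that has one.\<close>

theorem Los: "sat (range collapse) mem (\<lambda>i. collapse (F i)) p \<longleftrightarrow>
    large (\<lambda>x. sat UNIV mem (\<lambda>i. ap (F i) x) p)"
proof (induction p arbitrary: F)
  case (Member i k)
  then show ?case by (simp add: collapse_mem_iff memU_def)
next
  case (Equal i k)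
  then show ?case by (simp add: collapse_eq_iff eqU_def)
next
  case (Neg p)
  then show ?case by (simp add: large_not df_sat_values)
next
  case (Conj p q)
  then show ?case by (simp add: large_conj df_sat_values)
next
  case (Forall i p)
  let ?P = "\<lambda>y x. sat UNIV mem ((\<lambda>k. ap (F k) x)(i := y)) p"
  have "dt (\<lambda>e. if k = i then e 0 else ap (F k) (e (Suc 0)))" for k
    by (intro df_intros)
  from df_sat[OF this, where p = p] have [simp]: "df (\<lambda>e. ?P (a e) (b e))" if "dt a" "dt b" for a b
    using df_subst2[of ?P, OF _ that] by (simp add: fun_upd_def)
  have upd: "(\<lambda>k. collapse (F k))(i := collapse g) = (\<lambda>k. collapse ((F(i := g)) k))" for g
    by auto
  have "sat (range collapse) mem (\<lambda>i. collapse (F i)) (Forall i p) \<longleftrightarrow>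
      (\<forall>g. large (\<lambda>x. ?P (ap g x) x))"
  proof -
    have "(\<lambda>k. ap ((F(i := g)) k) x) = (\<lambda>k. ap (F k) x)(i := ap g x)" for g x
      by auto
    then show ?thesis by (simp add: upd Forall del: fun_upd_apply)
  qed
  also have "\<dots> \<longleftrightarrow> large (\<lambda>x. \<forall>y. ?P y x)"
  proof
    assume all: "\<forall>g. large (\<lambda>x. ?P (ap g x) x)"
    obtain g where g: "\<And>x. x \<epsilon> X \<Longrightarrow> \<exists>y. \<not> ?P y x \<Longrightarrow> \<not> ?P (ap g x) x"
      using class_choice[of "\<lambda>x y. (\<exists>y. \<not> ?P y x) \<longrightarrow> \<not> ?P y x" X] by auto
    from all have "large (\<lambda>x. ?P (ap g x) x)" by blast
    then show "large (\<lambda>x. \<forall>y. ?P y x)"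
    proof (rule large_mono[rotated 2])
      show "\<forall>y. ?P y x" if "x \<epsilon> X" "?P (ap g x) x" for x using g that by blast
    qed (simp_all del: fun_upd_apply)
  next
    assume "large (\<lambda>x. \<forall>y. ?P y x)"
    then show "\<forall>g. large (\<lambda>x. ?P (ap g x) x)"
      by (intro allI, elim large_mono[rotated 2]) auto
  qed
  finally show ?case by simp
qed

definition emb :: "'v \<Rightarrow> 'v" where
  "emb a = collapse (lam X (\<lambda>_. a))"

lemma dt_emb [df_intros, simp]: "dt a \<Longrightarrow> dt (\<lambda>e. emb (a e))"
  by (rule dt_subst1[of emb]) (simp_all add: emb_def)

lemma emb_embedding: "embedding mem emb (range collapse)"
proof (unfold_locales)
  show "definable_map emb"
    unfolding definable_map_def
    by (rule df_class2[of "\<lambda>x y. emb x = y"]) (simp, blast)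
  show "transitive_class (range collapse)"
    unfolding transitive_class_def by (auto simp: mem_collapse)
  show "elementary_embedding emb (range collapse)"
    unfolding elementary_embedding_def
  proof (intro conjI allI)
    show "range emb \<subseteq> range collapse" by (auto simp: emb_def)
    show "sat UNIV mem s p \<longleftrightarrow> sat (range collapse) mem (emb \<circ> s) p" for p s
    proof -
      let ?F = "\<lambda>i. lam X (\<lambda>_. s i)"
      have "sat (range collapse) mem (\<lambda>i. collapse (?F i)) p \<longleftrightarrow> large (\<lambda>x. sat UNIV mem (\<lambda>i. ap (?F i) x) p)"
        by (rule Los)
      also have "\<dots> \<longleftrightarrow> large (\<lambda>x. sat UNIV mem s p)"
        by (rule large_cong) (simp_all add: df_sat_values)
      finally show ?thesis by (simp add: large_const comp_def emb_def)
    qed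
  qed
qed

lemma definable_range_collapse: "definable_class (range collapse)"
  unfolding definable_class_def
  by (rule df_class[of "\<lambda>x. x \<in> range collapse"]) (simp add: image_iff, blast)

text \<open>An element \<open>g\<close> of \<open>j \<beta>\<close> takes almost everywhere one of fewer than \<open>\<delta>\<close> values, so it is almost
  everywhere constant.\<close>

lemma emb_fixes: "\<beta> \<epsilon> \<delta> \<Longrightarrow> emb \<beta> = \<beta>"
proof -
  assume "\<beta> \<epsilon> \<delta>"
  have "\<beta> \<epsilon> \<delta> \<longrightarrow> emb \<beta> = \<beta>"
  proof (rule mem_induct[of "\<lambda>\<beta>. \<beta> \<epsilon> \<delta> \<longrightarrow> emb \<beta> = \<beta>"])
    fix \<beta> assume IH: "\<And>\<gamma>. \<gamma> \<epsilon> \<beta> \<Longrightarrow> \<gamma> \<epsilon> \<delta> \<longrightarrow> emb \<gamma> = \<gamma>"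
    show "\<beta> \<epsilon> \<delta> \<longrightarrow> emb \<beta> = \<beta>"
    proof (intro impI set_ext)
      fix y assume \<beta>: "\<beta> \<epsilon> \<delta>"
      then have fixed: "emb \<gamma> = \<gamma>" if "\<gamma> \<epsilon> \<beta>" for \<gamma>
        using IH that Ord_trans[OF \<delta>_facts(2) \<beta> that] by blast
      interpret embedding mem emb "range collapse" by (rule emb_embedding)
      show "y \<epsilon> emb \<beta> \<longleftrightarrow> y \<epsilon> \<beta>"
      proof
        assume "y \<epsilon> emb \<beta>"
        then obtain g where g: "memU g (lam X (\<lambda>_. \<beta>))" "y = collapse g"
          unfolding emb_def mem_collapse using reps_memU by blast
        have "large (\<lambda>x. \<exists>\<gamma>. \<gamma> \<epsilon> \<beta> \<and> ap g x = \<gamma>)"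
          using g(1) unfolding memU_def by (rule large_mono[rotated 2]) auto
        then obtain \<gamma> where \<gamma>: "\<gamma> \<epsilon> \<beta>" "large (\<lambda>x. ap g x = \<gamma>)"
          using large_ex[OF _ \<beta>, of "\<lambda>\<gamma> x. ap g x = \<gamma>"] by auto
        have "eqU g (lam X (\<lambda>_. \<gamma>))"
          unfolding eqU_def using \<gamma>(2) by (rule large_mono[rotated 2]) auto
        then have "y = emb \<gamma>" using g(2) collapse_eqU by (simp add: emb_def)
        then show "y \<epsilon> \<beta>" using fixed \<gamma>(1) by simp
      next
        assume "y \<epsilon> \<beta>"
        then show "y \<epsilon> emb \<beta>" using fixed j_mem by metis
      qed
    qed
  qed simp
  then show ?thesis using \<open>\<beta> \<epsilon> \<delta>\<close> by blast
qed

end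

section \<open>Strong compactness and covering embeddings\<close>

context ZFC
begin

lemma no_small_superset_of_cardinal:
  assumes "is_initial \<alpha>" "subset \<alpha> x" "le (card x) \<beta>" "\<beta> \<epsilon> \<alpha>"
  shows False
proof -
  have \<alpha>: "Ord \<alpha>" using assms(1) by (rule is_initial_Ord)
  have "le \<alpha> (card x)" using card_le_of_subset[OF assms(2)] card_initial_eq[OF assms(1)] by simp
  moreover have "card x \<epsilon> \<alpha>" using le_mem_trans[OF \<alpha> assms(3,4)] .
  ultimately show False using Ord_trans[OF \<alpha>] mem_irrefl mem_asym unfolding le_def by blast
qed

text \<open>The witness is the class of the identity function in the ultrapower.\<close>

theorem covering_embedding_of_strongly_compact:
  assumes \<delta>: "uncountable_cardinal \<delta>" and \<kappa>: "uncountable_cardinal \<kappa>" and l: "uncountable_cardinal l"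
    and \<kappa>l: "le \<kappa> l" and sc: "strongly_compact \<delta> \<kappa> l"
  shows "covering_embedding_exists \<delta> \<kappa> l"
proof -
  note l' = uncountable_cardinal_facts[OF l] and \<delta>' = uncountable_cardinal_facts[OF \<delta>]
  define X where "X = Pk \<kappa> l"
  obtain U where fine: "fine \<kappa> l U" and U: "complete_filter \<delta> X (Power X) U" "measures X (Power X) U"
    using sc unfolding strongly_compact_def X_def by blast
  interpret ultrapower mem \<delta> X U
    by unfold_locales (fact \<delta> U)+
  interpret embedding mem emb "range collapse" by (rule emb_embedding)
  define D where "D = collapse (lam X (\<lambda>x. x))"
  have D_W: "D \<in> range collapse" by (simp add: D_def)
  have "memU (lam X (\<lambda>x. x)) (lam X (\<lambda>_. X))"
    unfolding memU_def by (rule large_mono[of "\<lambda>x. True"]) (simp_all add: large_const)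
  then have D_X: "D \<epsilon> emb X" unfolding D_def emb_def by (rule collapse_memI)
  have D_l: "emb a \<epsilon> D" if a: "a \<epsilon> l" for a
  proof -
    have "sep X (\<lambda>x. a \<epsilon> x) \<epsilon> U"
      using fine a unfolding fine_def sep_def X_def by blast
    then have "large (\<lambda>x. a \<epsilon> x)" by (simp only: large_def)
    then have "memU (lam X (\<lambda>_. a)) (lam X (\<lambda>x. x))"
      unfolding memU_def by (rule large_mono[rotated 2]) simp_all
    then show ?thesis unfolding D_def emb_def by (rule collapse_memI)
  qed
  have "(\<forall>x. x \<epsilon> X \<longrightarrow> (\<exists>\<alpha>. \<alpha> \<epsilon> \<kappa> \<and> is_initial \<alpha> \<and> eqpoll x \<alpha>)) \<longleftrightarrow>
      (\<forall>x. x \<epsilon> emb X \<longrightarrow> (\<exists>\<alpha>. \<alpha> \<epsilon> emb \<kappa> \<and> initial_W \<alpha> \<and> (\<exists>f\<in>range collapse. bijection f x \<alpha>)))"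
    by (rule transfer) (intro trf_intros)
  moreover have "\<exists>\<alpha>. \<alpha> \<epsilon> \<kappa> \<and> is_initial \<alpha> \<and> eqpoll x \<alpha>" if "x \<epsilon> X" for x
    using that eqpoll_card by (intro exI[of _ "card x"]) (simp add: X_def)
  ultimately obtain \<alpha> where \<alpha>: "\<alpha> \<epsilon> emb \<kappa>" "initial_W \<alpha>" "\<exists>f\<in>range collapse. bijection f D \<alpha>"
    using D_X by blast
  have card_D: "set_structure.card (range collapse) mem D = \<alpha>"
    using card_W_eqI[OF D_W W_trans[OF j_in_W \<alpha>(1)] \<alpha>(2,3)] .

  have fixed: "emb \<beta> = \<beta>" if "Ord \<beta>" "\<not> \<beta> \<epsilon> emb \<beta>" for \<beta>
    using Ord_linear[of "emb \<beta>" \<beta>] that j_Ord j_Ord_not_less by metis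
  have "\<exists>\<beta>. Ord \<beta> \<and> \<beta> \<epsilon> emb \<beta>"
  proof (rule ccontr)
    \<comment> \<open>If \<open>emb\<close> moved no ordinal, \<open>D\<close> would include \<open>l\<close> and have fewer than \<open>\<kappa>\<close> elements.\<close>
    assume none: "\<nexists>\<beta>. Ord \<beta> \<and> \<beta> \<epsilon> emb \<beta>"
    have "subset l D"
    proof (rule subsetI)
      fix a assume a: "a \<epsilon> l"
      have "emb a = a" using fixed[OF Ord_mem[OF l'(2) a]] none Ord_mem[OF l'(2) a] by blast
      then show "a \<epsilon> D" using D_l[OF a] by simp
    qed
    moreover have "\<alpha> \<epsilon> l"
    proof -
      have "Ord \<kappa>" using uncountable_cardinal_facts[OF \<kappa>] by blast
      then have "emb \<kappa> = \<kappa>" using fixed none by blast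
      then show ?thesis using \<alpha>(1) \<kappa>l Ord_trans[OF l'(2)] unfolding le_def by auto
    qed
    moreover have "le (card D) \<alpha>"
    proof -
      have "eqpoll D \<alpha>" using \<alpha>(3) unfolding eqpoll_def by blast
      then have "card D = card \<alpha>" by (rule card_eqpoll)
      then show ?thesis using card_Ord_le[OF Ord_mem[OF l'(2) \<open>\<alpha> \<epsilon> l\<close>]] by simp
    qed
    ultimately show False using no_small_superset_of_cardinal l'(1) by blast
  qed
  then obtain \<beta>' where "Ord \<beta>'" "\<beta>' \<epsilon> emb \<beta>'" by blast
  then have "\<exists>\<beta>. Ord \<beta> \<and> \<beta> \<epsilon> emb \<beta> \<and> (\<forall>\<gamma>. \<gamma> \<epsilon> \<beta> \<longrightarrow> \<not> \<gamma> \<epsilon> emb \<gamma>)"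
    by (intro least_Ord) simp_all
  then obtain \<beta> where \<beta>: "Ord \<beta>" "\<beta> \<epsilon> emb \<beta>" "\<And>\<gamma>. \<gamma> \<epsilon> \<beta> \<Longrightarrow> \<not> \<gamma> \<epsilon> emb \<gamma>" by blast
  then have "critical_point emb \<beta>"
    unfolding critical_point_def le_def using Ord_linear by metis
  moreover have "le \<delta> \<beta>"
  proof -
    have "\<not> \<beta> \<epsilon> \<delta>" using emb_fixes \<beta>(2) mem_irrefl by metis
    then show ?thesis using Ord_linear[OF \<delta>'(2) \<beta>(1)] unfolding le_def by blast
  qed
  ultimately show ?thesis
    unfolding covering_embedding_exists_def
    using definable_j definable_range_collapse transitive_W elementary D_W D_l card_D \<alpha>(1)
    by (intro exI[of _ emb] exI[of _ "range collapse"]) blast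
qed

text \<open>Conversely, the sets \<open>Y\<close> whose image contains the part of \<open>D\<close> below \<open>j l\<close> form the ultrafilter.\<close>

theorem strongly_compact_of_covering_embedding:
  assumes \<delta>: "uncountable_cardinal \<delta>" and \<kappa>: "uncountable_cardinal \<kappa>"
    and cov: "covering_embedding_exists \<delta> \<kappa> l"
  shows "strongly_compact \<delta> \<kappa> l"
proof -
  note \<delta>' = uncountable_cardinal_facts[OF \<delta>] and \<kappa>' = uncountable_cardinal_facts[OF \<kappa>]
  obtain j W \<alpha> D where jW: "definable_map j" "transitive_class W" "elementary_embedding j W"
    and \<alpha>: "critical_point j \<alpha>" "le \<delta> \<alpha>"
    and D: "D \<in> W" "\<And>a. a \<epsilon> l \<Longrightarrow> j a \<epsilon> D" "set_structure.card W mem D \<epsilon> j \<kappa>"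
    using cov unfolding covering_embedding_exists_def by blast
  interpret embedding mem j W by unfold_locales (fact jW)+
  define X where "X = Pk \<kappa> l"

  have fixed: "j \<beta> = \<beta>" if \<beta>: "\<beta> \<epsilon> \<delta>" for \<beta>
  proof -
    have Ord: "Ord \<beta>" using Ord_mem[OF \<delta>'(2) \<beta>] .
    have "Ord \<alpha>" using \<alpha>(1) by (simp add: critical_point_def)
    then have "\<beta> \<epsilon> \<alpha>" using \<alpha>(2) \<beta> Ord_trans unfolding le_def by blast
    then have "\<not> le \<alpha> \<beta>" unfolding le_def using mem_asym mem_irrefl by blast
    then have "\<not> \<beta> \<epsilon> j \<beta>" using \<alpha>(1) Ord unfolding critical_point_def by blast
    then show ?thesis using Ord_linear[of "j \<beta>" \<beta>] Ord j_Ord j_Ord_not_less by metis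
  qed

  \<comment> \<open>Only the part of \<open>D\<close> inside \<open>j l\<close> can be an element of \<open>j X\<close>.\<close>
  obtain D' where D': "D' \<in> W" "\<And>x. x \<epsilon> D' \<longleftrightarrow> x \<epsilon> D \<and> x \<epsilon> j l"
  proof -
    have "(\<forall>d. \<exists>z. (\<forall>x. x \<epsilon> z \<longrightarrow> x \<epsilon> d \<and> x \<epsilon> l) \<and> (\<forall>x. x \<epsilon> d \<longrightarrow> x \<epsilon> l \<longrightarrow> x \<epsilon> z)) \<longleftrightarrow>
        (\<forall>d\<in>W. \<exists>z\<in>W. (\<forall>x. x \<epsilon> z \<longrightarrow> x \<epsilon> d \<and> x \<epsilon> j l) \<and> (\<forall>x. x \<epsilon> d \<longrightarrow> x \<epsilon> j l \<longrightarrow> x \<epsilon> z))"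
      by (rule transfer) (intro trf_intros)
    moreover have "\<exists>z. (\<forall>x. x \<epsilon> z \<longrightarrow> x \<epsilon> d \<and> x \<epsilon> l) \<and> (\<forall>x. x \<epsilon> d \<longrightarrow> x \<epsilon> l \<longrightarrow> x \<epsilon> z)" for d
      by (rule exI[of _ "sep d (\<lambda>x. x \<epsilon> l)"]) simp
    ultimately obtain z where "z \<in> W"
        "(\<forall>x. x \<epsilon> z \<longrightarrow> x \<epsilon> D \<and> x \<epsilon> j l) \<and> (\<forall>x. x \<epsilon> D \<longrightarrow> x \<epsilon> j l \<longrightarrow> x \<epsilon> z)"
      using D(1) by blast
    then show thesis by (intro that[of z]) blast+
  qed
  have D'_X: "D' \<epsilon> j X"
  proof -
    have "(\<forall>d x \<beta>. \<beta> \<epsilon> \<kappa> \<longrightarrow> eqpoll d \<beta> \<longrightarrow> (\<forall>z. z \<epsilon> x \<longrightarrow> z \<epsilon> d \<and> z \<epsilon> l) \<longrightarrow> x \<epsilon> X) \<longleftrightarrow>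
        (\<forall>d\<in>W. \<forall>x\<in>W. \<forall>\<beta>\<in>W. \<beta> \<epsilon> j \<kappa> \<longrightarrow> (\<exists>f\<in>W. bijection f d \<beta>) \<longrightarrow>
          (\<forall>z. z \<epsilon> x \<longrightarrow> z \<epsilon> d \<and> z \<epsilon> j l) \<longrightarrow> x \<epsilon> j X)"
      by (rule transfer) (intro trf_intros)
    moreover have "x \<epsilon> X"
      if "\<beta> \<epsilon> \<kappa>" "eqpoll d \<beta>" "\<forall>z. z \<epsilon> x \<longrightarrow> z \<epsilon> d \<and> z \<epsilon> l" for d x \<beta>
    proof -
      have "le (card x) (card d)" by (rule card_le_of_subset) (use that(3) in \<open>simp add: subset_def\<close>)
      moreover have "le (card d) \<beta>"
        using card_eqpoll[OF that(2)] card_Ord_le[OF Ord_mem[OF \<kappa>'(2) that(1)]] by simp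
      ultimately have "card x \<epsilon> \<kappa>" using le_mem_trans[OF \<kappa>'(2)] that(1) by blast
      then show ?thesis using that(3) by (simp add: X_def subset_def)
    qed
    moreover have "\<exists>f\<in>W. bijection f D (set_structure.card W mem D)"
      by (rule card_W_bijection[OF D(1)])
    ultimately show ?thesis using D(1,3) D' W_trans[OF j_in_W D(3)] by blast
  qed
  \<comment> \<open>Membership of \<open>D'\<close> in \<open>j Y\<close> is definable as \<open>j\<close> is, so this is a set.\<close>
  define U where "U = sep (Power X) (\<lambda>Y. D' \<epsilon> j Y)"
  have U: "Y \<epsilon> U \<longleftrightarrow> subset Y X \<and> D' \<epsilon> j Y" for Y by (simp add: U_def)
  have j_subset: "subset (j Y) (j Z)" if "subset Y Z" for Y Z
  proof -
    have "subset Y Z \<longleftrightarrow> subset (j Y) (j Z)" by (rule transfer) (intro trf_intros)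
    then show ?thesis using that by blast
  qed

  have "complete_filter \<delta> X (Power X) U"
    unfolding complete_filter_def
  proof (intro conjI allI impI)
    show "subset U (Power X)" by (simp add: subset_def U)
    show "X \<epsilon> U" using D'_X by (simp add: U)
    show "\<not> empty \<epsilon> U"
    proof -
      have "(\<forall>x. \<not> x \<epsilon> empty) \<longleftrightarrow> (\<forall>x\<in>W. \<not> x \<epsilon> j empty)" by (rule transfer) (intro trf_intros)
      then show ?thesis using D'(1) by (simp add: U)
    qed
  next
    fix Y Z assume "Y \<epsilon> Power X \<and> Z \<epsilon> Power X \<and> subset Z Y \<and> Z \<epsilon> U"
    then show "Y \<epsilon> U" using subsetD[OF j_subset[of Z Y]] unfolding U mem_Power by blast
  next
    fix \<mu> Y assume Y: "\<mu> \<epsilon> \<delta> \<and> func Y \<mu> U"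
    then have f: "func Y \<mu> U" and \<mu>: "\<mu> \<epsilon> \<delta>" by blast+
    have "\<exists>x. x \<epsilon> X \<and> (\<forall>i. i \<epsilon> \<mu> \<longrightarrow> x \<epsilon> ap Y i)"
    proof (rule ccontr)
      assume no: "\<nexists>x. x \<epsilon> X \<and> (\<forall>i. i \<epsilon> \<mu> \<longrightarrow> x \<epsilon> ap Y i)"
      have "(\<forall>x. x \<epsilon> X \<longrightarrow> (\<exists>i. i \<epsilon> \<mu> \<and> (\<exists>y. pair i y \<epsilon> Y \<and> \<not> x \<epsilon> y))) \<longleftrightarrow>
          (\<forall>x. x \<epsilon> j X \<longrightarrow> (\<exists>i. i \<epsilon> j \<mu> \<and> (\<exists>y\<in>W. pair i y \<epsilon> j Y \<and> \<not> x \<epsilon> y)))"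
        by (rule transfer) (intro trf_intros)
      moreover have "\<exists>i. i \<epsilon> \<mu> \<and> (\<exists>y. pair i y \<epsilon> Y \<and> \<not> x \<epsilon> y)" if "x \<epsilon> X" for x
        using no that func_pair[OF f] by blast
      ultimately obtain i y where i: "i \<epsilon> \<mu>" "pair i y \<epsilon> j Y" "\<not> D' \<epsilon> y"
        using D'_X fixed[OF \<mu>] by auto
      \<comment> \<open>Since \<open>i\<close> is fixed, \<open>j Y\<close> has at \<open>i\<close> the value \<open>j (ap Y i)\<close>.\<close>
      let ?y = "ap Y i"
      have "(\<forall>y. pair i y \<epsilon> Y \<longrightarrow> y = ?y) \<longleftrightarrow> (\<forall>y\<in>W. pair (j i) y \<epsilon> j Y \<longrightarrow> y = j ?y)"
        by (rule transfer) (intro trf_intros)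
      moreover have "j i = i" using fixed Ord_trans[OF \<delta>'(2) \<mu> i(1)] by blast
      ultimately have "y = j ?y"
        using func_pair[OF f] i(2) pair_W_D[OF j_in_W i(2)] by auto
      then show False using func_ap[OF f i(1)] i(3) by (simp add: U)
    qed
    then show "\<exists>x. x \<epsilon> X \<and> (\<forall>i. i \<epsilon> \<mu> \<longrightarrow> x \<epsilon> app Y i)"
      using app_eq_ap[OF f] by auto
  qed
  moreover have "measures X (Power X) U"
    unfolding measures_def
  proof (intro allI impI)
    fix Y assume "Y \<epsilon> Power X"
    have "(\<forall>x. x \<epsilon> X \<longrightarrow> x \<epsilon> Y \<or> x \<epsilon> diff X Y) \<longleftrightarrow> (\<forall>x. x \<epsilon> j X \<longrightarrow> x \<epsilon> j Y \<or> x \<epsilon> j (diff X Y))"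
      by (rule transfer) (intro trf_intros)
    then have "D' \<epsilon> j Y \<or> D' \<epsilon> j (diff X Y)" using D'_X by simp
    then show "Y \<epsilon> U \<or> diff X Y \<epsilon> U" using \<open>Y \<epsilon> Power X\<close> by (auto simp: U subset_def)
  qed
  moreover have "fine \<kappa> l U"
    unfolding fine_def
  proof (intro allI impI)
    fix a assume a: "a \<epsilon> l"
    let ?c = "sep X (\<lambda>x. a \<epsilon> x)"
    have "(\<forall>x. x \<epsilon> X \<longrightarrow> a \<epsilon> x \<longrightarrow> x \<epsilon> ?c) \<longleftrightarrow> (\<forall>x. x \<epsilon> j X \<longrightarrow> j a \<epsilon> x \<longrightarrow> x \<epsilon> j ?c)"
      by (rule transfer) (intro trf_intros)
    moreover have "j a \<epsilon> D'" using D(2)[OF a] a by (simp add: D'(2) j_mem)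
    ultimately have "D' \<epsilon> j ?c" using D'_X by simp
    then have "?c \<epsilon> U" by (simp add: U subset_def)
    then show "setof (\<lambda>x. x \<epsilon> Pk \<kappa> l \<and> a \<epsilon> x) \<epsilon> U" by (simp add: sep_def X_def)
  qed
  ultimately show ?thesis unfolding strongly_compact_def X_def by blast
qed

end

theorem proposition23:
  fixes mem :: "'v \<Rightarrow> 'v \<Rightarrow> bool" and \<delta> \<kappa> l \<mu> :: 'v
  assumes "ZFC mem"
    and "ZFC.uncountable_cardinal mem \<delta>"
    and "ZFC.uncountable_cardinal mem \<kappa>"
    and "ZFC.uncountable_cardinal mem l"
    and "ZFC.le mem \<delta> \<kappa>" and "ZFC.le mem \<kappa> l"
    and "ZFC.regular_cardinal mem \<delta>"
    and "\<mu> = ZFC.cexp mem (ZFC.num mem 2) (ZFC.cexp_less mem l \<kappa>)"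
  shows "(ZFC.compact_cardinal mem \<delta> \<kappa> \<mu> \<longrightarrow> ZFC.filter_extension_property mem \<delta> \<kappa> \<mu>) \<and>
    (ZFC.filter_extension_property mem \<delta> \<kappa> \<mu> \<longrightarrow> ZFC.strongly_compact mem \<delta> \<kappa> l) \<and>
    (ZFC.strongly_compact mem \<delta> \<kappa> l \<longleftrightarrow> ZFC.covering_embedding_exists mem \<delta> \<kappa> l)"
proof (intro conjI impI iffI)
  interpret ZFC mem by (rule assms(1))
  show "filter_extension_property \<delta> \<kappa> \<mu>" if "compact_cardinal \<delta> \<kappa> \<mu>"
    using assms(2,3) that by (rule filter_extension_of_compact)
  show "strongly_compact \<delta> \<kappa> l" if "filter_extension_property \<delta> \<kappa> \<mu>"
    using strongly_compact_of_filter_extension[OF assms(3,4)] that assms(8) by simp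
  show "covering_embedding_exists \<delta> \<kappa> l" if "strongly_compact \<delta> \<kappa> l"
    using assms(2,3,4,6) that by (rule covering_embedding_of_strongly_compact)
  show "strongly_compact \<delta> \<kappa> l" if "covering_embedding_exists \<delta> \<kappa> l"
    using assms(2,3) that by (rule strongly_compact_of_covering_embedding)
qed

end
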